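(* Let $K$ be an algebraically closed field, let $\Gamma=(\Gamma_0,\Gamma_1,\mu,\mathfrak{o})$ be a Brauer configuration, let $\Lambda=K\mathcal{Q}/I$ be the Brauer configuration algebra associated to $\Gamma$, and let $\mathcal{C}_\Lambda=(c_{v,w})_{V,W\in\Gamma_1}$ be the Cartan matrix of $\Lambda$, where $v,w$ denote the vertices of $\mathcal{Q}$ associated to the polygons $V,W$. For a polygon $V$ let $\overline{V}=V\cap\Gamma_0$ be its underlying set of vertices. Then for all $V,W\in\Gamma_1$, \[c_{v,w}=\begin{cases}2+\sum\limits_{\alpha\in\overline{V}}\mathrm{occ}(\alpha,V)\bigl(\mathrm{occ}(\alpha,V)\mu(\alpha)-1\bigr), & V=W,\\[2mm] \sum\limits_{\alpha\in\overline{V}\cap\overline{W}}\mu(\alpha)\,\mathrm{occ}(\alpha,V)\,\mathrm{occ}(\alpha,W), & V\neq W.\end{cases}\]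
   Context: **Brauer configuration.** A Brauer configuration is a tuple $\Gamma=(\Gamma_0,\Gamma_1,\mu,\mathfrak{o})$ where: (1) $\Gamma_0$ is a finite set, whose elements are called vertices; (2) $\Gamma_1$ is a finite collection of finite labeled multisets of vertices, called polygons (two polygons with the same underlying multiset but different labels are different polygons); (3) $\mu:\Gamma_0\to\mathbb{Z}_{>0}$ is a function (the multiplicity function); (4) for $\alpha\in\Gamma_0$ and $V\in\Gamma_1$, $\mathrm{occ}(\alpha,V)$ is the number of times $\alpha$ appears in the multiset $V$, and $\mathrm{val}(\alpha)=\sum_{V\in\Gamma_1}\mathrm{occ}(\alpha,V)$. A vertex $\alpha$ is truncated if $\mathrm{val}(\alpha)=\mu(\alpha)=1$; $\mathcal{T}_\Gamma$ denotes the set of truncated vertices. The orientation $\mathfrak{o}$ is a choice, for each nontruncated vertex $\alpha$, of a cyclic ordering of the list of polygons containing $\alpha$, where each polygon $V$ is listed $\mathrm{occ}(\alpha,V)$ times (so the list has $t=\mathrm{val}(\alpha)$ entries). It is written $\alpha:V_{i_1}<\cdots<V_{i_t}$, with $V_{i_1}$ following $V_{i_t}$, and is considered up to cyclic permutation. It is further required that: every vertex lies in at least one polygon; every polygon has at least two vertices, counted with repetition; every polygon contains at least one vertex $\alpha$ with $\mathrm{val}(\alpha)\mu(\alpha)>1$. The intersection of a set and a multiset is the set of elements common to both, so $V\cap\Gamma_0$ is the underlying set of $V$. **Induced quiver $\mathcal{Q}$.** The vertices of $\mathcal{Q}$ are in bijection with the polygons; the vertex associated to $V$ is denoted $v$.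 For each nontruncated $\alpha$ with ordering $\alpha:V_{i_1}<\cdots<V_{i_t}$, $t=\mathrm{val}(\alpha)$, there are $t$ arrows $a^{(\alpha)}_l:v_{i_l}\to v_{i_{l+1}}$, $1\le l\le t$ (indices modulo $t$; if $t=1$ this is a single loop). Arrows coming from different $\alpha$ or different positions $l$ are distinct, and these are all the arrows of $\mathcal{Q}$. Paths are composed left to right. **Special cycles.** For nontruncated $\alpha$ and $1\le l\le t=\mathrm{val}(\alpha)$, the cycle $C_l=a^{(\alpha)}_l a^{(\alpha)}_{l+1}\cdots a^{(\alpha)}_t a^{(\alpha)}_1\cdots a^{(\alpha)}_{l-1}$ is a special $\alpha$-cycle. Those $C_l$ with $V_{i_l}=V$ are the special $\alpha$-cycles at $v$; there are $\mathrm{occ}(\alpha,V)$ of them. **Brauer configuration algebra.** $\Lambda=K\mathcal{Q}/I$, where $I$ is the two-sided ideal of the path algebra $K\mathcal{Q}$ generated by the following relations. Type one: $C^{\mu(\alpha)}-D^{\mu(\beta)}$, for every polygon $V$, all nontruncated vertices $\alpha,\beta\in V$ (possibly equal), every special $\alpha$-cycle $C$ at $v$ and every special $\beta$-cycle $D$ at $v$. Type two: $C^{\mu(\alpha)}f(C)$, for every nontruncated $\alpha$ and every special $\alpha$-cycle $C$, where $f(C)$ is the first arrow of $C$. Type three: all paths $ab$ of length two ($a,b$ arrows) such that $ab$ is not a subpath of any special cycle, except $ab=a^2$ where $a$ is the loop coming from a vertex $\alpha$ with $\mathrm{val}(\alpha)=1$ and $\mu(\alpha)>1$. **Cartan matrix.**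 For a finite-dimensional $K$-algebra $\Lambda$ with pairwise non-isomorphic indecomposable projective right modules $P_1,\dots,P_n$ (a complete list up to isomorphism), the Cartan matrix is $\mathcal{C}_\Lambda=(c_{i,j})$, where $c_{i,j}$ is the multiplicity of the simple module $P_i/\mathrm{rad}\,P_i$ in a composition series of $P_j$. For the Brauer configuration algebra, the rows and columns are indexed by the vertices $v$ of $\mathcal{Q}$ (equivalently by the polygons $V$), with $P_v=v\Lambda$, where $v$ is also regarded as the corresponding idempotent of $\Lambda$. *)

theory Defs
  imports
    "HOL-Library.Poly_Mapping"
    "HOL-Library.Multiset"
    "HOL-Library.Sublist"
    "HOL-Computational_Algebra.Polynomial"
    "HOL-Algebra.QuotRing"
    "HOL-Algebra.Module"
    "Graph_Theory.Arc_Walk"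
begin

section \<open>Right modules over a ring and the Cartan matrix\<close>

text \<open>
  Right modules are encoded with the record of \<^theory>\<open>HOL-Algebra.Module\<close>: for a right
  \<^term>\<open>R\<close>-module \<^term>\<open>M\<close>, the term \<^term>\<open>r \<odot>\<^bsub>M\<^esub> x\<close> stands for the right action \<open>x r\<close>.
  The fields \<^const>\<open>mult\<close> and \<^const>\<open>one\<close> of that record carry no information for a module.
  The locale \<^locale>\<open>submodule\<close> requires only an additive subgroup closed under the action, so it
  is side-independent.
\<close>

definition principal_right_module :: "('a, 'm) ring_scheme \<Rightarrow> 'a \<Rightarrow> ('a, 'a) module" where
  "principal_right_module R e =
     \<lparr>carrier = {e \<otimes>\<^bsub>R\<^esub> x |x. x \<in> carrier R}, mult = mult R, one = one R,
      zero = zero R, add = add R, smult = (\<lambda>r x. x \<otimes>\<^bsub>R\<^esub> r)\<rparr>"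

definition quotient_module :: "('a, 'b) module \<Rightarrow> 'b set \<Rightarrow> ('a, 'b set) module" where
  "quotient_module M N =
     \<lparr>carrier = a_rcosets\<^bsub>M\<^esub> N, mult = undefined, one = undefined,
      zero = N, add = set_add M, smult = (\<lambda>r X. \<Union>x\<in>X. N +>\<^bsub>M\<^esub> (r \<odot>\<^bsub>M\<^esub> x))\<rparr>"

definition module_iso ::
    "('a, 'm) ring_scheme \<Rightarrow> ('a, 'b) module \<Rightarrow> ('a, 'c) module \<Rightarrow> bool" where
  "module_iso R M N \<longleftrightarrow>
     (\<exists>f \<in> iso (add_monoid M) (add_monoid N).
        \<forall>r\<in>carrier R. \<forall>x\<in>carrier M. f (r \<odot>\<^bsub>M\<^esub> x) = r \<odot>\<^bsub>N\<^esub> f x)"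

definition simple_module :: "('a, 'm) ring_scheme \<Rightarrow> ('a, 'b) module \<Rightarrow> bool" where
  "simple_module R M \<longleftrightarrow>
     carrier M \<noteq> {\<zero>\<^bsub>M\<^esub>} \<and>
     (\<forall>N. submodule N R M \<longrightarrow> N = {\<zero>\<^bsub>M\<^esub>} \<or> N = carrier M)"

definition maximal_submodule ::
    "('a, 'm) ring_scheme \<Rightarrow> ('a, 'b) module \<Rightarrow> 'b set \<Rightarrow> bool" where
  "maximal_submodule R M N \<longleftrightarrow>
     submodule N R M \<and> N \<noteq> carrier M \<and>
     (\<forall>L. submodule L R M \<longrightarrow> N \<subseteq> L \<longrightarrow> L = N \<or> L = carrier M)"

definition module_radical :: "('a, 'm) ring_scheme \<Rightarrow> ('a, 'b) module \<Rightarrow> 'b set" where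
  "module_radical R M = carrier M \<inter> \<Inter>{N. maximal_submodule R M N}"

definition composition_factor :: "('a, 'b) module \<Rightarrow> 'b set list \<Rightarrow> nat \<Rightarrow> ('a, 'b set) module" where
  "composition_factor M Ns i = quotient_module (M\<lparr>carrier := Ns ! Suc i\<rparr>) (Ns ! i)"

definition composition_series ::
    "('a, 'm) ring_scheme \<Rightarrow> ('a, 'b) module \<Rightarrow> 'b set list \<Rightarrow> bool" where
  "composition_series R M Ns \<longleftrightarrow>
     Ns \<noteq> [] \<and> hd Ns = {\<zero>\<^bsub>M\<^esub>} \<and> last Ns = carrier M \<and>
     (\<forall>N\<in>set Ns. submodule N R M) \<and>
     (\<forall>i. Suc i < length Ns \<longrightarrow>
        Ns ! i \<subseteq> Ns ! Suc i \<and> simple_module R (composition_factor M Ns i))"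

text \<open>
  By the Jordan-Hoelder theorem the number below does not depend on the composition series, so
  that the definite description denotes it as soon as \<^term>\<open>M\<close> has a composition series.
\<close>

definition composition_multiplicity ::
    "('a, 'm) ring_scheme \<Rightarrow> ('a, 'c) module \<Rightarrow> ('a, 'b) module \<Rightarrow> nat" where
  "composition_multiplicity R S M =
     (THE m. \<exists>Ns. composition_series R M Ns \<and>
        m = card {i. Suc i < length Ns \<and> module_iso R (composition_factor M Ns i) S})"

text \<open>
  \<^term>\<open>P\<close> is meant to be a complete family of pairwise non-isomorphic indecomposable projective
  right \<^term>\<open>R\<close>-modules.
\<close>

definition cartan_matrix ::
    "('a, 'm) ring_scheme \<Rightarrow> ('i \<Rightarrow> ('a, 'b) module) \<Rightarrow> 'i \<Rightarrow> 'i \<Rightarrow> nat" where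
  "cartan_matrix R P i j =
     composition_multiplicity R (quotient_module (P i) (module_radical R (P i))) (P j)"


section \<open>Path algebras\<close>

text \<open>
  A path is a triple consisting of its source, its list of arrows (read from left to right) and
  its target; the trivial path at \<open>v\<close> is \<open>(v, [], v)\<close>.
\<close>

type_synonym ('v, 'e) qpath = "'v \<times> 'e list \<times> 'v"

definition quiver_paths :: "('v, 'e) pre_digraph \<Rightarrow> ('v, 'e) qpath set" where
  "quiver_paths Q = {(u, p, v). pre_digraph.awalk Q u p v}"

fun path_term_mult ::
    "('v, 'e) qpath \<Rightarrow> 'k \<Rightarrow> ('v, 'e) qpath \<Rightarrow> 'k \<Rightarrow> ('v, 'e) qpath \<Rightarrow>\<^sub>0 'k::field" where
  "path_term_mult (u, p, v) c (u', p', v') d =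
     (if v = u' then Poly_Mapping.single (u, p @ p', v') (c * d) else 0)"

text \<open>The unit element is the sum of the trivial paths, so \<^term>\<open>verts Q\<close> should be finite.\<close>

definition path_algebra :: "('v, 'e) pre_digraph \<Rightarrow> (('v, 'e) qpath \<Rightarrow>\<^sub>0 'k::field) ring" where
  "path_algebra Q =
     \<lparr>carrier = {f. Poly_Mapping.keys f \<subseteq> quiver_paths Q},
      mult = (\<lambda>f g. \<Sum>x\<in>Poly_Mapping.keys f. \<Sum>y\<in>Poly_Mapping.keys g.
                path_term_mult x (Poly_Mapping.lookup f x) y (Poly_Mapping.lookup g y)),
      one = (\<Sum>v\<in>verts Q. Poly_Mapping.single (v, [], v) 1),
      zero = 0,
      add = (+)\<rparr>"


section \<open>Brauer configurations\<close>

text \<open>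
  \<open>polygons\<close> is the set of labels of the polygons, and \<open>corners V\<close> is the multiset of vertices of
  the polygon labelled \<open>V\<close>. The cyclic ordering at a nontruncated vertex \<open>\<alpha>\<close> is given by the list
  \<open>orient \<alpha>\<close>, one of its representatives up to cyclic permutation.
\<close>

record ('a, 'p) brauer_config =
  vertices :: "'a set"
  polygons :: "'p set"
  corners :: "'p \<Rightarrow> 'a multiset"
  mu :: "'a \<Rightarrow> nat"
  orient :: "'a \<Rightarrow> 'p list"

definition occ :: "('a, 'p) brauer_config \<Rightarrow> 'a \<Rightarrow> 'p \<Rightarrow> nat" where
  "occ \<Gamma> \<alpha> V = count (corners \<Gamma> V) \<alpha>"

definition valency :: "('a, 'p) brauer_config \<Rightarrow> 'a \<Rightarrow> nat" where
  "valency \<Gamma> \<alpha> = (\<Sum>V\<in>polygons \<Gamma>. occ \<Gamma> \<alpha> V)"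

definition truncated :: "('a, 'p) brauer_config \<Rightarrow> 'a set" where
  "truncated \<Gamma> = {\<alpha> \<in> vertices \<Gamma>. valency \<Gamma> \<alpha> = 1 \<and> mu \<Gamma> \<alpha> = 1}"

definition nontruncated :: "('a, 'p) brauer_config \<Rightarrow> 'a set" where
  "nontruncated \<Gamma> = vertices \<Gamma> - truncated \<Gamma>"

locale brauer_configuration =
  fixes \<Gamma> :: "('a, 'p) brauer_config"
  assumes finite_vertices: "finite (vertices \<Gamma>)"
    and finite_polygons: "finite (polygons \<Gamma>)"
    and corners_vertices: "\<And>V. V \<in> polygons \<Gamma> \<Longrightarrow> set_mset (corners \<Gamma> V) \<subseteq> vertices \<Gamma>"
    and mu_pos: "\<And>\<alpha>. \<alpha> \<in> vertices \<Gamma> \<Longrightarrow> mu \<Gamma> \<alpha> > 0"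
    and orient_mset: "\<And>\<alpha>. \<alpha> \<in> nontruncated \<Gamma> \<Longrightarrow>
          mset (orient \<Gamma> \<alpha>) = (\<Sum>V\<in>polygons \<Gamma>. replicate_mset (occ \<Gamma> \<alpha> V) V)"
    and vertex_in_polygon: "\<And>\<alpha>. \<alpha> \<in> vertices \<Gamma> \<Longrightarrow> \<exists>V\<in>polygons \<Gamma>. \<alpha> \<in># corners \<Gamma> V"
    and polygon_size: "\<And>V. V \<in> polygons \<Gamma> \<Longrightarrow> size (corners \<Gamma> V) \<ge> 2"
    and polygon_nontruncated:
          "\<And>V. V \<in> polygons \<Gamma> \<Longrightarrow> \<exists>\<alpha>. \<alpha> \<in># corners \<Gamma> V \<and> valency \<Gamma> \<alpha> * mu \<Gamma> \<alpha> > 1"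


section \<open>The Brauer configuration algebra\<close>

text \<open>
  The arrow \<open>a\<^sup>(\<^sup>\<alpha>\<^sup>)\<^sub>l\<close> is the pair \<open>(\<alpha>, l)\<close>. Positions in the cyclic ordering are counted from \<open>0\<close>.
\<close>

definition brauer_quiver :: "('a, 'p) brauer_config \<Rightarrow> ('p, 'a \<times> nat) pre_digraph" where
  "brauer_quiver \<Gamma> =
     \<lparr>verts = polygons \<Gamma>,
      arcs = {(\<alpha>, l). \<alpha> \<in> nontruncated \<Gamma> \<and> l < valency \<Gamma> \<alpha>},
      tail = (\<lambda>(\<alpha>, l). orient \<Gamma> \<alpha> ! l),
      head = (\<lambda>(\<alpha>, l). orient \<Gamma> \<alpha> ! (Suc l mod valency \<Gamma> \<alpha>))\<rparr>"

text \<open>The arrows of the special cycle starting at position \<open>l\<close> of the ordering at \<open>\<alpha>\<close>.\<close>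

definition special_cycle :: "('a, 'p) brauer_config \<Rightarrow> 'a \<Rightarrow> nat \<Rightarrow> ('a \<times> nat) list" where
  "special_cycle \<Gamma> \<alpha> l = map (\<lambda>j. (\<alpha>, (l + j) mod valency \<Gamma> \<alpha>)) [0..<valency \<Gamma> \<alpha>]"

definition special_power :: "('a, 'p) brauer_config \<Rightarrow> 'a \<Rightarrow> nat \<Rightarrow> ('a \<times> nat) list" where
  "special_power \<Gamma> \<alpha> l = concat (replicate (mu \<Gamma> \<alpha>) (special_cycle \<Gamma> \<alpha> l))"

definition special_at :: "('a, 'p) brauer_config \<Rightarrow> 'p \<Rightarrow> ('a \<times> nat) set" where
  "special_at \<Gamma> V =
     {(\<alpha>, l). \<alpha> \<in> nontruncated \<Gamma> \<and> \<alpha> \<in># corners \<Gamma> V \<and> l < valency \<Gamma> \<alpha> \<and> orient \<Gamma> \<alpha> ! l = V}"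

definition relations_one ::
    "('a, 'p) brauer_config \<Rightarrow> (('p, 'a \<times> nat) qpath \<Rightarrow>\<^sub>0 'k::field) set" where
  "relations_one \<Gamma> =
     {Poly_Mapping.single (V, special_power \<Gamma> \<alpha> l, V) 1 -
        Poly_Mapping.single (V, special_power \<Gamma> \<beta> m, V) 1 | V \<alpha> l \<beta> m.
      V \<in> polygons \<Gamma> \<and> (\<alpha>, l) \<in> special_at \<Gamma> V \<and> (\<beta>, m) \<in> special_at \<Gamma> V}"

definition relations_two ::
    "('a, 'p) brauer_config \<Rightarrow> (('p, 'a \<times> nat) qpath \<Rightarrow>\<^sub>0 'k::field) set" where
  "relations_two \<Gamma> =
     {Poly_Mapping.single
        (V, special_power \<Gamma> \<alpha> l @ [hd (special_cycle \<Gamma> \<alpha> l)],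
         head (brauer_quiver \<Gamma>) (hd (special_cycle \<Gamma> \<alpha> l))) 1 | V \<alpha> l.
      V \<in> polygons \<Gamma> \<and> (\<alpha>, l) \<in> special_at \<Gamma> V}"

definition relations_three ::
    "('a, 'p) brauer_config \<Rightarrow> (('p, 'a \<times> nat) qpath \<Rightarrow>\<^sub>0 'k::field) set" where
  "relations_three \<Gamma> =
     {Poly_Mapping.single
        (tail (brauer_quiver \<Gamma>) a, [a, b], head (brauer_quiver \<Gamma>) b) 1 | a b.
      a \<in> arcs (brauer_quiver \<Gamma>) \<and> b \<in> arcs (brauer_quiver \<Gamma>) \<and>
      head (brauer_quiver \<Gamma>) a = tail (brauer_quiver \<Gamma>) b \<and>
      \<not> (\<exists>\<alpha> l. \<alpha> \<in> nontruncated \<Gamma> \<and> l < valency \<Gamma> \<alpha> \<and> sublist [a, b] (special_cycle \<Gamma> \<alpha> l)) \<and>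
      \<not> (\<exists>\<alpha>\<in>vertices \<Gamma>. valency \<Gamma> \<alpha> = 1 \<and> mu \<Gamma> \<alpha> > 1 \<and> a = (\<alpha>, 0) \<and> b = (\<alpha>, 0))}"

text \<open>
  Since the path algebra is unital and its scalars are central, the ring ideal generated by the
  relations is also an ideal of the \<open>K\<close>-algebra.
\<close>

definition brauer_ideal ::
    "('a, 'p) brauer_config \<Rightarrow> (('p, 'a \<times> nat) qpath \<Rightarrow>\<^sub>0 'k::field) set" where
  "brauer_ideal \<Gamma> =
     Idl\<^bsub>path_algebra (brauer_quiver \<Gamma>)\<^esub> (relations_one \<Gamma> \<union> relations_two \<Gamma> \<union> relations_three \<Gamma>)"

definition brauer_algebra ::
    "('a, 'p) brauer_config \<Rightarrow> (('p, 'a \<times> nat) qpath \<Rightarrow>\<^sub>0 'k::field) set ring" where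
  "brauer_algebra \<Gamma> = path_algebra (brauer_quiver \<Gamma>) Quot brauer_ideal \<Gamma>"

definition brauer_idempotent ::
    "('a, 'p) brauer_config \<Rightarrow> 'p \<Rightarrow> (('p, 'a \<times> nat) qpath \<Rightarrow>\<^sub>0 'k::field) set" where
  "brauer_idempotent \<Gamma> V =
     brauer_ideal \<Gamma> +>\<^bsub>path_algebra (brauer_quiver \<Gamma>)\<^esub> Poly_Mapping.single (V, [], V) 1"

text \<open>The ground field \<open>K\<close> is the type passed as first argument.\<close>

definition brauer_cartan_matrix ::
    "'k::field itself \<Rightarrow> ('a, 'p) brauer_config \<Rightarrow> 'p \<Rightarrow> 'p \<Rightarrow> nat" where
  "brauer_cartan_matrix _ \<Gamma> =
     (let \<Lambda> = brauer_algebra \<Gamma> :: (('p, 'a \<times> nat) qpath \<Rightarrow>\<^sub>0 'k) set ring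
      in cartan_matrix \<Lambda> (\<lambda>V. principal_right_module \<Lambda> (brauer_idempotent \<Gamma> V)))"

end

theory Submission
  imports Defs "HOL-Algebra.Embedded_Algebras"
begin

text \<open>
  Call a path reduced if it is trivial, a proper subpath of some \<open>C\<^sup>\<mu>\<close> for a special cycle \<open>C\<close>, or the
  representative chosen at its source among all the \<open>C\<^sup>\<mu>\<close> there. The relations send every path to a
  reduced path or to zero, and this rewriting is compatible with concatenation. Its linear extension
  therefore has a two-sided ideal as kernel, which contains the relations and hence is \<open>I\<close>; so the
  reduced paths form a basis of \<open>\<Lambda>\<close>.

  The arrows span a nilpotent ideal \<open>J\<close> with \<open>e\<^sub>v \<Lambda> \<subseteq> K e\<^sub>v + J\<close>. This makes every simple factor of
  submodules \<open>N \<subset> L\<close> of \<open>e\<^sub>w \<Lambda>\<close> equal to \<open>(N + K y)/N\<close> for some \<open>y = y e\<^sub>i\<close>, which is the simple module at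
  \<open>v\<close> if and only if \<open>i = v\<close>. Along a composition series of \<open>e\<^sub>w \<Lambda>\<close> the dimension of \<open>N e\<^sub>v\<close> thus grows by
  one exactly at the factors isomorphic to that simple module, and \<open>c\<^sub>v\<^sub>w = dim e\<^sub>w \<Lambda> e\<^sub>v\<close> is the number of
  reduced paths from \<open>w\<close> to \<open>v\<close>.
\<close>

section \<open>Right modules and their quotients\<close>

text \<open>A Cartan entry is a definite description over all composition series, so its value
  requires a series as well as a count that does not depend on it. The factors of an arbitrary
  series must therefore be identified, where no basis of paths is at hand; this is why the module
  theory is carried out with bare submodules in an abstract split algebra. Expressing the count as a
  dimension settles the independence without a separate appeal to uniqueness of composition factors.

  On the side of paths the obstacle is a lower bound: the ideal must not collapse more than the
  relations show at first sight. Compatibility of \<open>reduce\<close> with concatenation hinges on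
  a full power of a special cycle being a dead end on both sides. Any arrow before or after it gives
  zero, so exchanging it for the power chosen at the same polygon, possibly around another vertex,
  changes no longer product.\<close>

lemma (in abelian_subgroup) coset_eq_iff:
  assumes "x \<in> carrier G" "y \<in> carrier G"
  shows "H +> x = H +> y \<longleftrightarrow> x \<ominus> y \<in> H"
  using assms a_rcos_module[of y x]
  by (metis a_minus_def a_rcos_self a_repr_independence')

text \<open>Since \<open>r \<odot> x\<close> encodes x r, a product of scalars acts in reverse order
  in \<open>smult_assoc\<close>; over a noncommutative ring this separates right modules from left
  ones.\<close>

locale right_module = R?: ring R + M?: abelian_group M
  for R :: "('a, 'm) ring_scheme" (structure) and M :: "('a, 'b) module" (structure) +
  assumes smult_closed [simp, intro]:
      "\<lbrakk>r \<in> carrier R; x \<in> carrier M\<rbrakk> \<Longrightarrow> r \<odot>\<^bsub>M\<^esub> x \<in> carrier M"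
    and smult_l_distr:
      "\<lbrakk>r \<in> carrier R; s \<in> carrier R; x \<in> carrier M\<rbrakk> \<Longrightarrow>
       (r \<oplus>\<^bsub>R\<^esub> s) \<odot>\<^bsub>M\<^esub> x = r \<odot>\<^bsub>M\<^esub> x \<oplus>\<^bsub>M\<^esub> s \<odot>\<^bsub>M\<^esub> x"
    and smult_r_distr:
      "\<lbrakk>r \<in> carrier R; x \<in> carrier M; y \<in> carrier M\<rbrakk> \<Longrightarrow>
       r \<odot>\<^bsub>M\<^esub> (x \<oplus>\<^bsub>M\<^esub> y) = r \<odot>\<^bsub>M\<^esub> x \<oplus>\<^bsub>M\<^esub> r \<odot>\<^bsub>M\<^esub> y"
    and smult_assoc:
      "\<lbrakk>r \<in> carrier R; s \<in> carrier R; x \<in> carrier M\<rbrakk> \<Longrightarrow>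
       (r \<otimes>\<^bsub>R\<^esub> s) \<odot>\<^bsub>M\<^esub> x = s \<odot>\<^bsub>M\<^esub> (r \<odot>\<^bsub>M\<^esub> x)"
    and smult_one [simp]: "x \<in> carrier M \<Longrightarrow> \<one>\<^bsub>R\<^esub> \<odot>\<^bsub>M\<^esub> x = x"
begin

lemma smult_zero [simp]: "r \<in> carrier R \<Longrightarrow> r \<odot>\<^bsub>M\<^esub> \<zero>\<^bsub>M\<^esub> = \<zero>\<^bsub>M\<^esub>"
  by (metis M.add.l_cancel_one M.r_zero M.zero_closed smult_closed smult_r_distr)

lemma zero_smult [simp]: "x \<in> carrier M \<Longrightarrow> \<zero>\<^bsub>R\<^esub> \<odot>\<^bsub>M\<^esub> x = \<zero>\<^bsub>M\<^esub>"
  by (metis M.add.l_cancel_one R.l_zero R.zero_closed smult_closed smult_l_distr)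

lemma minus_one_smult: "x \<in> carrier M \<Longrightarrow> (\<ominus>\<^bsub>R\<^esub> \<one>\<^bsub>R\<^esub>) \<odot>\<^bsub>M\<^esub> x = \<ominus>\<^bsub>M\<^esub> x"
proof -
  assume x: "x \<in> carrier M"
  have "(\<ominus>\<^bsub>R\<^esub> \<one>\<^bsub>R\<^esub>) \<odot>\<^bsub>M\<^esub> x \<oplus>\<^bsub>M\<^esub> x = (\<ominus>\<^bsub>R\<^esub> \<one>\<^bsub>R\<^esub> \<oplus>\<^bsub>R\<^esub> \<one>\<^bsub>R\<^esub>) \<odot>\<^bsub>M\<^esub> x"
    using x by (simp add: smult_l_distr)
  then show ?thesis
    using x by (simp add: R.l_neg M.minus_equality)
qed

lemma submoduleI:
  assumes "N \<subseteq> carrier M" and "\<zero>\<^bsub>M\<^esub> \<in> N"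
    and "\<And>x y. \<lbrakk>x \<in> N; y \<in> N\<rbrakk> \<Longrightarrow> x \<oplus>\<^bsub>M\<^esub> y \<in> N"
    and smult: "\<And>r x. \<lbrakk>r \<in> carrier R; x \<in> N\<rbrakk> \<Longrightarrow> r \<odot>\<^bsub>M\<^esub> x \<in> N"
  shows "submodule N R M"
proof -
  have "\<ominus>\<^bsub>M\<^esub> x \<in> N" if "x \<in> N" for x
    using smult[of "\<ominus>\<^bsub>R\<^esub> \<one>\<^bsub>R\<^esub>" x] that assms(1) minus_one_smult by auto
  then have "subgroup N (add_monoid M)"
    using assms by (intro subgroup.intro) (auto simp: a_inv_def)
  then show ?thesis
    using smult by (simp add: submodule_def submodule_axioms_def)
qed

lemma submoduleD:
  assumes "submodule N R M"
  shows "N \<subseteq> carrier M" "\<zero>\<^bsub>M\<^esub> \<in> N"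
    and "\<And>x y. \<lbrakk>x \<in> N; y \<in> N\<rbrakk> \<Longrightarrow> x \<oplus>\<^bsub>M\<^esub> y \<in> N"
    and "\<And>r x. \<lbrakk>r \<in> carrier R; x \<in> N\<rbrakk> \<Longrightarrow> r \<odot>\<^bsub>M\<^esub> x \<in> N"
  using submodule.axioms[OF assms] subgroup.subset subgroup.one_closed subgroup.m_closed
  by (fastforce simp: submodule_axioms_def)+

lemma submodule_restrict:
  assumes "submodule N R M"
  shows "right_module R (M\<lparr>carrier := N\<rparr>)"
proof -
  note N = submoduleD[OF assms]
  have "subgroup N (add_monoid M)"
    using assms by (simp add: submodule_def)
  then have "group ((add_monoid M)\<lparr>carrier := N\<rparr>)"
    using M.a_group by (rule subgroup.subgroup_is_group)
  then have "comm_group ((add_monoid M)\<lparr>carrier := N\<rparr>)"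
    using N(1) by (intro group.group_comm_groupI) (auto simp: subset_iff M.a_comm)
  then have "abelian_group (M\<lparr>carrier := N\<rparr>)"
    by (intro comm_group_abelian_groupI) simp
  with N show ?thesis
    by (intro right_module.intro right_module_axioms.intro R.ring_axioms)
       (auto simp: subset_iff smult_l_distr smult_r_distr smult_assoc)
qed

text \<open>A composition factor is a quotient of \<open>M\<lparr>carrier := N\<rparr>\<close>.
  Maximality inside such a restricted module is moved back to submodules of M itself.\<close>

lemma submodule_restrict_iff:
  assumes "submodule N R M"
  shows "submodule L R (M\<lparr>carrier := N\<rparr>) \<longleftrightarrow> submodule L R M \<and> L \<subseteq> N"
proof -
  interpret N: right_module R "M\<lparr>carrier := N\<rparr>"
    using assms by (rule submodule_restrict)
  note N = submoduleD[OF assms]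
  show ?thesis
    using N N.submoduleD[of L] submoduleD[of L]
    by (auto intro!: submoduleI N.submoduleI)
qed

lemma submodule_abelian_subgroup:
  assumes "submodule N R M"
  shows "abelian_subgroup N M"
  using assms M.abelian_group_axioms
  by (intro abelian_subgroupI3) (auto simp: submodule_def additive_subgroup_def)

lemma submodule_carrier: "submodule (carrier M) R M"
  by (intro submoduleI) auto

lemma submodule_zero: "submodule {\<zero>\<^bsub>M\<^esub>} R M"
  by (intro submoduleI) auto

context
  fixes N assumes N: "submodule N R M"
begin

interpretation N: abelian_subgroup N M
  using N by (rule submodule_abelian_subgroup)

lemma quotient_carrier: "carrier (quotient_module M N) = (\<lambda>x. N +>\<^bsub>M\<^esub> x) ` carrier M"
  by (auto simp: quotient_module_def A_RCOSETS_def')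

lemma quotient_add:
  assumes "x \<in> carrier M" "y \<in> carrier M"
  shows "(N +>\<^bsub>M\<^esub> x) \<oplus>\<^bsub>quotient_module M N\<^esub> (N +>\<^bsub>M\<^esub> y) = N +>\<^bsub>M\<^esub> (x \<oplus>\<^bsub>M\<^esub> y)"
  using assms by (simp add: quotient_module_def N.a_rcos_sum)

lemma quotient_zero: "\<zero>\<^bsub>quotient_module M N\<^esub> = N"
  by (simp add: quotient_module_def)

lemma coset_zero: "N +>\<^bsub>M\<^esub> \<zero>\<^bsub>M\<^esub> = N"
  using submoduleD(1)[OF N] by simp

lemma coset_eq_zero_iff: "x \<in> carrier M \<Longrightarrow> N +>\<^bsub>M\<^esub> x = N \<longleftrightarrow> x \<in> N"
  using N.coset_eq_iff[of x "\<zero>\<^bsub>M\<^esub>"] coset_zero M.minus_equality[of "\<zero>\<^bsub>M\<^esub>" "\<zero>\<^bsub>M\<^esub>"]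
  by (simp add: M.minus_eq)

text \<open>Two representatives of a coset differ by an element of N, and the action keeps N inside
  N; so the union defining the action on cosets ranges over one coset repeated.\<close>

lemma quotient_smult:
  assumes r: "r \<in> carrier R" and x: "x \<in> carrier M"
  shows "r \<odot>\<^bsub>quotient_module M N\<^esub> (N +>\<^bsub>M\<^esub> x) = N +>\<^bsub>M\<^esub> (r \<odot>\<^bsub>M\<^esub> x)"
proof -
  have "N +>\<^bsub>M\<^esub> (r \<odot>\<^bsub>M\<^esub> y) = N +>\<^bsub>M\<^esub> (r \<odot>\<^bsub>M\<^esub> x)" if "y \<in> N +>\<^bsub>M\<^esub> x" for y
  proof -
    obtain n where n: "n \<in> N" "y = n \<oplus>\<^bsub>M\<^esub> x"
      using \<open>y \<in> N +>\<^bsub>M\<^esub> x\<close> by (auto simp: a_r_coset_def')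
    have "n \<in> carrier M" "r \<odot>\<^bsub>M\<^esub> n \<in> N"
      using n(1) submoduleD[OF N] r by auto
    then have "r \<odot>\<^bsub>M\<^esub> y \<in> N +>\<^bsub>M\<^esub> (r \<odot>\<^bsub>M\<^esub> x)"
      using n r x by (auto simp: smult_r_distr a_r_coset_def')
    then show ?thesis
      using N.a_repr_independence' r x by simp
  qed
  then show ?thesis
    using UN_constant_eq[OF N.a_rcos_self[OF x], of "\<lambda>y. N +>\<^bsub>M\<^esub> (r \<odot>\<^bsub>M\<^esub> y)"]
    by (simp add: quotient_module_def)
qed

lemma quotient_right_module: "right_module R (quotient_module M N)"
proof -
  have "\<exists>y\<in>carrier M. (N +>\<^bsub>M\<^esub> y) \<oplus>\<^bsub>quotient_module M N\<^esub> (N +>\<^bsub>M\<^esub> x) = N" if "x \<in> carrier M" for x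
    using that coset_zero by (intro bexI[of _ "\<ominus>\<^bsub>M\<^esub> x"]) (simp_all add: quotient_add M.l_neg)
  then have "abelian_group (quotient_module M N)"
  proof (intro abelian_groupI, goal_cases)
    case 2
    show ?case
      using coset_zero M.zero_closed unfolding quotient_carrier quotient_zero by (metis imageI)
  next
    case (5 X)
    then show ?case
      using coset_zero quotient_add[OF M.zero_closed] by (auto simp: quotient_carrier quotient_zero)
  qed (auto simp: quotient_carrier quotient_add quotient_zero M.a_ac)
  then show ?thesis
    by (intro right_module.intro right_module_axioms.intro R.ring_axioms)
       (auto simp: quotient_carrier quotient_add quotient_smult
         smult_l_distr smult_r_distr smult_assoc)
qed

text \<open>The correspondence between submodules of the quotient and submodules containing N, by
  image in one direction and preimage in the other. It trades simple factors for maximal submodules,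
  so that a composition series can be analysed inside the module.\<close>

lemma simple_quotient_iff_maximal:
  "simple_module R (quotient_module M N) \<longleftrightarrow> maximal_submodule R M N"
proof -
  let ?Q = "quotient_module M N"
  interpret Q: right_module R ?Q by (rule quotient_right_module)
  note sub = submoduleD[OF N]
  have zero: "{\<zero>\<^bsub>?Q\<^esub>} = {N}" by (simp add: quotient_zero)
  show ?thesis
  proof
    assume S: "simple_module R ?Q"
    have "N \<noteq> carrier M"
      using S coset_eq_zero_iff coset_zero unfolding simple_module_def quotient_carrier zero by force
    moreover have "L = N \<or> L = carrier M" if L: "submodule L R M" and NL: "N \<subseteq> L" for L
    proof -
      note subL = submoduleD[OF L]
      \<comment> \<open>Because N is contained in L, a coset that meets L lies wholly in L, so the
        image of L determines L.\<close>
      have Lc: "x \<in> L" if "x \<in> carrier M" "N +>\<^bsub>M\<^esub> x \<in> (\<lambda>x. N +>\<^bsub>M\<^esub> x) ` L" for x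
      proof -
        obtain y where y: "y \<in> L" "N +>\<^bsub>M\<^esub> x = N +>\<^bsub>M\<^esub> y" using \<open>N +>\<^bsub>M\<^esub> x \<in> _\<close> by auto
        then have "x \<in> N +>\<^bsub>M\<^esub> y" using N.a_rcos_self that(1) by blast
        then show ?thesis using y(1) NL subL(3) by (auto simp: a_r_coset_def')
      qed
      have "submodule ((\<lambda>x. N +>\<^bsub>M\<^esub> x) ` L) R ?Q"
      proof (rule Q.submoduleI)
        show "(\<lambda>x. N +>\<^bsub>M\<^esub> x) ` L \<subseteq> carrier ?Q" using subL(1) by (auto simp: quotient_carrier)
        show "\<zero>\<^bsub>?Q\<^esub> \<in> (\<lambda>x. N +>\<^bsub>M\<^esub> x) ` L"
          using subL(2) coset_zero unfolding quotient_zero by force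
      qed (use subL in \<open>auto simp: quotient_add quotient_smult subset_iff intro!: imageI\<close>)
      then consider "(\<lambda>x. N +>\<^bsub>M\<^esub> x) ` L = {N}" | "(\<lambda>x. N +>\<^bsub>M\<^esub> x) ` L = carrier ?Q"
        using S unfolding simple_module_def zero by blast
      then show ?thesis
      proof cases
        case 1
        then have "N +>\<^bsub>M\<^esub> x = N" if "x \<in> L" for x using that by blast
        then have "L \<subseteq> N" using coset_eq_zero_iff subL(1) by (metis subset_iff)
        then show ?thesis using NL by blast
      next
        case 2
        then have "carrier M \<subseteq> L" using Lc unfolding quotient_carrier by blast
        then show ?thesis using subL(1) by blast
      qed
    qed
    ultimately show "maximal_submodule R M N"
      using N by (auto simp: maximal_submodule_def)
  next
    assume mx: "maximal_submodule R M N"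
    have "carrier ?Q \<noteq> {N}"
      using mx coset_eq_zero_iff sub(1) unfolding maximal_submodule_def quotient_carrier
      by (metis imageI singletonD subsetI subset_antisym)
    moreover have "H = {N} \<or> H = carrier ?Q" if H: "submodule H R ?Q" for H
    proof -
      note subH = Q.submoduleD[OF H]
      \<comment> \<open>The preimage of H under the quotient map, to which maximality of N
        applies.\<close>
      let ?L = "{x \<in> carrier M. N +>\<^bsub>M\<^esub> x \<in> H}"
      have "submodule ?L R M"
      proof (rule submoduleI)
        show "\<zero>\<^bsub>M\<^esub> \<in> ?L" using subH(2) by (simp add: quotient_zero coset_zero sub(1))
        show "x \<oplus>\<^bsub>M\<^esub> y \<in> ?L" if "x \<in> ?L" "y \<in> ?L" for x y
          using that subH(3)[of "N +>\<^bsub>M\<^esub> x" "N +>\<^bsub>M\<^esub> y"] by (simp add: quotient_add)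
        show "r \<odot>\<^bsub>M\<^esub> x \<in> ?L" if "r \<in> carrier R" "x \<in> ?L" for r x
          using that subH(4)[of r "N +>\<^bsub>M\<^esub> x"] by (simp add: quotient_smult)
      qed auto
      moreover have "N \<subseteq> ?L"
      proof
        fix x assume x: "x \<in> N"
        then have "N +>\<^bsub>M\<^esub> x = N" using coset_eq_zero_iff sub(1) by blast
        then show "x \<in> ?L" using x sub(1) subH(2) by (auto simp: quotient_zero)
      qed
      ultimately consider "?L = N" | "?L = carrier M"
        using mx unfolding maximal_submodule_def by blast
      then show ?thesis
      proof cases
        case 1
        have "X = N" if X: "X \<in> H" for X
        proof -
          obtain x where "x \<in> carrier M" "X = N +>\<^bsub>M\<^esub> x"
            using X subH(1) unfolding quotient_carrier by blast
          then show ?thesis using X 1 coset_eq_zero_iff by auto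
        qed
        then show ?thesis using subH(2) unfolding quotient_zero by blast
      next
        case 2
        then show ?thesis using subH(1) unfolding quotient_carrier by blast
      qed
    qed
    ultimately show "simple_module R ?Q"
      unfolding simple_module_def zero by blast
  qed
qed

end
end

section \<open>Split algebras\<close>

context ring
begin

lemma principal_right_module_mem_iff:
  assumes "e \<in> carrier R" "e \<otimes> e = e"
  shows "x \<in> carrier (principal_right_module R e) \<longleftrightarrow> x \<in> carrier R \<and> e \<otimes> x = x"
  using assms by (auto simp: principal_right_module_def m_assoc[symmetric] intro: exI[of _ x])

lemma principal_right_module_simps [simp]:
  "\<zero>\<^bsub>principal_right_module R e\<^esub> = \<zero>"
  "x \<oplus>\<^bsub>principal_right_module R e\<^esub> y = x \<oplus> y"
  "r \<odot>\<^bsub>principal_right_module R e\<^esub> x = x \<otimes> r"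
  by (simp_all add: principal_right_module_def)

text \<open>Cosets only involve addition, which all submodules of a principal module share with R;
  hence every coset may be computed in R.\<close>

lemma principal_right_module_coset [simp]:
  "a_r_coset (principal_right_module R e\<lparr>carrier := L\<rparr>) = a_r_coset R"
  "a_r_coset (principal_right_module R e) = a_r_coset R"
  by (simp_all add: fun_eq_iff a_r_coset_def' principal_right_module_def)

lemma principal_right_module_is_right_module:
  assumes "e \<in> carrier R" "e \<otimes> e = e"
  shows "right_module R (principal_right_module R e)"
proof -
  have "\<exists>y\<in>carrier (principal_right_module R e). y \<oplus> x = \<zero>" if "x \<in> carrier R" "e \<otimes> x = x" for x
    using that assms
    by (intro bexI[of _ "\<ominus> x"]) (simp_all add: principal_right_module_mem_iff r_minus l_neg)
  then have "abelian_group (principal_right_module R e)"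
    using assms
    by (intro abelian_groupI) (auto simp: principal_right_module_mem_iff r_distr a_ac)
  then show ?thesis
    using assms
    by (intro right_module.intro right_module_axioms.intro ring_axioms)
       (auto simp: principal_right_module_mem_iff l_distr r_distr m_assoc[symmetric])
qed

lemma foldr_mult_closed: "set xs \<subseteq> carrier R \<Longrightarrow> foldr (\<otimes>) xs \<one> \<in> carrier R"
  by (induction xs) auto

end

text \<open>A split basic algebra with a complete set of orthogonal idempotents. The decisive
  condition is \<open>e_decomp\<close>: modulo J, each \<open>e i R\<close> is the line through
  \<open>e i\<close>, so the top of \<open>P i\<close> is one-dimensional over K. Nilpotency is
  phrased with lists of factors to suit inductions on their number.\<close>

locale split_algebra = ring R for R :: "('a, 'm) ring_scheme" (structure) +
  fixes K J :: "'a set" and I :: "'i set" and e :: "'i \<Rightarrow> 'a"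
  assumes subfield: "subfield K R"
    and central: "\<lbrakk>k \<in> K; x \<in> carrier R\<rbrakk> \<Longrightarrow> k \<otimes> x = x \<otimes> k"
    and finite_I: "finite I"
    and e_closed [simp]: "i \<in> I \<Longrightarrow> e i \<in> carrier R"
    and e_idem [simp]: "i \<in> I \<Longrightarrow> e i \<otimes> e i = e i"
    and e_orth: "\<lbrakk>i \<in> I; j \<in> I; i \<noteq> j\<rbrakk> \<Longrightarrow> e i \<otimes> e j = \<zero>"
    and e_nonzero: "i \<in> I \<Longrightarrow> e i \<noteq> \<zero>"
    and e_sum: "(\<Oplus>i\<in>I. e i) = \<one>"
    and ideal_J: "ideal J R"
    and nilpotent_J: "\<exists>n. \<forall>xs. set xs \<subseteq> J \<longrightarrow> length xs = n \<longrightarrow> foldr (\<otimes>) xs \<one> = \<zero>"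
    and e_decomp: "\<lbrakk>i \<in> I; x \<in> carrier R\<rbrakk> \<Longrightarrow> \<exists>k\<in>K. \<exists>z\<in>J. e i \<otimes> x = k \<otimes> e i \<oplus> z"
begin

abbreviation P :: "'i \<Rightarrow> ('a, 'a) module" where "P i \<equiv> principal_right_module R (e i)"

lemma P_mem_iff: "i \<in> I \<Longrightarrow> x \<in> carrier (P i) \<longleftrightarrow> x \<in> carrier R \<and> e i \<otimes> x = x"
  by (simp add: principal_right_module_mem_iff)

lemma P_right_module: "i \<in> I \<Longrightarrow> right_module R (P i)"
  by (simp add: principal_right_module_is_right_module)

lemma J_closed: "J \<subseteq> carrier R"
  using ideal.axioms(1)[OF ideal_J] by (simp add: additive_subgroup.a_subset)

lemma K_closed: "K \<subseteq> carrier R"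
  using subfieldE(3)[OF subfield] .

lemma submodule_PD:
  assumes "w \<in> I" "submodule N R (P w)"
  shows "N \<subseteq> carrier R" "N \<subseteq> carrier (P w)" "\<zero> \<in> N"
    and "\<And>x y. \<lbrakk>x \<in> N; y \<in> N\<rbrakk> \<Longrightarrow> x \<oplus> y \<in> N"
    and "\<And>r x. \<lbrakk>r \<in> carrier R; x \<in> N\<rbrakk> \<Longrightarrow> x \<otimes> r \<in> N"
    and "\<And>x. x \<in> N \<Longrightarrow> \<ominus> x \<in> N"
    and "abelian_subgroup N R"
proof -
  interpret W: right_module R "P w" using assms(1) by (rule P_right_module)
  note N = W.submoduleD[OF assms(2), simplified]
  show "N \<subseteq> carrier (P w)" "\<zero> \<in> N"
    and "\<And>x y. \<lbrakk>x \<in> N; y \<in> N\<rbrakk> \<Longrightarrow> x \<oplus> y \<in> N"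
    and s: "\<And>r x. \<lbrakk>r \<in> carrier R; x \<in> N\<rbrakk> \<Longrightarrow> x \<otimes> r \<in> N"
    using N by auto
  show Nc: "N \<subseteq> carrier R" using N(1) P_mem_iff[OF assms(1)] by auto
  show m: "\<And>x. x \<in> N \<Longrightarrow> \<ominus> x \<in> N"
    using s[of "\<ominus> \<one>"] Nc by (auto simp: subset_iff r_minus)
  show "abelian_subgroup N R"
    using N Nc m
    by (intro abelian_subgroupI3 abelian_group_axioms additive_subgroup.intro subgroup.intro)
       (auto simp: a_inv_def[symmetric])
qed

lemma submodule_PI:
  assumes "w \<in> I" "N \<subseteq> carrier (P w)" "\<zero> \<in> N"
    and "\<And>x y. \<lbrakk>x \<in> N; y \<in> N\<rbrakk> \<Longrightarrow> x \<oplus> y \<in> N"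
    and "\<And>r x. \<lbrakk>r \<in> carrier R; x \<in> N\<rbrakk> \<Longrightarrow> x \<otimes> r \<in> N"
  shows "submodule N R (P w)"
  using assms(2-) by (intro right_module.submoduleI[OF P_right_module[OF assms(1)]]) auto

section \<open>Maximal submodules and radicals of the projectives\<close>

lemma e_notin_J:
  assumes "i \<in> I"
  shows "e i \<notin> J"
proof
  assume "e i \<in> J"
  obtain n where n: "\<And>xs. set xs \<subseteq> J \<Longrightarrow> length xs = n \<Longrightarrow> foldr (\<otimes>) xs \<one> = \<zero>"
    using nilpotent_J by blast
  have "foldr (\<otimes>) (replicate n (e i)) \<one> = \<zero>"
    using \<open>e i \<in> J\<close> by (intro n) (auto simp: set_replicate_conv_if)
  moreover have "e i \<otimes> foldr (\<otimes>) (replicate n (e i)) \<one> = e i" for n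
    using assms by (induction n) auto
  ultimately show False
    using e_nonzero[OF assms] assms by (metis e_closed r_null)
qed

text \<open>If every element of L outside N could be moved by J to another one outside N, iteration
  would give products of arbitrarily many elements of J that do not vanish. So some nonzero class of
  L modulo N is killed by J.\<close>

lemma exists_annihilated_mod:
  assumes x: "x \<in> L" "x \<notin> N" and L: "L \<subseteq> carrier R" "\<And>r x. \<lbrakk>r \<in> carrier R; x \<in> L\<rbrakk> \<Longrightarrow> x \<otimes> r \<in> L"
    and N: "\<zero> \<in> N"
  obtains y where "y \<in> L" "y \<notin> N" "\<And>z. z \<in> J \<Longrightarrow> y \<otimes> z \<in> N"
proof (rule ccontr)
  assume "\<not> thesis"
  with that have descend: "\<exists>z\<in>J. y \<otimes> z \<notin> N" if "y \<in> L" "y \<notin> N" for y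
    using \<open>y \<in> L\<close> \<open>y \<notin> N\<close> by blast
  have "\<exists>xs. set xs \<subseteq> J \<and> length xs = n \<and> y \<otimes> foldr (\<otimes>) xs \<one> \<notin> N" if "y \<in> L" "y \<notin> N" for n y
    using that
  proof (induction n arbitrary: y)
    case 0
    then show ?case using L by (auto simp: subset_iff)
  next
    case (Suc n)
    then obtain z where z: "z \<in> J" "y \<otimes> z \<notin> N" using descend by blast
    then have "z \<in> carrier R" "y \<otimes> z \<in> L" using J_closed L(2) Suc.prems by auto
    then obtain xs where xs: "set xs \<subseteq> J" "length xs = n" "y \<otimes> z \<otimes> foldr (\<otimes>) xs \<one> \<notin> N"
      using Suc.IH z(2) by blast
    then have "y \<otimes> foldr (\<otimes>) (z # xs) \<one> \<notin> N"
      using \<open>z \<in> carrier R\<close> Suc.prems(1) L(1) J_closed foldr_mult_closed[of xs]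
      by (auto simp: m_assoc subset_iff)
    then show ?case using xs z(1) by (intro exI[of _ "z # xs"]) auto
  qed
  then show False
    using nilpotent_J x L(1) N by (metis r_null subsetD)
qed

text \<open>Modulo J the module \<open>P i\<close> is a line, so an element of N outside J can be
  rescaled to \<open>e i \<oplus> z'\<close> with z' in J. Nilpotency then removes z' and puts the
  generator \<open>e i\<close> into N.\<close>

lemma submodule_P_not_in_J:
  assumes i: "i \<in> I" and N: "submodule N R (P i)" and "\<not> N \<subseteq> J"
  shows "N = carrier (P i)"
proof -
  interpret J: ideal J R by (rule ideal_J)
  note sub = submodule_PD[OF i N]
  obtain x where x: "x \<in> N" "x \<notin> J" using assms(3) by blast
  then have xc: "x \<in> carrier R" "e i \<otimes> x = x" using sub(2) P_mem_iff[OF i] by auto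
  obtain k z where kz: "k \<in> K" "z \<in> J" "x = k \<otimes> e i \<oplus> z"
    using e_decomp[OF i xc(1)] xc(2) by auto
  have zc: "z \<in> carrier R" and kc: "k \<in> carrier R" using kz J_closed K_closed by auto
  have "k \<noteq> \<zero>" using kz x(2) i zc by auto
  then obtain k' where k': "k' \<in> K" "k \<otimes> k' = \<one>"
    using subfield_m_inv[OF subfield, of k] kz(1) by blast
  have k'c: "k' \<in> carrier R" using k' K_closed by auto
  define z' where "z' = z \<otimes> k'"
  have z'J: "z' \<in> J" using kz(2) k'c by (simp add: z'_def J.I_r_closed)
  then have z'c: "z' \<in> carrier R" using J_closed by auto
  have "k \<otimes> e i \<otimes> k' = e i"
    using k' kc k'c i central[OF k'(1), of "k \<otimes> e i"] central[OF kz(1) k'c]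
    by (metis e_closed l_one m_assoc m_closed)
  then have x': "x \<otimes> k' = e i \<oplus> z'"
    using kz kc zc k'c i by (simp add: l_distr z'_def)
  \<comment> \<open>Both \<open>x \<otimes> k'\<close> and \<open>e i\<close> lie in
    \<open>e i R\<close>, hence so does z'. A leading factor \<open>e i\<close> is therefore
    absorbed once z' is prepended to a product.\<close>
  have "e i \<otimes> (e i \<oplus> z') = e i \<oplus> z'"
    unfolding x'[symmetric] using xc k'c i by (simp add: m_assoc[symmetric])
  then have ez': "e i \<otimes> z' = z'"
    using i z'c by (simp add: r_distr)
  have y: "e i \<oplus> z' \<in> N" using x' x(1) k'c sub(5) by metis
  \<comment> \<open>As \<open>e\<^sub>i w = (e\<^sub>i + z') w - z' w\<close>, a product \<open>w\<close> of \<open>n\<close> elements of \<open>J\<close> satisfies \<open>e\<^sub>i w \<in> N\<close> as soon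
    as this holds for products of \<open>n + 1\<close> elements.\<close>
  have "e i \<otimes> foldr (\<otimes>) [] \<one> \<in> N"
    if "\<And>xs. set xs \<subseteq> J \<Longrightarrow> length xs = n \<Longrightarrow> e i \<otimes> foldr (\<otimes>) xs \<one> \<in> N" for n
    using that
  proof (induction n)
    case 0
    then show ?case by (metis empty_subsetI list.set(1) list.size(3))
  next
    case (Suc n)
    have "e i \<otimes> foldr (\<otimes>) xs \<one> \<in> N" if xs: "set xs \<subseteq> J" "length xs = n" for xs
    proof -
      let ?w = "foldr (\<otimes>) xs \<one>"
      have w: "?w \<in> carrier R" using xs J_closed by (intro foldr_mult_closed) auto
      have "e i \<otimes> foldr (\<otimes>) (z' # xs) \<one> \<in> N" using Suc.prems[of "z' # xs"] xs z'J by simp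
      moreover have "e i \<otimes> (z' \<otimes> ?w) = z' \<otimes> ?w"
        using ez' w z'c i by (simp add: m_assoc[symmetric])
      ultimately have "\<ominus> (z' \<otimes> ?w) \<in> N" using sub(6) by simp
      moreover have "(e i \<oplus> z') \<otimes> ?w \<in> N" using y w sub(5) by blast
      ultimately have "(e i \<oplus> z') \<otimes> ?w \<oplus> \<ominus> (z' \<otimes> ?w) \<in> N" using sub(4) by blast
      moreover have "(e i \<oplus> z') \<otimes> ?w \<oplus> \<ominus> (z' \<otimes> ?w) = e i \<otimes> ?w"
        using w z'c i by (simp add: l_distr a_assoc r_neg)
      ultimately show ?thesis by simp
    qed
    then show ?case by (rule Suc.IH)
  qed
  then have "e i \<in> N"
    using nilpotent_J sub(3) i by (metis e_closed foldr_Nil id_apply r_null r_one)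
  then have "x \<in> N" if "x \<in> carrier (P i)" for x
    using that sub(5) P_mem_iff[OF i] by metis
  then show ?thesis using sub(2) by blast
qed

text \<open>Every proper submodule lies in J while \<open>e i\<close> does not, so
  \<open>P i\<close> is local and its radical can be read off.\<close>

lemma maximal_submodule_P_iff:
  assumes i: "i \<in> I"
  shows "maximal_submodule R (P i) N \<longleftrightarrow> N = carrier (P i) \<inter> J"
proof -
  interpret J: ideal J R by (rule ideal_J)
  let ?J = "carrier (P i) \<inter> J"
  have sub: "submodule ?J R (P i)"
    using i J_closed
    by (intro submodule_PI)
       (auto simp: P_mem_iff r_distr J.I_r_closed J.a_closed m_assoc[symmetric])
  have "e i \<in> carrier (P i)" using i by (simp add: P_mem_iff)
  then have "?J \<noteq> carrier (P i)" using e_notin_J[OF i] by auto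
  moreover have "N = carrier (P i) \<or> N \<subseteq> ?J" if "submodule N R (P i)" for N
    using submodule_P_not_in_J[OF i that] submodule_PD(2)[OF i that] by blast
  ultimately show ?thesis
    using sub unfolding maximal_submodule_def by blast
qed

lemma radical_P: "i \<in> I \<Longrightarrow> module_radical R (P i) = carrier (P i) \<inter> J"
  by (simp add: module_radical_def maximal_submodule_P_iff)

text \<open>Start from an x in L outside N that J kills modulo N. As the \<open>e i\<close> sum to
  one, some \<open>x \<otimes> e i\<close> stays outside N, and it is still killed because
  \<open>e i \<otimes> z\<close> lies in J for z in J.\<close>

lemma exists_line:
  assumes w: "w \<in> I" and N: "submodule N R (P w)" and L: "submodule L R (P w)"
    and "\<not> L \<subseteq> N"
  obtains i y where "i \<in> I" "y \<in> L" "y \<notin> N" "y \<otimes> e i = y" "\<And>z. z \<in> J \<Longrightarrow> y \<otimes> z \<in> N"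
proof -
  interpret J: ideal J R by (rule ideal_J)
  note subN = submodule_PD[OF w N] and subL = submodule_PD[OF w L]
  obtain x0 where "x0 \<in> L" "x0 \<notin> N" using assms(4) by blast
  then obtain x where x: "x \<in> L" "x \<notin> N" "\<And>z. z \<in> J \<Longrightarrow> x \<otimes> z \<in> N"
    using exists_annihilated_mod[of x0 L N] subL(1,5) subN(3) by blast
  have xc: "x \<in> carrier R" using x(1) subL(1) by blast
  have "\<exists>i\<in>I. x \<otimes> e i \<notin> N"
  proof (rule ccontr)
    assume *: "\<not> (\<exists>i\<in>I. x \<otimes> e i \<notin> N)"
    have "F \<subseteq> I \<Longrightarrow> (\<Oplus>i\<in>F. x \<otimes> e i) \<in> N" if "finite F" for F
      using that
    proof (induction F rule: finite_induct)
      case (insert i F)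
      then have "(\<Oplus>i\<in>insert i F. x \<otimes> e i) = x \<otimes> e i \<oplus> (\<Oplus>i\<in>F. x \<otimes> e i)"
        using xc by (intro finsum_insert) auto
      then show ?case using insert * subN(4) by auto
    qed (simp add: subN(3))
    then have "(\<Oplus>i\<in>I. x \<otimes> e i) \<in> N" using finite_I by simp
    then have "x \<otimes> (\<Oplus>i\<in>I. e i) \<in> N"
      using xc finite_I by (simp add: finsum_rdistr)
    then show False using x(2) xc by (simp add: e_sum)
  qed
  then obtain i where i: "i \<in> I" "x \<otimes> e i \<notin> N" by blast
  show thesis
  proof (rule that[of i "x \<otimes> e i"])
    show "x \<otimes> e i \<in> L" using x(1) subL(5) i by simp
    show "x \<otimes> e i \<otimes> e i = x \<otimes> e i" using i xc by (simp add: m_assoc)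
    show "x \<otimes> e i \<otimes> z \<in> N" if "z \<in> J" for z
    proof -
      have "z \<in> carrier R" "e i \<otimes> z \<in> J" using that i J_closed by (auto simp: J.I_l_closed)
      then show ?thesis using x(3)[of "e i \<otimes> z"] xc i by (simp add: m_assoc)
    qed
  qed (use i in auto)
qed

text \<open>\<open>y\<close> spans a copy of the simple module at \<open>i\<close> modulo \<open>N\<close>.\<close>

definition line_over :: "'a set \<Rightarrow> 'i \<Rightarrow> 'a \<Rightarrow> bool" where
  "line_over N i y \<longleftrightarrow> i \<in> I \<and> y \<notin> N \<and> y \<otimes> e i = y \<and> (\<forall>z\<in>J. y \<otimes> z \<in> N)"

section \<open>Extending a submodule by one line\<close>

context
  fixes w N i y
  assumes w: "w \<in> I" and N: "submodule N R (P w)" and y: "y \<in> carrier (P w)"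
    and line: "line_over N i y"
begin

interpretation J: ideal J R by (rule ideal_J)

private lemmas subN = submodule_PD[OF w N]
interpretation N: abelian_subgroup N R by (rule subN(7))

private lemma i: "i \<in> I" and yN: "y \<notin> N" and ye: "y \<otimes> e i = y"
  and yJ: "\<And>z. z \<in> J \<Longrightarrow> y \<otimes> z \<in> N" and yc: "y \<in> carrier R" "e w \<otimes> y = y"
  using line y w by (auto simp: line_over_def P_mem_iff)

text \<open>Since \<open>y = y \<otimes> e i\<close>, only
  \<open>e i \<otimes> x = k \<otimes> e i \<oplus> z\<close> matters, and y carries z into N. So R
  acts on the class of y through scalars, which makes the line a submodule modulo N.\<close>

lemma line_mult:
  assumes "x \<in> carrier R"
  obtains k n where "k \<in> K" "n \<in> N" "y \<otimes> x = k \<otimes> y \<oplus> n"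
proof -
  obtain k z where kz: "k \<in> K" "z \<in> J" "e i \<otimes> x = k \<otimes> e i \<oplus> z"
    using e_decomp[OF i assms] by blast
  have c: "k \<in> carrier R" "z \<in> carrier R" using kz K_closed J_closed by auto
  have "y \<otimes> x = y \<otimes> (e i \<otimes> x)" using ye yc assms i by (metis m_assoc e_closed)
  also have "\<dots> = y \<otimes> (k \<otimes> e i) \<oplus> y \<otimes> z" using kz c yc i by (simp add: r_distr)
  also have "y \<otimes> (k \<otimes> e i) = k \<otimes> y"
    using central[OF kz(1) yc(1)] ye c yc i by (metis e_closed m_assoc)
  finally show thesis using that kz yJ by blast
qed

text \<open>\<open>line_extension\<close> places scalars on the left while the module action is on
  the right; centrality of K reconciles the two.\<close>

lemma line_extension_mem_iff_mult:
  "x \<in> line_extension K y N \<longleftrightarrow> (\<exists>k\<in>K. \<exists>n\<in>N. x = y \<otimes> k \<oplus> n)"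
  unfolding line_extension_mem_iff using central yc by metis

lemma K_line_in_N_iff: "k \<in> K \<Longrightarrow> k \<otimes> y \<in> N \<longleftrightarrow> k = \<zero>"
proof
  assume k: "k \<in> K" "k \<otimes> y \<in> N"
  show "k = \<zero>"
  proof (rule ccontr)
    assume "k \<noteq> \<zero>"
    then obtain k' where k': "k' \<in> K" "k' \<otimes> k = \<one>"
      using subfield_m_inv[OF subfield, of k] k(1) by blast
    have c: "k \<in> carrier R" "k' \<in> carrier R" using k k' K_closed by auto
    have "(k \<otimes> y) \<otimes> k' = y"
      using k'(2) central[OF k'(1), of "k \<otimes> y"] yc c by (simp add: m_assoc[symmetric])
    then show False using subN(5)[OF c(2) k(2)] yN by simp
  qed
qed (use yc subN(3) in simp)

lemma line_extension_submodule: "submodule (line_extension K y N) R (P w)"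
proof (rule submodule_PI[OF w])
  have Kc: "k \<in> carrier R" if "k \<in> K" for k using that K_closed by auto
  show "line_extension K y N \<subseteq> carrier (P w)"
    using subN(1,2) yc Kc w
    by (auto simp: line_extension_mem_iff_mult P_mem_iff r_distr m_assoc[symmetric] subset_iff)
  have zero: "\<zero> \<in> K" "\<zero> = \<zero> \<otimes> y \<oplus> \<zero>" using subring_props(2)[OF subfield] yc by auto
  then show "\<zero> \<in> line_extension K y N"
    unfolding line_extension_mem_iff using subN(3) by blast
  show add: "a \<oplus> b \<in> line_extension K y N"
    if ab: "a \<in> line_extension K y N" "b \<in> line_extension K y N" for a b
  proof -
    obtain k n k' n' where *: "k \<in> K" "n \<in> N" "a = k \<otimes> y \<oplus> n" "k' \<in> K" "n' \<in> N" "b = k' \<otimes> y \<oplus> n'"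
      using ab unfolding line_extension_mem_iff by blast
    then have "n \<in> carrier R" "n' \<in> carrier R" "k \<in> carrier R" "k' \<in> carrier R"
      using subN(1) Kc by auto
    then have "a \<oplus> b = (k \<oplus> k') \<otimes> y \<oplus> (n \<oplus> n')"
      using * yc by (simp add: l_distr a_ac)
    then show ?thesis
      unfolding line_extension_mem_iff using * subN(4) subring_props(7)[OF subfield] by blast
  qed
  show "a \<otimes> r \<in> line_extension K y N" if r: "r \<in> carrier R" and a: "a \<in> line_extension K y N" for r a
  proof -
    obtain k n where *: "k \<in> K" "n \<in> N" "a = y \<otimes> k \<oplus> n"
      using a unfolding line_extension_mem_iff_mult by blast
    have c: "k \<in> carrier R" "n \<in> carrier R" using * Kc subN(1) by auto
    obtain k' n' where k': "k' \<in> K" "n' \<in> N" "y \<otimes> (k \<otimes> r) = k' \<otimes> y \<oplus> n'"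
      using line_mult[of "k \<otimes> r"] c r by auto
    have c': "k' \<in> carrier R" "n' \<in> carrier R" using k' Kc subN(1) by auto
    have "a \<otimes> r = y \<otimes> (k \<otimes> r) \<oplus> n \<otimes> r" using * c r yc by (simp add: l_distr m_assoc)
    also have "\<dots> = k' \<otimes> y \<oplus> (n' \<oplus> n \<otimes> r)" using k' c c' r yc by (simp add: a_assoc)
    finally show ?thesis
      unfolding line_extension_mem_iff using k' subN(4) subN(5)[OF r *(2)] by blast
  qed
qed

lemma line_extension_contains: "N \<subseteq> line_extension K y N" "y \<in> line_extension K y N"
proof -
  have one: "\<zero> \<in> K" "\<one> \<in> K" using subring_props(2,3)[OF subfield] by auto
  show "N \<subseteq> line_extension K y N"
    unfolding line_extension_mem_iff[abs_def] subset_iff using one yc subN(1)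
    by (metis l_null l_zero subsetD)
  show "y \<in> line_extension K y N"
    unfolding line_extension_mem_iff using one yc subN(3) by (metis l_one r_zero)
qed

lemma line_extension_maximal:
  "maximal_submodule R (P w\<lparr>carrier := line_extension K y N\<rparr>) N"
proof -
  let ?L = "line_extension K y N"
  have L: "submodule ?L R (P w)" by (rule line_extension_submodule)
  note iff = right_module.submodule_restrict_iff[OF P_right_module[OF w] L]
  have "H = N \<or> H = ?L" if H: "submodule H R (P w)" "N \<subseteq> H" "H \<subseteq> ?L" for H
  proof (cases "H \<subseteq> N")
    case False
    note subH = submodule_PD[OF w H(1)]
    obtain x where x: "x \<in> H" "x \<notin> N" using False by blast
    then obtain k n where kn: "k \<in> K" "n \<in> N" "x = k \<otimes> y \<oplus> n"
      using H(3) unfolding subset_iff line_extension_mem_iff by blast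
    have c: "k \<in> carrier R" "n \<in> carrier R" using kn K_closed subN(1) by auto
    \<comment> \<open>An element of H outside N has a nonzero coefficient at y; subtracting n and
      dividing by k brings y itself into H.\<close>
    have "k \<noteq> \<zero>" using kn x c yc by auto
    then obtain k' where k': "k' \<in> K" "k' \<otimes> k = \<one>"
      using subfield_m_inv[OF subfield, of k] kn(1) by blast
    have c': "k' \<in> carrier R" using k' K_closed by auto
    have "x \<oplus> \<ominus> n = k \<otimes> y" using kn c yc by (simp add: a_assoc r_neg)
    then have "k \<otimes> y \<in> H" using x(1) kn(2) H(2) subH(4,6) by (metis subsetD)
    then have "(k \<otimes> y) \<otimes> k' \<in> H" using c' subH(5) by blast
    then have "y \<in> H"
      using k'(2) central[OF k'(1), of "k \<otimes> y"] yc c c' by (simp add: m_assoc[symmetric])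
    then have "?L \<subseteq> H"
      using H(2) subH(4,5) K_closed by (auto simp: line_extension_mem_iff_mult subset_iff)
    then show ?thesis using H(3) by blast
  qed (use H in blast)
  then show ?thesis
    using N yN line_extension_contains unfolding maximal_submodule_def iff by auto
qed

text \<open>By orthogonality \<open>y \<otimes> e v\<close> is y for v = i and zero otherwise, so
  multiplication by \<open>e v\<close> either keeps the new line or erases it.\<close>

lemma line_extension_mult_e:
  assumes v: "v \<in> I"
  shows "(\<lambda>x. x \<otimes> e v) ` line_extension K y N =
    (if v = i then line_extension K y ((\<lambda>x. x \<otimes> e v) ` N) else (\<lambda>x. x \<otimes> e v) ` N)"
proof -
  have one: "\<zero> \<in> K" using subring_props(2)[OF subfield] by auto
  have *: "(k \<otimes> y \<oplus> n) \<otimes> e v = k \<otimes> (y \<otimes> e v) \<oplus> n \<otimes> e v" if "k \<in> K" "n \<in> N" for k n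
    using that K_closed subN(1) v yc by (auto simp: l_distr m_assoc subset_iff)
  have im: "line_extension K a E = (\<lambda>(k, x). k \<otimes> a \<oplus> x) ` (K \<times> E)" for a E
    unfolding set_eq_iff line_extension_mem_iff image_iff by (simp add: split_def)
  have L: "(\<lambda>x. x \<otimes> e v) ` line_extension K y N =
      (\<lambda>(k, n). k \<otimes> (y \<otimes> e v) \<oplus> n \<otimes> e v) ` (K \<times> N)"
    unfolding im image_image using * by (intro image_cong) auto
  show ?thesis
  proof (cases "v = i")
    case True
    have "line_extension K y ((\<lambda>x. x \<otimes> e v) ` N) = (\<lambda>(k, n). k \<otimes> y \<oplus> n \<otimes> e v) ` (K \<times> N)"
      unfolding set_eq_iff line_extension_mem_iff image_iff by (simp add: split_def)
    then show ?thesis using True ye unfolding L by simp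
  next
    case False
    then have "y \<otimes> e v = \<zero>"
      using ye yc i v e_orth by (metis e_closed m_assoc r_null)
    then have "k \<otimes> (y \<otimes> e v) \<oplus> n \<otimes> e v = n \<otimes> e v" if "k \<in> K" "n \<in> N" for k n
      using that K_closed subN(1) v by (auto simp: subset_iff)
    then have "(\<lambda>(k, n). k \<otimes> (y \<otimes> e v) \<oplus> n \<otimes> e v) ` (K \<times> N) = (\<lambda>(k, n). n \<otimes> e v) ` (K \<times> N)"
      by (intro image_cong) auto
    also have "\<dots> = (\<lambda>x. x \<otimes> e v) ` N"
      using one by auto
    finally show ?thesis using False unfolding L by simp
  qed
qed

text \<open>For u = k e + z with e = \<open>e i\<close>, the product y u is k y modulo N, which lies
  in N only for k = 0. So left multiplication by y, from \<open>P i\<close> into the quotient by N,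
  has the radical of \<open>P i\<close> as its kernel.\<close>

lemma line_in_N_iff:
  assumes u: "u \<in> carrier (P i)"
  shows "y \<otimes> u \<in> N \<longleftrightarrow> u \<in> J"
proof
  assume yu: "y \<otimes> u \<in> N"
  have uc: "u \<in> carrier R" "e i \<otimes> u = u" using u P_mem_iff[OF i] by auto
  obtain k z where kz: "k \<in> K" "z \<in> J" "u = k \<otimes> e i \<oplus> z"
    using e_decomp[OF i uc(1)] uc(2) by auto
  have c: "k \<in> carrier R" "z \<in> carrier R" using kz K_closed J_closed by auto
  have "y \<otimes> (k \<otimes> e i) = k \<otimes> y"
    using central[OF kz(1) yc(1)] ye c yc i by (metis e_closed m_assoc)
  then have eq: "y \<otimes> u = k \<otimes> y \<oplus> y \<otimes> z" using kz c yc i by (simp add: r_distr)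
  have "y \<otimes> u \<oplus> \<ominus> (y \<otimes> z) \<in> N" using yu yJ[OF kz(2)] subN(4,6) by blast
  then have "k \<otimes> y \<in> N" using eq c yc by (simp add: a_assoc r_neg)
  then have "k = \<zero>" using K_line_in_N_iff kz(1) by blast
  then show "u \<in> J" using kz c i by simp
qed (use yJ in auto)

end

abbreviation S :: "'i \<Rightarrow> ('a, 'a set) module" where
  "S i \<equiv> quotient_module (P i) (module_radical R (P i))"

text \<open>For v = i, left multiplication by y induces the isomorphism. For v distinct from i, the
  idempotent \<open>e v\<close> annihilates the quotient by N but fixes the nonzero class of
  \<open>e v\<close> in \<open>S v\<close>, which no isomorphism can reconcile.\<close>

lemma line_extension_quotient_iso_iff:
  assumes w: "w \<in> I" and N: "submodule N R (P w)" and y: "y \<in> carrier (P w)"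
    and line: "line_over N i y" and v: "v \<in> I"
  shows "module_iso R (quotient_module (P w\<lparr>carrier := line_extension K y N\<rparr>) N) (S v) \<longleftrightarrow> v = i"
proof -
  interpret J: ideal J R by (rule ideal_J)
  let ?L = "line_extension K y N" and ?Jv = "carrier (P v) \<inter> J"
  let ?PL = "P w\<lparr>carrier := ?L\<rparr>"
  let ?Q = "quotient_module ?PL N"
  note line_facts = w N y line
  have L: "submodule ?L R (P w)" by (rule line_extension_submodule[OF line_facts])
  interpret W: right_module R "P w" using w by (rule P_right_module)
  interpret V: right_module R "P v" using v by (rule P_right_module)
  interpret PL: right_module R ?PL using L by (rule W.submodule_restrict)
  have i: "i \<in> I" and ye: "y \<otimes> e i = y" using line by (auto simp: line_over_def)
  have yc: "y \<in> carrier R" using y P_mem_iff[OF w] by blast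
  have NL: "submodule N R ?PL"
    using N line_extension_contains(1)[OF line_facts] by (simp add: W.submodule_restrict_iff[OF L])
  have Jv: "submodule ?Jv R (P v)"
    using maximal_submodule_P_iff[OF v] unfolding maximal_submodule_def by blast
  have Sv: "S v = quotient_module (P v) ?Jv" by (simp add: radical_P[OF v])
  interpret PN: right_module R ?Q by (rule PL.quotient_right_module[OF NL])
  interpret SV: right_module R "S v" unfolding Sv by (rule V.quotient_right_module[OF Jv])
  note subN = submodule_PD[OF w N] and subL = submodule_PD[OF w L] and subJ = submodule_PD[OF v Jv]
  interpret N: abelian_subgroup N R by (rule subN(7))
  interpret Jv: abelian_subgroup ?Jv R by (rule subJ(7))
  have Pc: "p \<in> carrier R" if "p \<in> carrier (P j)" "j \<in> I" for p j
    using that P_mem_iff by blast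
  have yp: "y \<otimes> p \<in> ?L" if "p \<in> carrier R" for p
    using line_extension_contains(2)[OF line_facts] subL(5) that by blast
  \<comment> \<open>Every class has a representative y p with p in \<open>P i\<close>: the part in N
    disappears, and y k equals \<open>y \<otimes> (e i \<otimes> k)\<close>.\<close>
  have Qc: "carrier ?Q = (\<lambda>p. N +> y \<otimes> p) ` carrier (P i)"
  proof -
    have "\<exists>p\<in>carrier (P i). N +> x = N +> y \<otimes> p" if x: "x \<in> ?L" for x
    proof -
      obtain k n where kn: "k \<in> K" "n \<in> N" "x = y \<otimes> k \<oplus> n"
        using x unfolding line_extension_mem_iff_mult[OF line_facts] by blast
      have c: "k \<in> carrier R" "n \<in> carrier R" using kn K_closed subN(1) by auto
      have *: "y \<otimes> (e i \<otimes> k) = y \<otimes> k"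
        using ye yc c i by (metis e_closed m_assoc)
      have "x \<ominus> y \<otimes> (e i \<otimes> k) = n"
        unfolding * kn(3) using c yc by (simp add: a_minus_def a_ac r_neg r_neg1)
      then have "N +> x = N +> y \<otimes> (e i \<otimes> k)"
        using kn(2) yc c i kn(3) by (subst N.coset_eq_iff) auto
      moreover have "e i \<otimes> k \<in> carrier (P i)" using i c by (simp add: P_mem_iff m_assoc[symmetric])
      ultimately show ?thesis by blast
    qed
    then show ?thesis
      using yp Pc[OF _ i] by (auto simp: PL.quotient_carrier[OF NL] image_iff)
  qed
  have Qadd: "(N +> y \<otimes> p) \<oplus>\<^bsub>?Q\<^esub> (N +> y \<otimes> q) = N +> y \<otimes> (p \<oplus> q)"
    if "p \<in> carrier R" "q \<in> carrier R" for p q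
    using PL.quotient_add[OF NL, of "y \<otimes> p" "y \<otimes> q"] that yp yc by (simp add: r_distr)
  have Qsmult: "r \<odot>\<^bsub>?Q\<^esub> (N +> y \<otimes> p) = N +> y \<otimes> (p \<otimes> r)"
    if "p \<in> carrier R" "r \<in> carrier R" for p r
    using PL.quotient_smult[OF NL, of r "y \<otimes> p"] that yp yc by (simp add: m_assoc)
  have Sc: "carrier (S v) = (\<lambda>p. ?Jv +> p) ` carrier (P v)"
    unfolding Sv using V.quotient_carrier[OF Jv] by simp
  have Sadd: "(?Jv +> p) \<oplus>\<^bsub>S v\<^esub> (?Jv +> q) = ?Jv +> (p \<oplus> q)"
    if "p \<in> carrier (P v)" "q \<in> carrier (P v)" for p q
    unfolding Sv using V.quotient_add[OF Jv that] by simp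
  have Ssmult: "r \<odot>\<^bsub>S v\<^esub> (?Jv +> p) = ?Jv +> p \<otimes> r"
    if "p \<in> carrier (P v)" "r \<in> carrier R" for p r
    unfolding Sv using V.quotient_smult[OF Jv that(2,1)] by simp
  show ?thesis
  proof
    assume iso: "module_iso R ?Q (S v)"
    show "v = i"
    proof (rule ccontr)
      assume "v \<noteq> i"
      obtain g where g: "bij_betw g (carrier ?Q) (carrier (S v))"
        and gs: "\<And>r x. r \<in> carrier R \<Longrightarrow> x \<in> carrier ?Q \<Longrightarrow> g (r \<odot>\<^bsub>?Q\<^esub> x) = r \<odot>\<^bsub>S v\<^esub> g x"
        using iso unfolding module_iso_def iso_def by auto
      have ev: "e v \<in> carrier (P v)" using v by (simp add: P_mem_iff)
      have "?Jv +> e v \<in> carrier (S v)" unfolding Sc using ev by blast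
      then have "?Jv +> e v \<in> g ` carrier ?Q" unfolding bij_betw_imp_surj_on[OF g] .
      then obtain X where X: "X \<in> carrier ?Q" "g X = ?Jv +> e v" by (auto elim: imageE)
      then obtain p where p: "p \<in> carrier (P i)" "X = N +> y \<otimes> p" unfolding Qc by blast
      have pc: "p \<in> carrier R" "e i \<otimes> p = p" using p(1) P_mem_iff[OF i] by auto
      obtain k z where kz: "k \<in> K" "z \<in> J" "p = k \<otimes> e i \<oplus> z"
        using e_decomp[OF i pc(1)] pc(2) by auto
      have c: "k \<in> carrier R" "z \<in> carrier R" using kz K_closed J_closed by auto
      \<comment> \<open>Orthogonality leaves only the part of p in J, and y carries J into
        N.\<close>
      have "p \<otimes> e v = k \<otimes> (e i \<otimes> e v) \<oplus> z \<otimes> e v"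
        using kz(3) c i v by (simp add: l_distr m_assoc)
      also have "\<dots> = z \<otimes> e v" using e_orth[of i v] i v \<open>v \<noteq> i\<close> c by simp
      finally have "p \<otimes> e v \<in> J" using kz(2) v by (simp add: J.I_r_closed)
      moreover have "p \<otimes> e v \<in> carrier (P i)"
        using i v pc by (simp add: P_mem_iff m_assoc[symmetric])
      ultimately have "y \<otimes> (p \<otimes> e v) \<in> N" using line_in_N_iff[OF line_facts] by blast
      then have "e v \<odot>\<^bsub>?Q\<^esub> X = \<zero>\<^bsub>?Q\<^esub>"
        using v p(2) pc Qsmult[of p "e v"] by (simp add: N.a_rcos_const quotient_module_def)
      then have "e v \<odot>\<^bsub>?Q\<^esub> X = \<zero> \<odot>\<^bsub>?Q\<^esub> X" using X(1) by simp
      then have "e v \<odot>\<^bsub>S v\<^esub> g X = \<zero> \<odot>\<^bsub>S v\<^esub> g X"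
        using gs X(1) v by (metis e_closed zero_closed)
      then have "?Jv +> e v = \<zero>\<^bsub>S v\<^esub>"
        using Ssmult[OF ev, of "e v"] X v \<open>?Jv +> e v \<in> carrier (S v)\<close> by simp
      then have "e v \<in> ?Jv"
        using V.coset_eq_zero_iff[OF Jv ev] V.quotient_zero[OF Jv] Sv by simp
      then show False using e_notin_J[OF v] by blast
    qed
  next
    assume vi: "v = i"
    \<comment> \<open>The inverse of \<open>p + rad \<mapsto> y p + N\<close>.\<close>
    define f where "f = (\<lambda>X. {u \<in> carrier (P v). y \<otimes> u \<in> X})"
    have minus: "u \<ominus> p \<in> carrier (P v)" if "u \<in> carrier (P v)" "p \<in> carrier (P v)" for u p
      using that submodule_PD(4,6)[OF v V.submodule_carrier] unfolding a_minus_def by blast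
    have diff: "y \<otimes> u \<ominus> y \<otimes> p \<in> N \<longleftrightarrow> u \<ominus> p \<in> ?Jv"
      if "u \<in> carrier (P v)" "p \<in> carrier (P v)" for u p
    proof -
      have "y \<otimes> u \<ominus> y \<otimes> p = y \<otimes> (u \<ominus> p)"
        using Pc[OF that(1) v] Pc[OF that(2) v] yc by (simp add: a_minus_def r_distr r_minus)
      then show ?thesis
        using line_in_N_iff[OF line_facts, of "u \<ominus> p"] minus[OF that] vi by simp
    qed
    have F: "f (N +> y \<otimes> p) = ?Jv +> p" if p: "p \<in> carrier (P v)" for p
    proof -
      have "u \<in> ?Jv +> p \<Longrightarrow> u \<in> carrier (P v)" for u
        using p v by (auto simp: a_r_coset_def' P_mem_iff r_distr)
      moreover have "y \<otimes> u \<in> N +> y \<otimes> p \<longleftrightarrow> u \<in> ?Jv +> p" if u: "u \<in> carrier (P v)" for u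
        using diff[OF u p] N.a_rcos_module[of "y \<otimes> p" "y \<otimes> u"] Jv.a_rcos_module[of p u]
          Pc[OF u v] Pc[OF p v] yc by (simp add: a_minus_def)
      ultimately show ?thesis unfolding f_def by blast
    qed
    have "f \<in> hom (add_monoid ?Q) (add_monoid (S v))"
    proof (rule homI)
      fix X Y assume "X \<in> carrier (add_monoid ?Q)" "Y \<in> carrier (add_monoid ?Q)"
      then obtain p q where pq: "p \<in> carrier (P v)" "X = N +> y \<otimes> p"
          "q \<in> carrier (P v)" "Y = N +> y \<otimes> q"
        unfolding vi using Qc by auto
      have "p \<oplus> q \<in> carrier (P v)" using pq V.a_closed[of p q] by simp
      then show "f (X \<otimes>\<^bsub>add_monoid ?Q\<^esub> Y) = f X \<otimes>\<^bsub>add_monoid (S v)\<^esub> f Y"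
        using pq Pc[OF _ v] by (simp add: Qadd F Sadd)
    qed (use F Sc in \<open>auto simp: Qc vi\<close>)
    moreover have "bij_betw f (carrier ?Q) (carrier (S v))"
    proof (rule bij_betw_imageI)
      show "inj_on f (carrier ?Q)"
      proof (rule inj_onI)
        fix X Y assume XY: "X \<in> carrier ?Q" "Y \<in> carrier ?Q" "f X = f Y"
        then obtain p q where pq: "p \<in> carrier (P v)" "X = N +> y \<otimes> p"
            "q \<in> carrier (P v)" "Y = N +> y \<otimes> q"
          unfolding vi using Qc by auto
        then have "?Jv +> p = ?Jv +> q" using XY(3) F by simp
        then have "p \<ominus> q \<in> ?Jv" using Jv.coset_eq_iff Pc v pq by blast
        then have "y \<otimes> p \<ominus> y \<otimes> q \<in> N" using diff pq by blast
        then show "X = Y" unfolding pq using N.coset_eq_iff Pc[OF _ v] pq yc by simp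
      qed
      show "f ` carrier ?Q = carrier (S v)"
        unfolding Qc Sc vi[symmetric] image_image using F by (intro image_cong) auto
    qed
    moreover have "f (r \<odot>\<^bsub>?Q\<^esub> X) = r \<odot>\<^bsub>S v\<^esub> f X" if r: "r \<in> carrier R" and X: "X \<in> carrier ?Q" for r X
    proof -
      obtain p where p: "p \<in> carrier (P v)" "X = N +> y \<otimes> p" using X unfolding Qc vi by blast
      have "p \<otimes> r \<in> carrier (P v)" using V.smult_closed[OF r p(1)] by simp
      then show ?thesis using p r Pc[OF _ v] by (simp add: Qsmult F Ssmult)
    qed
    ultimately show "module_iso R ?Q (S v)"
      unfolding module_iso_def iso_def by auto
  qed
qed

end

lemma (in ring) dimension_mono:
  assumes "subfield K R" "dimension m K E" "dimension n K F" "E \<subseteq> F"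
  shows "m \<le> n"
proof -
  obtain Us where "set Us \<subseteq> carrier R" "independent K Us" "length Us = m" "Span K Us = E"
    using exists_base[OF assms(1,2)] by blast
  then show ?thesis
    using independent_length_le_dimension[OF assms(1,3)] Span_base_incl[OF assms(1)] assms(4)
    by blast
qed

section \<open>Multiplicities along a composition series as dimensions\<close>

context split_algebra
begin

lemma line_in_submodule:
  assumes "w \<in> I" "submodule L R (P w)" "N \<subseteq> L" "y \<in> L"
  shows "line_extension K y N \<subseteq> L"
proof -
  note sub = submodule_PD[OF assms(1,2)]
  show ?thesis
  proof
    fix x assume "x \<in> line_extension K y N"
    then obtain k n where kn: "k \<in> K" "n \<in> N" "x = k \<otimes> y \<oplus> n"
      unfolding line_extension_mem_iff by blast
    then have "x = y \<otimes> k \<oplus> n" using central[OF kn(1), of y] assms(4) sub(1) by auto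
    moreover have "y \<otimes> k \<in> L" "n \<in> L" using kn K_closed assms(3,4) sub(5) by auto
    ultimately show "x \<in> L" using sub(4) by simp
  qed
qed

text \<open>The extension by a line found inside L lies strictly above N and within L, so maximality
  makes it equal to L. Hence each step of an arbitrary composition series adds exactly one
  line.\<close>

lemma maximal_imp_line_extension:
  assumes w: "w \<in> I" and L: "submodule L R (P w)"
    and mx: "maximal_submodule R (P w\<lparr>carrier := L\<rparr>) N"
  obtains i y where "line_over N i y" "y \<in> L" "L = line_extension K y N"
proof -
  note iff = right_module.submodule_restrict_iff[OF P_right_module[OF w] L]
  have N: "submodule N R (P w)" "N \<subseteq> L" "N \<noteq> L"
    and max: "\<And>H. submodule H R (P w) \<Longrightarrow> H \<subseteq> L \<Longrightarrow> N \<subseteq> H \<Longrightarrow> H = N \<or> H = L"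
    using mx unfolding maximal_submodule_def iff by auto
  obtain i y where iy: "i \<in> I" "y \<in> L" "y \<notin> N" "y \<otimes> e i = y" "\<And>z. z \<in> J \<Longrightarrow> y \<otimes> z \<in> N"
    using exists_line[OF w N(1) L] N(2,3) by blast
  then have line: "line_over N i y" by (simp add: line_over_def)
  have y: "y \<in> carrier (P w)" using iy(2) submodule_PD(2)[OF w L] by blast
  note facts = w N(1) y line
  have "L = line_extension K y N"
    using max[OF line_extension_submodule[OF facts] line_in_submodule[OF w L N(2) iy(2)]
        line_extension_contains(1)[OF facts]] line_extension_contains(2)[OF facts] iy(3) by blast
  then show thesis using that line iy(2) by blast
qed

text \<open>Stated for the initial parts of an arbitrary series, so that at the last term the count
  becomes the dimension of a space in which the series no longer occurs.\<close>

lemma composition_factor_dimension: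
  assumes w: "w \<in> I" and v: "v \<in> I" and Ns: "composition_series R (P w) Ns"
    and "m < length Ns"
  shows "dimension (card {i. i < m \<and> module_iso R (composition_factor (P w) Ns i) (S v)}) K
    ((\<lambda>x. x \<otimes> e v) ` (Ns ! m))"
  using assms(4)
proof (induction m)
  case 0
  then have "Ns ! 0 = {\<zero>}" using Ns by (simp add: composition_series_def hd_conv_nth)
  then show ?case using v by simp
next
  case (Suc m)
  let ?N = "Ns ! m" and ?L = "Ns ! Suc m"
  let ?iso = "\<lambda>i. module_iso R (composition_factor (P w) Ns i) (S v)"
  have N: "submodule ?N R (P w)" and L: "submodule ?L R (P w)"
    and NL: "?N \<subseteq> ?L" and simple: "simple_module R (composition_factor (P w) Ns m)"
    using Ns Suc.prems by (auto simp: composition_series_def)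
  interpret W: right_module R "P w" using w by (rule P_right_module)
  interpret PL: right_module R "P w\<lparr>carrier := ?L\<rparr>" using L by (rule W.submodule_restrict)
  have "submodule ?N R (P w\<lparr>carrier := ?L\<rparr>)"
    using W.submodule_restrict_iff[OF L] N NL by blast
  then have "maximal_submodule R (P w\<lparr>carrier := ?L\<rparr>) ?N"
    using simple PL.simple_quotient_iff_maximal unfolding composition_factor_def by blast
  then obtain i y where iy: "line_over ?N i y" "y \<in> ?L" "?L = line_extension K y ?N"
    using maximal_imp_line_extension[OF w L] by blast
  have y: "y \<in> carrier (P w)" using iy(2) submodule_PD(2)[OF w L] by blast
  note facts = w N y iy(1) v
  have iso: "?iso m \<longleftrightarrow> v = i"
    using line_extension_quotient_iso_iff[OF facts] by (simp add: composition_factor_def iy(3)[symmetric])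
  have IH: "dimension (card {i. i < m \<and> ?iso i}) K ((\<lambda>x. x \<otimes> e v) ` ?N)"
    using Suc by simp
  have im: "(\<lambda>x. x \<otimes> e v) ` ?L =
      (if v = i then line_extension K y ((\<lambda>x. x \<otimes> e v) ` ?N) else (\<lambda>x. x \<otimes> e v) ` ?N)"
    using line_extension_mult_e[OF facts] iy(3) by simp
  show ?case
  proof (cases "v = i")
    case True
    have "{i. i < Suc m \<and> ?iso i} = insert m {i. i < m \<and> ?iso i}"
      using iso True by (auto simp: less_Suc_eq)
    then have "card {i. i < Suc m \<and> ?iso i} = Suc (card {i. i < m \<and> ?iso i})" by simp
    \<comment> \<open>The image of N under \<open>e v\<close> stays inside N, which y avoids; so y
      is also outside that image and the dimension really increases.\<close>
    moreover have "(\<lambda>x. x \<otimes> e v) ` ?N \<subseteq> ?N" using submodule_PD(5)[OF w N] v by auto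
    then have "y \<notin> (\<lambda>x. x \<otimes> e v) ` ?N" using iy(1) by (auto simp: line_over_def)
    ultimately show ?thesis
      using IH Suc_dim[of y] True im y P_mem_iff[OF w] by simp
  next
    case False
    then have "{i. i < Suc m \<and> ?iso i} = {i. i < m \<and> ?iso i}"
      using iso by (auto simp: less_Suc_eq)
    then show ?thesis using IH im False by simp
  qed
qed

text \<open>Starting from zero, lines are adjoined until \<open>P w\<close> is reached. Each one
  raises the dimension k of the last term, which d bounds, so \<open>d - k\<close>
  decreases.\<close>

lemma composition_series_exists:
  assumes w: "w \<in> I" and d: "dimension d K (carrier (P w))"
  shows "\<exists>Ns. composition_series R (P w) Ns"
proof -
  interpret W: right_module R "P w" using w by (rule P_right_module)
  let ?series = "\<lambda>N Ns. Ns \<noteq> [] \<and> hd Ns = {\<zero>} \<and> last Ns = N \<and> (\<forall>N\<in>set Ns. submodule N R (P w)) \<and>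
     (\<forall>i. Suc i < length Ns \<longrightarrow>
        Ns ! i \<subseteq> Ns ! Suc i \<and> simple_module R (composition_factor (P w) Ns i))"
  have "\<exists>Ns. ?series (carrier (P w)) Ns"
    if "?series N Ns" "dimension k K N" for k N Ns
    using that
  proof (induction "d - k" arbitrary: k N Ns rule: less_induct)
    case less
    have N: "submodule N R (P w)" using less.prems(1) by force
    show ?case
    proof (cases "carrier (P w) \<subseteq> N")
      case True
      then have "N = carrier (P w)" using submodule_PD(2)[OF w N] by blast
      then show ?thesis using less.prems(1) by blast
    next
      case False
      then obtain i y where iy: "i \<in> I" "y \<in> carrier (P w)" "y \<notin> N" "y \<otimes> e i = y"
          "\<And>z. z \<in> J \<Longrightarrow> y \<otimes> z \<in> N"
        using exists_line[OF w N W.submodule_carrier] by blast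
      then have line: "line_over N i y" by (simp add: line_over_def)
      note facts = w N iy(2) line
      let ?L = "line_extension K y N"
      have L: "submodule ?L R (P w)" by (rule line_extension_submodule[OF facts])
      have dL: "dimension (Suc k) K ?L"
        using less.prems(2) iy(2,3) P_mem_iff[OF w] by (intro Suc_dim) auto
      then have "Suc k \<le> d"
        using dimension_mono[OF subfield dL d] submodule_PD(2)[OF w L] by blast
      moreover have "?series ?L (Ns @ [?L])"
      proof -
        interpret PL: right_module R "P w\<lparr>carrier := ?L\<rparr>" using L by (rule W.submodule_restrict)
        have mx: "maximal_submodule R (P w\<lparr>carrier := ?L\<rparr>) N"
          by (rule line_extension_maximal[OF facts])
        then have "simple_module R (quotient_module (P w\<lparr>carrier := ?L\<rparr>) N)"
          using PL.simple_quotient_iff_maximal by (simp add: maximal_submodule_def)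
        moreover have "Ns ! (length Ns - 1) = N" "Ns \<noteq> []"
          using less.prems(1) by (auto simp: last_conv_nth)
        ultimately have "(Ns @ [?L]) ! i \<subseteq> (Ns @ [?L]) ! Suc i \<and>
            simple_module R (composition_factor (P w) (Ns @ [?L]) i)"
          if "Suc i < length (Ns @ [?L])" for i
        proof (cases "Suc i < length Ns")
          case True
          then show ?thesis using less.prems(1) by (simp add: composition_factor_def nth_append)
        next
          case False
          then have "i = length Ns - 1" "Suc i = length Ns" using that by auto
          then show ?thesis
            using \<open>simple_module R _\<close> \<open>Ns ! _ = N\<close> \<open>Ns \<noteq> []\<close> line_extension_contains(1)[OF facts]
            by (simp add: composition_factor_def nth_append)
        qed
        then show ?thesis using less.prems(1) L by auto
      qed
      ultimately show ?thesis using less.hyps[of "Suc k" "Ns @ [?L]" ?L] dL by simp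
    qed
  qed
  moreover have "?series {\<zero>} [{\<zero>}]" using W.submodule_zero by simp
  ultimately have "\<exists>Ns. ?series (carrier (P w)) Ns" using zero_dim by blast
  then show ?thesis by (simp add: composition_series_def)
qed

text \<open>Each series yields the count n, since n is a dimension independent of the series, and a
  series exists; the definite description in \<open>composition_multiplicity\<close> therefore
  denotes n.\<close>

theorem cartan_matrix_eq_dimension:
  assumes v: "v \<in> I" and w: "w \<in> I" and d: "dimension d K (carrier (P w))"
    and n: "dimension n K ((\<lambda>x. x \<otimes> e v) ` carrier (P w))"
  shows "cartan_matrix R P v w = n"
proof -
  have "card {i. Suc i < length Ns \<and> module_iso R (composition_factor (P w) Ns i) (S v)} = n"
    if Ns: "composition_series R (P w) Ns" for Ns
  proof -
    define m where "m = length Ns - 1"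
    have m: "m < length Ns" "Ns ! m = carrier (P w)"
      using Ns by (auto simp: composition_series_def m_def last_conv_nth)
    have "{i. Suc i < length Ns \<and> module_iso R (composition_factor (P w) Ns i) (S v)} =
        {i. i < m \<and> module_iso R (composition_factor (P w) Ns i) (S v)}"
      by (auto simp: m_def)
    then show ?thesis
      using dimension_is_inj[OF subfield composition_factor_dimension[OF w v Ns m(1), unfolded m(2)] n]
      by simp
  qed
  then show ?thesis
    using composition_series_exists[OF w d]
    unfolding cartan_matrix_def composition_multiplicity_def by (intro the_equality) blast+
qed

end

section \<open>The path algebra\<close>

text \<open>f is the sum of its one-term parts. Keeping supports inside A allows additive statements
  that concern actual paths only to be checked on multiples of single paths.\<close>

lemma poly_mapping_additive_induct [consumes 1, case_names zero single add]:
  fixes f :: "'x \<Rightarrow>\<^sub>0 'k::comm_monoid_add"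
  assumes "Poly_Mapping.keys f \<subseteq> A"
    and "P 0" and "\<And>x c. x \<in> A \<Longrightarrow> P (Poly_Mapping.single x c)"
    and "\<And>f g. \<lbrakk>Poly_Mapping.keys f \<subseteq> A; Poly_Mapping.keys g \<subseteq> A; P f; P g\<rbrakk> \<Longrightarrow> P (f + g)"
  shows "P f"
proof -
  have *: "Poly_Mapping.keys (\<Sum>x\<in>B. Poly_Mapping.single x (Poly_Mapping.lookup f x)) \<subseteq> A \<and>
      P (\<Sum>x\<in>B. Poly_Mapping.single x (Poly_Mapping.lookup f x))"
    if "finite B" "B \<subseteq> A" for B
    using that
  proof (induction B rule: finite_induct)
    case (insert x B)
    let ?s = "Poly_Mapping.single x (Poly_Mapping.lookup f x)"
    let ?S = "\<Sum>x\<in>B. Poly_Mapping.single x (Poly_Mapping.lookup f x)"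
    have "Poly_Mapping.keys ?s \<subseteq> A" "P ?s" "Poly_Mapping.keys ?S \<subseteq> A" "P ?S"
      using insert assms(3) by auto
    then have "P (?s + ?S)" "Poly_Mapping.keys (?s + ?S) \<subseteq> A"
      using assms(4) Poly_Mapping.keys_add[of ?s ?S] by blast+
    then show ?case using insert.hyps by simp
  qed (simp add: assms(2))
  have "f = (\<Sum>x\<in>Poly_Mapping.keys f. Poly_Mapping.single x (Poly_Mapping.lookup f x))"
    by (rule poly_mapping_eqI)
      (auto simp: lookup_sum lookup_single when_def not_in_keys_iff_lookup_eq_zero sum.delta')
  then show ?thesis using *[OF finite_keys assms(1)] by metis
qed

text \<open>Concatenation of triples makes sense without a quiver, so bilinearity and associativity
  can be proved for all formal sums and are inherited by every path algebra.\<close>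

definition path_mult ::
  "(('v, 'e) qpath \<Rightarrow>\<^sub>0 'k::field) \<Rightarrow> (('v, 'e) qpath \<Rightarrow>\<^sub>0 'k) \<Rightarrow> (('v, 'e) qpath \<Rightarrow>\<^sub>0 'k)" where
  "path_mult f g = (\<Sum>x\<in>Poly_Mapping.keys f. \<Sum>y\<in>Poly_Mapping.keys g.
     path_term_mult x (Poly_Mapping.lookup f x) y (Poly_Mapping.lookup g y))"

lemma path_term_mult_simps [simp]:
  "path_term_mult x 0 y d = 0" "path_term_mult x c y 0 = 0"
  by (cases x; cases y; simp)+

lemma path_term_mult_add:
  "path_term_mult x (c + c') y d = path_term_mult x c y d + path_term_mult x c' y d"
  "path_term_mult x c y (d + d') = path_term_mult x c y d + path_term_mult x c y d'"
  by (cases x; cases y; simp add: algebra_simps single_add)+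

text \<open>Terms may cancel in a sum, so f, f' and f + f' can have different supports; over a
  common finite superset bilinearity becomes termwise.\<close>

lemma path_mult_superset:
  assumes "finite A" "Poly_Mapping.keys f \<subseteq> A" "finite B" "Poly_Mapping.keys g \<subseteq> B"
  shows "path_mult f g = (\<Sum>x\<in>A. \<Sum>y\<in>B.
     path_term_mult x (Poly_Mapping.lookup f x) y (Poly_Mapping.lookup g y))"
proof -
  have "path_mult f g = (\<Sum>x\<in>Poly_Mapping.keys f. \<Sum>y\<in>B.
     path_term_mult x (Poly_Mapping.lookup f x) y (Poly_Mapping.lookup g y))"
    unfolding path_mult_def using assms
    by (intro sum.cong refl sum.mono_neutral_left) (auto simp: not_in_keys_iff_lookup_eq_zero)
  also have "\<dots> = (\<Sum>x\<in>A. \<Sum>y\<in>B.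
     path_term_mult x (Poly_Mapping.lookup f x) y (Poly_Mapping.lookup g y))"
    using assms by (intro sum.mono_neutral_left) (auto simp: not_in_keys_iff_lookup_eq_zero)
  finally show ?thesis .
qed

lemma path_mult_add:
  "path_mult (f + f') g = path_mult f g + path_mult f' g"
  "path_mult f (g + g') = path_mult f g + path_mult f g'"
proof -
  note sup = path_mult_superset[of "Poly_Mapping.keys f \<union> Poly_Mapping.keys f'" _ "Poly_Mapping.keys g"]
  show "path_mult (f + f') g = path_mult f g + path_mult f' g"
    using Poly_Mapping.keys_add[of f f']
    by (simp add: sup lookup_add path_term_mult_add sum.distrib)
  note sup = path_mult_superset[of "Poly_Mapping.keys f" _ "Poly_Mapping.keys g \<union> Poly_Mapping.keys g'"]
  show "path_mult f (g + g') = path_mult f g + path_mult f g'"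
    using Poly_Mapping.keys_add[of g g']
    by (simp add: sup lookup_add path_term_mult_add sum.distrib)
qed

lemma path_mult_zero [simp]: "path_mult 0 g = 0" "path_mult f 0 = 0"
  by (simp_all add: path_mult_def)

lemma path_mult_sum_left: "path_mult (\<Sum>a\<in>A. f a) g = (\<Sum>a\<in>A. path_mult (f a) g)"
  by (induction A rule: infinite_finite_induct) (simp_all add: path_mult_add)

lemma path_mult_sum_right: "path_mult g (\<Sum>a\<in>A. f a) = (\<Sum>a\<in>A. path_mult g (f a))"
  by (induction A rule: infinite_finite_induct) (simp_all add: path_mult_add)

lemma path_mult_single [simp]:
  "path_mult (Poly_Mapping.single x c) (Poly_Mapping.single y d) = path_term_mult x c y d"
  using path_mult_superset[of "{x}" "Poly_Mapping.single x c" "{y}" "Poly_Mapping.single y d"]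
  by simp

lemma path_mult_assoc:
  fixes f g h :: "('v, 'e) qpath \<Rightarrow>\<^sub>0 'k::field"
  shows "path_mult (path_mult f g) h = path_mult f (path_mult g h)"
proof -
  have "path_mult (path_mult (Poly_Mapping.single x a) (Poly_Mapping.single y b)) (Poly_Mapping.single z c) =
      path_mult (Poly_Mapping.single x a) (path_mult (Poly_Mapping.single y b) (Poly_Mapping.single z c))"
    for x y z :: "('v, 'e) qpath" and a b c :: 'k
    by (cases x; cases y; cases z) (auto simp: mult.assoc)
  then have "path_mult (path_mult (Poly_Mapping.single x a) (Poly_Mapping.single y b)) h =
      path_mult (Poly_Mapping.single x a) (path_mult (Poly_Mapping.single y b) h)" for x y a b
    by (induction rule: poly_mapping_additive_induct[OF subset_UNIV, of _ h]) (simp_all add: path_mult_add)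
  then have "path_mult (path_mult (Poly_Mapping.single x a) g) h =
      path_mult (Poly_Mapping.single x a) (path_mult g h)" for x a
    by (induction rule: poly_mapping_additive_induct[OF subset_UNIV, of _ g]) (simp_all add: path_mult_add)
  then show ?thesis
    by (induction rule: poly_mapping_additive_induct[OF subset_UNIV, of _ f]) (simp_all add: path_mult_add)
qed

lemma path_algebra_simps [simp]:
  "carrier (path_algebra Q) = {f. Poly_Mapping.keys f \<subseteq> quiver_paths Q}"
  "\<one>\<^bsub>path_algebra Q\<^esub> = (\<Sum>v\<in>verts Q. Poly_Mapping.single (v, [], v) 1)"
  "\<zero>\<^bsub>path_algebra Q\<^esub> = 0"
  "f \<oplus>\<^bsub>path_algebra Q\<^esub> g = f + g"
  "f \<otimes>\<^bsub>path_algebra Q\<^esub> g = path_mult f g"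
  by (simp_all add: path_algebra_def path_mult_def)

lemma keys_sum_subset:
  "(\<And>a. a \<in> A \<Longrightarrow> Poly_Mapping.keys (f a) \<subseteq> B) \<Longrightarrow> Poly_Mapping.keys (\<Sum>a\<in>A. f a) \<subseteq> B"
proof (induction A rule: infinite_finite_induct)
  case (insert x A)
  then show ?case using Poly_Mapping.keys_add[of "f x" "sum f A"] by fastforce
qed auto

context wf_digraph
begin

lemma path_concat:
  assumes "(u, p, v) \<in> quiver_paths G" "(v, q, w) \<in> quiver_paths G"
  shows "(u, p @ q, w) \<in> quiver_paths G"
  using assms by (auto simp: quiver_paths_def intro: awalk_appendI)

lemma path_mult_closed:
  assumes "Poly_Mapping.keys f \<subseteq> quiver_paths G" "Poly_Mapping.keys g \<subseteq> quiver_paths G"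
  shows "Poly_Mapping.keys (path_mult f g) \<subseteq> quiver_paths G"
proof -
  have "Poly_Mapping.keys (path_term_mult x c y d) \<subseteq> quiver_paths G"
    if "x \<in> quiver_paths G" "y \<in> quiver_paths G" for x c y d
    using that path_concat by (cases x; cases y) auto
  then show ?thesis
    unfolding path_mult_def using assms by (intro keys_sum_subset) blast
qed

text \<open>The coefficient c is left general: c = 1 gives the unit laws, arbitrary c the action of
  the ground field.\<close>

lemma sum_trivial_mult:
  assumes "finite (verts G)" "(u, p, w) \<in> quiver_paths G"
  shows "path_mult (\<Sum>v\<in>verts G. Poly_Mapping.single (v, [], v) c) (Poly_Mapping.single (u, p, w) d) =
      Poly_Mapping.single (u, p, w) (c * d)"
    and "path_mult (Poly_Mapping.single (u, p, w) d) (\<Sum>v\<in>verts G. Poly_Mapping.single (v, [], v) c) =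
      Poly_Mapping.single (u, p, w) (d * c)"
  using assms
  by (auto simp: path_mult_sum_left path_mult_sum_right sum.delta sum.delta' quiver_paths_def
      dest: awalk_hd_in_verts awalk_last_in_verts)

lemma path_algebra_ring:
  assumes "finite (verts G)"
  shows "ring (path_algebra G :: (('a, 'b) qpath \<Rightarrow>\<^sub>0 'k::field) ring)" (is "ring ?A")
proof (rule ringI)
  have neg: "Poly_Mapping.keys (- f) = Poly_Mapping.keys f" for f :: "('a, 'b) qpath \<Rightarrow>\<^sub>0 'k"
    by (auto simp: in_keys_iff)
  show "abelian_group ?A"
  proof (rule abelian_groupI)
    fix f assume "f \<in> carrier ?A"
    then show "\<exists>g\<in>carrier ?A. g \<oplus>\<^bsub>?A\<^esub> f = \<zero>\<^bsub>?A\<^esub>"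
      by (intro bexI[of _ "- f"]) (simp_all add: neg)
  qed (use Poly_Mapping.keys_add in \<open>fastforce simp: ac_simps\<close>)+
  have one: "Poly_Mapping.keys (\<Sum>v\<in>verts G. Poly_Mapping.single (v, [], v) (1::'k)) \<subseteq> quiver_paths G"
    by (intro keys_sum_subset) (auto simp: quiver_paths_def awalk_Nil_iff)
  show "Group.monoid ?A"
  proof (rule monoidI)
    fix f assume "f \<in> carrier ?A"
    then have f: "Poly_Mapping.keys f \<subseteq> quiver_paths G" by simp
    show "\<one>\<^bsub>?A\<^esub> \<otimes>\<^bsub>?A\<^esub> f = f"
      using f by (induction rule: poly_mapping_additive_induct)
        (auto simp: path_mult_add sum_trivial_mult[OF assms])
    show "f \<otimes>\<^bsub>?A\<^esub> \<one>\<^bsub>?A\<^esub> = f"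
      using f by (induction rule: poly_mapping_additive_induct)
        (auto simp: path_mult_add sum_trivial_mult[OF assms])
  qed (auto simp: one path_mult_assoc dest: subsetD[OF path_mult_closed])
qed (auto simp: path_mult_add)

end

section \<open>Segments of special cycles\<close>

definition next_arrow :: "('a, 'p) brauer_config \<Rightarrow> 'a \<times> nat \<Rightarrow> 'a \<times> nat" where
  "next_arrow \<Gamma> a = (fst a, Suc (snd a) mod valency \<Gamma> (fst a))"

text \<open>Indices wrap around, so n may exceed the valency: powers of special cycles and their
  initial parts are all segments.\<close>

definition special_segment :: "('a, 'p) brauer_config \<Rightarrow> 'a \<Rightarrow> nat \<Rightarrow> nat \<Rightarrow> ('a \<times> nat) list" where
  "special_segment \<Gamma> \<alpha> l n = map (\<lambda>j. (\<alpha>, (l + j) mod valency \<Gamma> \<alpha>)) [0..<n]"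

abbreviation chain :: "('a, 'p) brauer_config \<Rightarrow> ('a \<times> nat) list \<Rightarrow> bool" where
  "chain \<Gamma> \<equiv> successively (\<lambda>a b. b = next_arrow \<Gamma> a)"

text \<open>The length of the mu-th power of the special cycle through the first arrow. That arrow
  decides, because all arrows of a chain come from the same vertex.\<close>

definition full_length :: "('a, 'p) brauer_config \<Rightarrow> ('a \<times> nat) list \<Rightarrow> nat" where
  "full_length \<Gamma> p = mu \<Gamma> (fst (hd p)) * valency \<Gamma> (fst (hd p))"

text \<open>
  All the powers \<open>C\<^sup>\<mu>\<close> at \<open>V\<close> agree in the algebra; \<open>socle \<Gamma> V\<close> is an arbitrary one of them. In
  \<open>reduce\<close>, the value \<^const>\<open>None\<close> stands for a path that is zero in the algebra.
\<close>

definition socle :: "('a, 'p) brauer_config \<Rightarrow> 'p \<Rightarrow> ('a \<times> nat) list" where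
  "socle \<Gamma> V = (case SOME al. al \<in> special_at \<Gamma> V of (\<alpha>, l) \<Rightarrow> special_power \<Gamma> \<alpha> l)"

fun reduce :: "('a, 'p) brauer_config \<Rightarrow> ('p, 'a \<times> nat) qpath \<Rightarrow> ('p, 'a \<times> nat) qpath option" where
  "reduce \<Gamma> (u, p, v) =
    (if p = [] then Some (u, p, v)
     else if \<not> chain \<Gamma> p \<or> length p > full_length \<Gamma> p then None
     else if length p = full_length \<Gamma> p then Some (u, socle \<Gamma> u, u)
     else Some (u, p, v))"

lemma length_special_segment [simp]: "length (special_segment \<Gamma> \<alpha> l n) = n"
  by (simp add: special_segment_def)

lemma special_segment_0 [simp]: "special_segment \<Gamma> \<alpha> l 0 = []"
  by (simp add: special_segment_def)

lemma special_segment_Suc: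
  "special_segment \<Gamma> \<alpha> l (Suc n) = (\<alpha>, l mod valency \<Gamma> \<alpha>) # special_segment \<Gamma> \<alpha> (Suc l) n"
  unfolding special_segment_def by (rule nth_equalityI) (auto simp: nth_Cons simp del: upt_Suc split: nat.split)

lemma special_segment_add:
  "special_segment \<Gamma> \<alpha> l (m + n) = special_segment \<Gamma> \<alpha> l m @ special_segment \<Gamma> \<alpha> (l + m) n"
  by (induction m arbitrary: l) (simp_all add: special_segment_Suc)

lemma special_segment_mod: "special_segment \<Gamma> \<alpha> (l mod valency \<Gamma> \<alpha>) n = special_segment \<Gamma> \<alpha> l n"
  by (simp add: special_segment_def mod_add_left_eq)

lemma special_segment_period:
  "special_segment \<Gamma> \<alpha> (l + valency \<Gamma> \<alpha>) n = special_segment \<Gamma> \<alpha> l n"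
  by (metis mod_add_self2 special_segment_mod)

lemma special_cycle_eq_segment: "special_cycle \<Gamma> \<alpha> l = special_segment \<Gamma> \<alpha> l (valency \<Gamma> \<alpha>)"
  by (simp add: special_cycle_def special_segment_def)

lemma special_power_eq_segment:
  "special_power \<Gamma> \<alpha> l = special_segment \<Gamma> \<alpha> l (mu \<Gamma> \<alpha> * valency \<Gamma> \<alpha>)"
proof -
  have "concat (replicate m (special_segment \<Gamma> \<alpha> l (valency \<Gamma> \<alpha>))) =
      special_segment \<Gamma> \<alpha> l (m * valency \<Gamma> \<alpha>)" for m
    by (induction m) (simp_all add: special_segment_add special_segment_period)
  then show ?thesis by (simp add: special_power_def special_cycle_eq_segment)
qed

lemma hd_special_segment: "n > 0 \<Longrightarrow> hd (special_segment \<Gamma> \<alpha> l n) = (\<alpha>, l mod valency \<Gamma> \<alpha>)"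
  by (cases n) (simp_all add: special_segment_Suc)

lemma chain_special_segment: "chain \<Gamma> (special_segment \<Gamma> \<alpha> l n)"
proof (induction n arbitrary: l)
  case (Suc n)
  then show ?case
    by (cases n) (auto simp: special_segment_Suc successively_Cons next_arrow_def mod_Suc_eq)
qed simp

lemma chain_fst: "chain \<Gamma> p \<Longrightarrow> a \<in> set p \<Longrightarrow> fst a = fst (hd p)"
  by (induction p) (auto simp: successively_Cons next_arrow_def)

lemma brauer_quiver_simps [simp]:
  "verts (brauer_quiver \<Gamma>) = polygons \<Gamma>"
  "(\<alpha>, l) \<in> arcs (brauer_quiver \<Gamma>) \<longleftrightarrow> \<alpha> \<in> nontruncated \<Gamma> \<and> l < valency \<Gamma> \<alpha>"
  "tail (brauer_quiver \<Gamma>) (\<alpha>, l) = orient \<Gamma> \<alpha> ! l"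
  "head (brauer_quiver \<Gamma>) (\<alpha>, l) = orient \<Gamma> \<alpha> ! (Suc l mod valency \<Gamma> \<alpha>)"
  by (simp_all add: brauer_quiver_def)

lemma chain_eq_segment:
  assumes "p \<noteq> []" "chain \<Gamma> p" "set p \<subseteq> arcs (brauer_quiver \<Gamma>)"
  shows "p = special_segment \<Gamma> (fst (hd p)) (snd (hd p)) (length p)"
  using assms
proof (induction p)
  case (Cons a p)
  obtain \<alpha> l where a: "a = (\<alpha>, l)" by (cases a)
  \<comment> \<open>Segments take indices modulo the valency, so this bound is what lets the segment
    start at the arrow a itself.\<close>
  have l: "l < valency \<Gamma> \<alpha>" using Cons.prems by (simp add: a)
  show ?case
  proof (cases "p = []")
    case True
    then show ?thesis using l by (simp add: special_segment_Suc a)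
  next
    case False
    then have "hd p = (\<alpha>, Suc l mod valency \<Gamma> \<alpha>)" "chain \<Gamma> p"
      using Cons.prems by (auto simp: successively_Cons next_arrow_def a)
    then have "p = special_segment \<Gamma> \<alpha> (Suc l) (length p)"
      using Cons False by (simp add: special_segment_mod)
    then show ?thesis using l by (simp add: special_segment_Suc a)
  qed
qed simp

section \<open>Paths of the induced quiver and their reduction\<close>

context brauer_configuration
begin

lemma valency_pos: "\<alpha> \<in> nontruncated \<Gamma> \<Longrightarrow> valency \<Gamma> \<alpha> > 0"
  using vertex_in_polygon[of \<alpha>] finite_polygons
  by (force simp: nontruncated_def valency_def occ_def intro: sum_pos2)

lemma mu_valency_gt_1:
  assumes "\<alpha> \<in> nontruncated \<Gamma>"
  shows "mu \<Gamma> \<alpha> * valency \<Gamma> \<alpha> > 1"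
proof -
  have "mu \<Gamma> \<alpha> > 0" "valency \<Gamma> \<alpha> > 0" "\<not> (mu \<Gamma> \<alpha> = 1 \<and> valency \<Gamma> \<alpha> = 1)"
    using assms mu_pos valency_pos by (auto simp: nontruncated_def truncated_def)
  then show ?thesis by (metis One_nat_def Suc_lessI mult_eq_1_iff nat_0_less_mult_iff)
qed

lemma length_orient: "\<alpha> \<in> nontruncated \<Gamma> \<Longrightarrow> length (orient \<Gamma> \<alpha>) = valency \<Gamma> \<alpha>"
proof -
  assume "\<alpha> \<in> nontruncated \<Gamma>"
  then have "size (mset (orient \<Gamma> \<alpha>)) = (\<Sum>V\<in>polygons \<Gamma>. occ \<Gamma> \<alpha> V)"
    by (simp add: orient_mset size_multiset_sum)
  then show ?thesis by (simp add: valency_def)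
qed

lemma count_orient:
  assumes "\<alpha> \<in> nontruncated \<Gamma>" "V \<in> polygons \<Gamma>"
  shows "count (mset (orient \<Gamma> \<alpha>)) V = occ \<Gamma> \<alpha> V"
  using assms finite_polygons by (simp add: orient_mset count_sum sum.delta)

lemma orient_nth_polygon: "\<alpha> \<in> nontruncated \<Gamma> \<Longrightarrow> l < valency \<Gamma> \<alpha> \<Longrightarrow> orient \<Gamma> \<alpha> ! l \<in> polygons \<Gamma>"
proof -
  assume *: "\<alpha> \<in> nontruncated \<Gamma>" "l < valency \<Gamma> \<alpha>"
  then have "orient \<Gamma> \<alpha> ! l \<in># mset (orient \<Gamma> \<alpha>)" by (simp add: length_orient)
  then show ?thesis
    using * finite_polygons by (auto simp: orient_mset set_mset_sum split: if_splits)
qed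

sublocale Q: wf_digraph "brauer_quiver \<Gamma>"
proof
  fix a assume "a \<in> arcs (brauer_quiver \<Gamma>)"
  then show "tail (brauer_quiver \<Gamma>) a \<in> verts (brauer_quiver \<Gamma>)"
    and "head (brauer_quiver \<Gamma>) a \<in> verts (brauer_quiver \<Gamma>)"
    by (cases a; simp add: orient_nth_polygon valency_pos)+
qed

lemma special_at_iff:
  "V \<in> polygons \<Gamma> \<Longrightarrow> (\<alpha>, l) \<in> special_at \<Gamma> V \<longleftrightarrow>
     \<alpha> \<in> nontruncated \<Gamma> \<and> l < valency \<Gamma> \<alpha> \<and> orient \<Gamma> \<alpha> ! l = V"
proof -
  assume V: "V \<in> polygons \<Gamma>"
  have "\<alpha> \<in># corners \<Gamma> V" if "\<alpha> \<in> nontruncated \<Gamma>" "l < valency \<Gamma> \<alpha>" "orient \<Gamma> \<alpha> ! l = V"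
  proof -
    have "V \<in># mset (orient \<Gamma> \<alpha>)" using that by (auto simp: length_orient)
    then have "occ \<Gamma> \<alpha> V > 0" using count_orient[OF that(1) V] by (metis count_greater_zero_iff)
    then show ?thesis by (simp add: occ_def)
  qed
  then show ?thesis by (auto simp: special_at_def)
qed

text \<open>A corner with val mu > 1 is nontruncated, so the polygon occurs in its cyclic ordering.
  This makes the choice behind \<open>socle\<close> a genuine special cycle.\<close>

lemma special_at_nonempty:
  assumes "V \<in> polygons \<Gamma>"
  shows "special_at \<Gamma> V \<noteq> {}"
proof -
  obtain \<alpha> where \<alpha>: "\<alpha> \<in># corners \<Gamma> V" "valency \<Gamma> \<alpha> * mu \<Gamma> \<alpha> > 1"
    using polygon_nontruncated[OF assms] by blast
  then have nt: "\<alpha> \<in> nontruncated \<Gamma>"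
    using corners_vertices[OF assms] by (auto simp: nontruncated_def truncated_def)
  have "count (mset (orient \<Gamma> \<alpha>)) V > 0" using \<alpha>(1) count_orient[OF nt assms] by (simp add: occ_def)
  then have "V \<in> set (orient \<Gamma> \<alpha>)" by (simp add: count_mset_0_iff)
  then obtain l where "l < valency \<Gamma> \<alpha>" "orient \<Gamma> \<alpha> ! l = V"
    using length_orient[OF nt] by (metis in_set_conv_nth)
  then show ?thesis using nt special_at_iff[OF assms] by blast
qed

lemma socle_eq:
  assumes "V \<in> polygons \<Gamma>"
  obtains \<alpha> l where "(\<alpha>, l) \<in> special_at \<Gamma> V" "socle \<Gamma> V = special_power \<Gamma> \<alpha> l"
proof -
  have "(SOME al. al \<in> special_at \<Gamma> V) \<in> special_at \<Gamma> V"
    using special_at_nonempty[OF assms] by (simp add: some_in_eq)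
  then show thesis using that by (cases "SOME al. al \<in> special_at \<Gamma> V") (auto simp: socle_def)
qed

lemma special_power_props:
  assumes "V \<in> polygons \<Gamma>" "(\<alpha>, l) \<in> special_at \<Gamma> V"
  shows "special_power \<Gamma> \<alpha> l \<noteq> []" "chain \<Gamma> (special_power \<Gamma> \<alpha> l)"
    and "length (special_power \<Gamma> \<alpha> l) = full_length \<Gamma> (special_power \<Gamma> \<alpha> l)"
    and "hd (special_power \<Gamma> \<alpha> l) = (\<alpha>, l)"
proof -
  have nt: "\<alpha> \<in> nontruncated \<Gamma>" "l < valency \<Gamma> \<alpha>"
    using assms special_at_iff by auto
  then have "mu \<Gamma> \<alpha> * valency \<Gamma> \<alpha> > 0" "l < valency \<Gamma> \<alpha>"
    using mu_valency_gt_1[OF nt(1)] by linarith+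
  moreover from this show hd: "hd (special_power \<Gamma> \<alpha> l) = (\<alpha>, l)"
    by (simp add: special_power_eq_segment hd_special_segment del: nat_0_less_mult_iff)
  ultimately have "length (special_power \<Gamma> \<alpha> l) > 0" by (simp add: special_power_eq_segment)
  then show "special_power \<Gamma> \<alpha> l \<noteq> []" by (metis length_greater_0_conv)
  show "chain \<Gamma> (special_power \<Gamma> \<alpha> l)"
    by (simp add: special_power_eq_segment chain_special_segment)
  show "length (special_power \<Gamma> \<alpha> l) = full_length \<Gamma> (special_power \<Gamma> \<alpha> l)"
    unfolding full_length_def hd by (simp add: special_power_eq_segment)
qed

lemma socle_props:
  assumes "V \<in> polygons \<Gamma>"
  shows "socle \<Gamma> V \<noteq> []" "chain \<Gamma> (socle \<Gamma> V)" "length (socle \<Gamma> V) = full_length \<Gamma> (socle \<Gamma> V)"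
  using socle_eq[OF assms] special_power_props[OF assms] by metis+

lemma special_segment_path:
  assumes "\<alpha> \<in> nontruncated \<Gamma>"
  shows "(orient \<Gamma> \<alpha> ! (l mod valency \<Gamma> \<alpha>), special_segment \<Gamma> \<alpha> l n,
     orient \<Gamma> \<alpha> ! ((l + n) mod valency \<Gamma> \<alpha>)) \<in> quiver_paths (brauer_quiver \<Gamma>)"
proof (induction n arbitrary: l)
  case 0
  then show ?case
    using assms by (simp add: quiver_paths_def Q.awalk_Nil_iff orient_nth_polygon valency_pos)
next
  case (Suc n)
  have "Suc (l mod valency \<Gamma> \<alpha>) mod valency \<Gamma> \<alpha> = Suc l mod valency \<Gamma> \<alpha>" by (simp add: mod_Suc_eq)
  then show ?case
    using assms Suc[of "Suc l"]
    by (simp add: quiver_paths_def Q.awalk_Cons_iff special_segment_Suc valency_pos)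
qed

lemma special_power_path:
  assumes "V \<in> polygons \<Gamma>" "(\<alpha>, l) \<in> special_at \<Gamma> V"
  shows "(V, special_power \<Gamma> \<alpha> l, V) \<in> quiver_paths (brauer_quiver \<Gamma>)"
  using assms special_segment_path[of \<alpha> l "mu \<Gamma> \<alpha> * valency \<Gamma> \<alpha>"]
  by (simp add: special_at_iff special_power_eq_segment)

lemma path_hd:
  assumes "(u, p, v) \<in> quiver_paths (brauer_quiver \<Gamma>)" "p \<noteq> []" "hd p = (\<alpha>, l)"
  shows "\<alpha> \<in> nontruncated \<Gamma>" "l < valency \<Gamma> \<alpha>" "orient \<Gamma> \<alpha> ! l = u" "u \<in> polygons \<Gamma>"
    and "(\<alpha>, l) \<in> special_at \<Gamma> u"
proof -
  show "\<alpha> \<in> nontruncated \<Gamma>" "l < valency \<Gamma> \<alpha>" "orient \<Gamma> \<alpha> ! l = u"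
    using assms by (cases p; auto simp: quiver_paths_def Q.awalk_Cons_iff)+
  then show "u \<in> polygons \<Gamma>" using orient_nth_polygon by blast
  then show "(\<alpha>, l) \<in> special_at \<Gamma> u"
    using \<open>\<alpha> \<in> _\<close> \<open>l < _\<close> \<open>orient \<Gamma> \<alpha> ! l = u\<close> special_at_iff by blast
qed

lemma path_end:
  assumes "(u, p, v) \<in> quiver_paths (brauer_quiver \<Gamma>)" "p \<noteq> []" "(u, p, v') \<in> quiver_paths (brauer_quiver \<Gamma>)"
  shows "v = v'"
  using assms Q.awalk_ends by (fastforce simp: quiver_paths_def)

lemma chain_path:
  assumes "(u, p, v) \<in> quiver_paths (brauer_quiver \<Gamma>)" "p \<noteq> []" "hd p = (\<alpha>, l)" "chain \<Gamma> p"
  shows "p = special_segment \<Gamma> \<alpha> l (length p)" "v = orient \<Gamma> \<alpha> ! ((l + length p) mod valency \<Gamma> \<alpha>)"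
proof -
  note hd = path_hd[OF assms(1-3)]
  have "set p \<subseteq> arcs (brauer_quiver \<Gamma>)"
    using assms(1) by (auto simp: quiver_paths_def Q.awalk_def)
  then show p: "p = special_segment \<Gamma> \<alpha> l (length p)"
    using chain_eq_segment[OF assms(2,4)] assms(3) by simp
  show "v = orient \<Gamma> \<alpha> ! ((l + length p) mod valency \<Gamma> \<alpha>)"
    using path_end[OF assms(1,2)] special_segment_path[OF hd(1), of l "length p"] hd p by simp
qed

text \<open>mu full turns return to the starting position, so a chain of full length is closed; this
  is why \<open>reduce\<close> may use its source as the new target.\<close>

lemma full_path:
  assumes "(u, p, v) \<in> quiver_paths (brauer_quiver \<Gamma>)" "p \<noteq> []" "chain \<Gamma> p" "length p = full_length \<Gamma> p"
  obtains \<alpha> l where "u \<in> polygons \<Gamma>" "(\<alpha>, l) \<in> special_at \<Gamma> u" "p = special_power \<Gamma> \<alpha> l" "v = u"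
proof -
  obtain \<alpha> l where al: "hd p = (\<alpha>, l)" by (cases "hd p")
  note hd = path_hd[OF assms(1,2) al] and ch = chain_path[OF assms(1,2) al assms(3)]
  have len: "length p = mu \<Gamma> \<alpha> * valency \<Gamma> \<alpha>" using assms(4) al by (simp add: full_length_def)
  have "p = special_power \<Gamma> \<alpha> l" using ch(1) by (simp add: len special_power_eq_segment)
  moreover have "v = u" using ch(2) hd by (simp add: len)
  ultimately show thesis using that hd by blast
qed

lemma reduce_socle: "V \<in> polygons \<Gamma> \<Longrightarrow> reduce \<Gamma> (V, socle \<Gamma> V, V) = Some (V, socle \<Gamma> V, V)"
  using socle_props by simp

lemma reduce_path:
  assumes "x \<in> quiver_paths (brauer_quiver \<Gamma>)" "reduce \<Gamma> x = Some y"
  shows "y \<in> quiver_paths (brauer_quiver \<Gamma>)" "reduce \<Gamma> y = Some y"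
proof -
  obtain u p v where x: "x = (u, p, v)" by (cases x)
  have u: "u \<in> polygons \<Gamma>" using assms(1) Q.awalk_hd_in_verts by (auto simp: x quiver_paths_def)
  have "y = x \<or> y = (u, socle \<Gamma> u, u)" using assms(2) by (auto simp: x split: if_splits)
  then have "y \<in> quiver_paths (brauer_quiver \<Gamma>) \<and> reduce \<Gamma> y = Some y"
    using assms reduce_socle[OF u] socle_eq[OF u] special_power_path[OF u] by metis
  then show "y \<in> quiver_paths (brauer_quiver \<Gamma>)" "reduce \<Gamma> y = Some y" by auto
qed

lemma reduce_ends:
  assumes "(u, p, v) \<in> quiver_paths (brauer_quiver \<Gamma>)" "reduce \<Gamma> (u, p, v) = Some (u', p', v')"
  shows "u' = u" "v' = v"
  using assms full_path[OF assms(1)] by (auto split: if_splits)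

text \<open>The delicate case is a prefix of full length, which is replaced by a socle that may go
  around another vertex. Followed by a nonempty q, both exceed the full length set by their own
  first arrow, so both sides are zero.\<close>

lemma reduce_append_left:
  assumes "(u, p, v) \<in> quiver_paths (brauer_quiver \<Gamma>)" "(v, q, w) \<in> quiver_paths (brauer_quiver \<Gamma>)"
  shows "reduce \<Gamma> (u, p @ q, w) =
    (case reduce \<Gamma> (u, p, v) of None \<Rightarrow> None | Some (u', p', v') \<Rightarrow> reduce \<Gamma> (u', p' @ q, w))"
proof -
  consider "p = []" | "p \<noteq> []" "\<not> chain \<Gamma> p \<or> length p > full_length \<Gamma> p"
    | "p \<noteq> []" "chain \<Gamma> p" "length p < full_length \<Gamma> p" | "p \<noteq> []" "chain \<Gamma> p" "length p = full_length \<Gamma> p"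
    by linarith
  then show ?thesis
  proof cases
    case 1
    then have "u = v" using assms(1) by (simp add: quiver_paths_def Q.awalk_Nil_iff)
    then show ?thesis using 1 by simp
  next
    case 2
    then have "reduce \<Gamma> (u, p @ q, w) = None"
      by (auto simp: successively_append_iff full_length_def)
    then show ?thesis using 2 by simp
  next
    case 3
    then show ?thesis by simp
  next
    case 4
    then obtain "u \<in> polygons \<Gamma>" "v = u" using full_path[OF assms(1)] by metis
    note soc = socle_props[OF this(1)]
    show ?thesis
    proof (cases "q = []")
      case True
      then have "w = u" using assms(2) \<open>v = u\<close> by (simp add: quiver_paths_def Q.awalk_Nil_iff)
      then show ?thesis using True 4 soc by simp
    next
      case False
      then have "length q > 0" by simp
      then have "reduce \<Gamma> (u, p @ q, w) = None" "reduce \<Gamma> (u, socle \<Gamma> u @ q, w) = None"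
        using 4 soc by (auto simp: full_length_def)
      then show ?thesis using 4 by simp
    qed
  qed
qed

text \<open>The full length is read off at the first arrow, which now belongs to p. If p followed by
  q is still a chain, then its arrows come from one vertex, both have the same full length, and a q
  of at least that length becomes too long. The same applies to the socle that replaces q.\<close>

lemma reduce_append_right:
  assumes "(u, p, v) \<in> quiver_paths (brauer_quiver \<Gamma>)" "(v, q, w) \<in> quiver_paths (brauer_quiver \<Gamma>)"
  shows "reduce \<Gamma> (u, p @ q, w) =
    (case reduce \<Gamma> (v, q, w) of None \<Rightarrow> None | Some (v', q', w') \<Rightarrow> reduce \<Gamma> (u, p @ q', w'))"
proof (cases "p = []")
  case True
  then have "u = v" using assms(1) by (simp add: quiver_paths_def Q.awalk_Nil_iff)
  then show ?thesis
    using True reduce_path(2)[OF assms(2)] reduce_ends(1)[OF assms(2)]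
    by (auto simp del: reduce.simps split: option.split)
next
  case False
  have long: "reduce \<Gamma> (u, p @ q', w') = None" if "q' \<noteq> []" "length q' \<ge> full_length \<Gamma> q'" for q' w'
  proof (cases "chain \<Gamma> (p @ q')")
    case True
    then have "fst (hd q') = fst (hd (p @ q'))" using that by (intro chain_fst) auto
    then have "full_length \<Gamma> (p @ q') = full_length \<Gamma> q'" by (simp add: full_length_def)
    moreover have "length p > 0" using \<open>p \<noteq> []\<close> by simp
    then have "length p + length q' > full_length \<Gamma> q'" using that(2) by linarith
    ultimately show ?thesis using \<open>p \<noteq> []\<close> by simp
  qed (use \<open>p \<noteq> []\<close> in simp)
  consider "q = []" | "q \<noteq> []" "\<not> chain \<Gamma> q" | "q \<noteq> []" "chain \<Gamma> q" "length q > full_length \<Gamma> q"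
    | "q \<noteq> []" "chain \<Gamma> q" "length q < full_length \<Gamma> q" | "q \<noteq> []" "chain \<Gamma> q" "length q = full_length \<Gamma> q"
    by linarith
  then show ?thesis
  proof cases
    case 2
    then have "reduce \<Gamma> (u, p @ q, w) = None" using False by (simp add: successively_append_iff)
    then show ?thesis using 2 by simp
  next
    case 5
    then have "v \<in> polygons \<Gamma>" using full_path[OF assms(2)] by metis
    then show ?thesis using 5 long[of q] long[of "socle \<Gamma> v"] socle_props[of v] by simp
  qed (use long[of q] in auto)
qed

end

section \<open>Normal forms of paths\<close>

lemma path_mult_diff:
  "path_mult (f - f') g = path_mult f g - path_mult f' g"
  "path_mult f (g - g') = path_mult f g - path_mult f g'"
  by (metis add_diff_cancel diff_add_cancel path_mult_add(1))
    (metis add_diff_cancel diff_add_cancel path_mult_add(2))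

lemma keys_path_mult:
  assumes "z \<in> Poly_Mapping.keys (path_mult f g)"
  obtains u p v q w where "z = (u, p @ q, w)" "(u, p, v) \<in> Poly_Mapping.keys f"
    "(v, q, w) \<in> Poly_Mapping.keys g"
proof -
  let ?Z = "{(u, p @ q, w) | u p v q w. (u, p, v) \<in> Poly_Mapping.keys f \<and> (v, q, w) \<in> Poly_Mapping.keys g}"
  have "Poly_Mapping.keys (path_term_mult x c y d) \<subseteq> ?Z"
    if "x \<in> Poly_Mapping.keys f" "y \<in> Poly_Mapping.keys g" for x c y d
    using that by (cases x; cases y) auto
  then have "Poly_Mapping.keys (path_mult f g) \<subseteq> ?Z"
    unfolding path_mult_def by (intro keys_sum_subset) blast
  then show thesis using assms that by blast
qed

lemma not_successivelyE:
  assumes "\<not> successively P xs"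
  obtains ps a b qs where "xs = ps @ [a, b] @ qs" "\<not> P a b"
  using assms
proof (induction xs arbitrary: thesis)
  case (Cons a xs)
  show ?case
  proof (cases "successively P xs")
    case True
    then obtain b qs where "xs = b # qs" "\<not> P a b"
      using Cons.prems(2) by (cases xs) (auto simp: successively_Cons)
    then show ?thesis using Cons.prems(1)[of "[]" a b qs] by simp
  next
    case False
    then obtain ps c d qs where "xs = ps @ [c, d] @ qs" "\<not> P c d" using Cons.IH by blast
    then show ?thesis using Cons.prems(1)[of "a # ps" c d qs] by simp
  qed
qed simp

definition reduce_single ::
  "('a, 'p) brauer_config \<Rightarrow> ('p, 'a \<times> nat) qpath \<Rightarrow> 'k \<Rightarrow> ('p, 'a \<times> nat) qpath \<Rightarrow>\<^sub>0 'k::field" where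
  "reduce_single \<Gamma> x c = (case reduce \<Gamma> x of None \<Rightarrow> 0 | Some y \<Rightarrow> Poly_Mapping.single y c)"

definition normal_form ::
  "('a, 'p) brauer_config \<Rightarrow> (('p, 'a \<times> nat) qpath \<Rightarrow>\<^sub>0 'k::field) \<Rightarrow> (('p, 'a \<times> nat) qpath \<Rightarrow>\<^sub>0 'k)" where
  "normal_form \<Gamma> f = (\<Sum>x\<in>Poly_Mapping.keys f. reduce_single \<Gamma> x (Poly_Mapping.lookup f x))"

lemma reduce_single_0 [simp]: "reduce_single \<Gamma> x 0 = 0"
  by (simp add: reduce_single_def split: option.split)

lemma reduce_single_add: "reduce_single \<Gamma> x (c + d) = reduce_single \<Gamma> x c + reduce_single \<Gamma> x d"
  by (simp add: reduce_single_def single_add split: option.split)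

lemma normal_form_superset:
  assumes "finite A" "Poly_Mapping.keys f \<subseteq> A"
  shows "normal_form \<Gamma> f = (\<Sum>x\<in>A. reduce_single \<Gamma> x (Poly_Mapping.lookup f x))"
  unfolding normal_form_def using assms
  by (intro sum.mono_neutral_left) (auto simp: not_in_keys_iff_lookup_eq_zero)

lemma normal_form_add [simp]: "normal_form \<Gamma> (f + g) = normal_form \<Gamma> f + normal_form \<Gamma> g"
proof -
  note sup = normal_form_superset[of "Poly_Mapping.keys f \<union> Poly_Mapping.keys g"]
  show ?thesis
    using Poly_Mapping.keys_add[of f g]
    by (simp add: sup lookup_add reduce_single_add sum.distrib)
qed

lemma normal_form_zero [simp]: "normal_form \<Gamma> 0 = 0"
  by (simp add: normal_form_def)

lemma normal_form_single: "normal_form \<Gamma> (Poly_Mapping.single x c) = reduce_single \<Gamma> x c"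
  using normal_form_superset[of "{x}" "Poly_Mapping.single x c"] by simp

lemma normal_form_diff [simp]: "normal_form \<Gamma> (f - g) = normal_form \<Gamma> f - normal_form \<Gamma> g"
  using normal_form_add[of \<Gamma> "f - g" g] by simp

lemma normal_form_eq_0: "(\<And>x. x \<in> Poly_Mapping.keys f \<Longrightarrow> reduce \<Gamma> x = None) \<Longrightarrow> normal_form \<Gamma> f = 0"
  by (simp add: normal_form_def reduce_single_def)

context brauer_configuration
begin

abbreviation paths :: "('p, 'a \<times> nat) qpath set" where
  "paths \<equiv> quiver_paths (brauer_quiver \<Gamma>)"

definition reduced :: "('p, 'a \<times> nat) qpath set" where
  "reduced = {x \<in> paths. reduce \<Gamma> x = Some x}"

lemma normal_form_reduced:
  assumes "Poly_Mapping.keys f \<subseteq> paths"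
  shows "Poly_Mapping.keys (normal_form \<Gamma> f) \<subseteq> reduced"
  unfolding normal_form_def
proof (rule keys_sum_subset)
  fix x assume "x \<in> Poly_Mapping.keys f"
  then have x: "x \<in> paths" using assms by blast
  then show "Poly_Mapping.keys (reduce_single \<Gamma> x (Poly_Mapping.lookup f x)) \<subseteq> reduced"
    using reduce_path[OF x] by (cases "reduce \<Gamma> x") (simp_all add: reduce_single_def reduced_def)
qed

lemma normal_form_id:
  assumes "Poly_Mapping.keys f \<subseteq> reduced"
  shows "normal_form \<Gamma> f = f"
  using assms
  by (induction rule: poly_mapping_additive_induct)
    (auto simp: normal_form_single reduce_single_def reduced_def simp del: reduce.simps)

lemma normal_form_mult_left:
  fixes f g :: "('p, 'a \<times> nat) qpath \<Rightarrow>\<^sub>0 'k::field"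
  assumes f: "Poly_Mapping.keys f \<subseteq> paths" and g: "Poly_Mapping.keys g \<subseteq> paths"
  shows "normal_form \<Gamma> (path_mult f g) = normal_form \<Gamma> (path_mult (normal_form \<Gamma> f) g)"
proof -
  have "normal_form \<Gamma> (path_mult (Poly_Mapping.single x c) (Poly_Mapping.single y d)) =
      normal_form \<Gamma> (path_mult (reduce_single \<Gamma> x c) (Poly_Mapping.single y d))"
    if xy: "x \<in> paths" "y \<in> paths" for x y and c d :: 'k
  proof -
    obtain u p v v0 q w where x: "x = (u, p, v)" and y: "y = (v0, q, w)" by (cases x; cases y)
    show ?thesis
    proof (cases "v0 = v")
      case True
      then show ?thesis
        using reduce_append_left[of u p v q w] reduce_ends[of u p v] xy
        by (auto simp: x y reduce_single_def normal_form_single simp del: reduce.simps split: option.splits)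
    next
      \<comment> \<open>Reduction keeps endpoints, so paths that do not compose still do not compose
        afterwards and both products vanish.\<close>
      case False
      then show ?thesis
        using reduce_ends[of u p v] xy
        by (auto simp: x y reduce_single_def simp del: reduce.simps split: option.splits)
    qed
  qed
  then have "normal_form \<Gamma> (path_mult (Poly_Mapping.single x c) g) =
      normal_form \<Gamma> (path_mult (reduce_single \<Gamma> x c) g)" if "x \<in> paths" for x and c :: 'k
    by (induction rule: poly_mapping_additive_induct[OF g]) (simp_all add: path_mult_add that)
  then show ?thesis
    by (induction rule: poly_mapping_additive_induct[OF f]) (simp_all add: path_mult_add normal_form_single)
qed

lemma normal_form_mult_right:
  fixes f g :: "('p, 'a \<times> nat) qpath \<Rightarrow>\<^sub>0 'k::field"
  assumes f: "Poly_Mapping.keys f \<subseteq> paths" and g: "Poly_Mapping.keys g \<subseteq> paths"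
  shows "normal_form \<Gamma> (path_mult f g) = normal_form \<Gamma> (path_mult f (normal_form \<Gamma> g))"
proof -
  have "normal_form \<Gamma> (path_mult (Poly_Mapping.single x c) (Poly_Mapping.single y d)) =
      normal_form \<Gamma> (path_mult (Poly_Mapping.single x c) (reduce_single \<Gamma> y d))"
    if xy: "x \<in> paths" "y \<in> paths" for x y and c d :: 'k
  proof -
    obtain u p v v0 q w where x: "x = (u, p, v)" and y: "y = (v0, q, w)" by (cases x; cases y)
    show ?thesis
    proof (cases "v0 = v")
      case True
      then show ?thesis
        using reduce_append_right[of u p v q w] reduce_ends[of v q w] xy
        by (auto simp: x y reduce_single_def normal_form_single simp del: reduce.simps split: option.splits)
    next
      case False
      then show ?thesis
        using reduce_ends[of v0 q w] xy
        by (auto simp: x y reduce_single_def simp del: reduce.simps split: option.splits)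
    qed
  qed
  then have "normal_form \<Gamma> (path_mult f (Poly_Mapping.single y d)) =
      normal_form \<Gamma> (path_mult f (reduce_single \<Gamma> y d))" if "y \<in> paths" for y and d :: 'k
    by (induction rule: poly_mapping_additive_induct[OF f]) (simp_all add: path_mult_add that)
  then show ?thesis
    by (induction rule: poly_mapping_additive_induct[OF g]) (simp_all add: path_mult_add normal_form_single)
qed

lemma path_split:
  assumes "(u, p @ q, w) \<in> paths"
  obtains v where "(u, p, v) \<in> paths" "(v, q, w) \<in> paths"
  using assms by (auto simp: quiver_paths_def)

text \<open>The exceptional clause covers valency 1: the special cycle is then the single loop a, so
  a a is not a subpath although a is its own successor, and mu > 1 as the vertex is nontruncated.
  For larger valency the cycle starting at a contains a and its successor side by side.\<close>

lemma not_next_arrow_iff: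
  assumes a: "a \<in> arcs (brauer_quiver \<Gamma>)" and b: "b \<in> arcs (brauer_quiver \<Gamma>)"
  shows "b \<noteq> next_arrow \<Gamma> a \<longleftrightarrow>
    \<not> (\<exists>\<alpha> l. \<alpha> \<in> nontruncated \<Gamma> \<and> l < valency \<Gamma> \<alpha> \<and> sublist [a, b] (special_cycle \<Gamma> \<alpha> l)) \<and>
    \<not> (\<exists>\<alpha>\<in>vertices \<Gamma>. valency \<Gamma> \<alpha> = 1 \<and> mu \<Gamma> \<alpha> > 1 \<and> a = (\<alpha>, 0) \<and> b = (\<alpha>, 0))"
    (is "_ \<longleftrightarrow> \<not> ?s \<and> \<not> ?t")
proof -
  obtain \<alpha> l where al: "a = (\<alpha>, l)" by (cases a)
  have nt: "\<alpha> \<in> nontruncated \<Gamma>" "l < valency \<Gamma> \<alpha>" using a al by auto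
  have "?s \<or> ?t" if nxt: "b = next_arrow \<Gamma> a"
  proof (cases "valency \<Gamma> \<alpha> = 1")
    case True
    have "mu \<Gamma> \<alpha> > 1" using mu_valency_gt_1[OF nt(1)] True by simp
    then have ?t using True nt al nxt by (auto simp: nontruncated_def next_arrow_def)
    then show ?thesis ..
  next
    case False
    then obtain n where "valency \<Gamma> \<alpha> = Suc (Suc n)" using nt(2) by (metis One_nat_def Suc_lessE less_nat_zero_code not0_implies_Suc)
    then have "special_cycle \<Gamma> \<alpha> l = [a, b] @ special_segment \<Gamma> \<alpha> (Suc (Suc l)) n"
      using nt(2) by (simp add: special_cycle_eq_segment special_segment_Suc al nxt next_arrow_def)
    then have "sublist [a, b] (special_cycle \<Gamma> \<alpha> l)" by (metis sublist_append_rightI)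
    then show ?thesis using nt by blast
  qed
  moreover have "b = next_arrow \<Gamma> a" if "sublist [a, b] (special_cycle \<Gamma> \<beta> m)" for \<beta> m
    using that chain_special_segment[of \<Gamma> \<beta> m "valency \<Gamma> \<beta>"]
    by (auto simp: sublist_def special_cycle_eq_segment successively_append_iff successively_Cons)
  moreover have "b = next_arrow \<Gamma> a" if ?t
    using that by (auto simp: next_arrow_def)
  ultimately show ?thesis by blast
qed

lemma relations_three_eq:
  "relations_three \<Gamma> = {Poly_Mapping.single
     (tail (brauer_quiver \<Gamma>) a, [a, b], head (brauer_quiver \<Gamma>) b) 1 | a b.
      a \<in> arcs (brauer_quiver \<Gamma>) \<and> b \<in> arcs (brauer_quiver \<Gamma>) \<and>
      head (brauer_quiver \<Gamma>) a = tail (brauer_quiver \<Gamma>) b \<and> b \<noteq> next_arrow \<Gamma> a}"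
  unfolding relations_three_def
  by (intro Collect_cong ex_cong1 conj_cong refl) (simp add: not_next_arrow_iff)

text \<open>Both terms of a type one relation have full length and reduce to the same socle. A type
  two relation is one arrow too long, and a type three relation is not a chain.\<close>

lemma relations_normal_form:
  assumes "f \<in> relations_one \<Gamma> \<union> relations_two \<Gamma> \<union> relations_three \<Gamma>"
  shows "Poly_Mapping.keys f \<subseteq> paths" "normal_form \<Gamma> f = 0"
proof -
  consider (one) V \<alpha> l \<beta> m where "V \<in> polygons \<Gamma>" "(\<alpha>, l) \<in> special_at \<Gamma> V" "(\<beta>, m) \<in> special_at \<Gamma> V"
      "f = Poly_Mapping.single (V, special_power \<Gamma> \<alpha> l, V) 1 -
        Poly_Mapping.single (V, special_power \<Gamma> \<beta> m, V) 1"
    | (two) V \<alpha> l where "V \<in> polygons \<Gamma>" "(\<alpha>, l) \<in> special_at \<Gamma> V"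
      "f = Poly_Mapping.single (V, special_power \<Gamma> \<alpha> l @ [hd (special_cycle \<Gamma> \<alpha> l)],
         head (brauer_quiver \<Gamma>) (hd (special_cycle \<Gamma> \<alpha> l))) 1"
    | (three) a b where "a \<in> arcs (brauer_quiver \<Gamma>)" "b \<in> arcs (brauer_quiver \<Gamma>)"
      "head (brauer_quiver \<Gamma>) a = tail (brauer_quiver \<Gamma>) b" "b \<noteq> next_arrow \<Gamma> a"
      "f = Poly_Mapping.single (tail (brauer_quiver \<Gamma>) a, [a, b], head (brauer_quiver \<Gamma>) b) 1"
    using assms unfolding relations_one_def relations_two_def relations_three_eq by blast
  then have "Poly_Mapping.keys f \<subseteq> paths \<and> normal_form \<Gamma> f = 0"
  proof cases
    case one
    note props = special_power_props[OF one(1)] special_power_path[OF one(1)]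
    have "reduce \<Gamma> (V, special_power \<Gamma> \<gamma> k, V) = Some (V, socle \<Gamma> V, V)"
      if "(\<gamma>, k) \<in> special_at \<Gamma> V" for \<gamma> k
      using props(1-3)[OF that] by simp
    then have "normal_form \<Gamma> f = 0"
      using one(2,3) by (simp add: one(4) normal_form_single reduce_single_def del: reduce.simps)
    moreover have "Poly_Mapping.keys f \<subseteq> paths"
    proof
      fix x assume "x \<in> Poly_Mapping.keys f"
      then have "x = (V, special_power \<Gamma> \<alpha> l, V) \<or> x = (V, special_power \<Gamma> \<beta> m, V)"
        by (auto simp: one(4) in_keys_iff lookup_minus lookup_single when_def split: if_splits)
      then show "x \<in> paths" using props(5) one(2,3) by blast
    qed
    ultimately show ?thesis by blast
  next
    case two
    note props = special_power_props[OF two(1,2)] special_power_path[OF two(1,2)]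
    have nt: "\<alpha> \<in> nontruncated \<Gamma>" "l < valency \<Gamma> \<alpha>" "orient \<Gamma> \<alpha> ! l = V"
      using two(1,2) special_at_iff by auto
    then have hd: "hd (special_cycle \<Gamma> \<alpha> l) = (\<alpha>, l)"
      by (simp add: special_cycle_eq_segment hd_special_segment)
    have "full_length \<Gamma> (special_power \<Gamma> \<alpha> l @ [(\<alpha>, l)]) = full_length \<Gamma> (special_power \<Gamma> \<alpha> l)"
      using props(1) by (simp add: full_length_def)
    then have "reduce \<Gamma> (V, special_power \<Gamma> \<alpha> l @ [(\<alpha>, l)], v) = None" for v
      using props(3) by simp
    then have "normal_form \<Gamma> f = 0"
      by (simp add: two(3) hd normal_form_single reduce_single_def del: reduce.simps)
    moreover have "(V, [(\<alpha>, l)], head (brauer_quiver \<Gamma>) (\<alpha>, l)) \<in> paths"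
      using nt Q.head_in_verts[of "(\<alpha>, l)"] two(1)
      by (simp add: quiver_paths_def Q.awalk_Cons_iff Q.awalk_Nil_iff)
    then have "Poly_Mapping.keys f \<subseteq> paths"
      using Q.path_concat[OF props(5)] by (simp add: two(3) hd)
    ultimately show ?thesis by blast
  next
    case three
    then show ?thesis
      using Q.head_in_verts[of b]
      by (simp add: normal_form_single reduce_single_def quiver_paths_def Q.awalk_Cons_iff Q.awalk_Nil_iff)
  qed
  then show "Poly_Mapping.keys f \<subseteq> paths" "normal_form \<Gamma> f = 0" by auto
qed

end

section \<open>The Brauer configuration algebra\<close>

text \<open>\<open>field_type\<close> pins down the coefficient field. Nonemptiness excludes the
  zero ring, in which the scalars would not form a field.\<close>

locale brauer_algebra_over = brauer_configuration \<Gamma>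
  for \<Gamma> :: "('a, 'p) brauer_config" +
  fixes field_type :: "'k::field itself"
  assumes polygons_nonempty: "polygons \<Gamma> \<noteq> {}"
begin

abbreviation A :: "(('p, 'a \<times> nat) qpath \<Rightarrow>\<^sub>0 'k) ring" where
  "A \<equiv> path_algebra (brauer_quiver \<Gamma>)"

abbreviation \<I> :: "(('p, 'a \<times> nat) qpath \<Rightarrow>\<^sub>0 'k) set" where
  "\<I> \<equiv> brauer_ideal \<Gamma>"

abbreviation \<Lambda> :: "(('p, 'a \<times> nat) qpath \<Rightarrow>\<^sub>0 'k) set ring" where
  "\<Lambda> \<equiv> brauer_algebra \<Gamma>"

abbreviation relations :: "(('p, 'a \<times> nat) qpath \<Rightarrow>\<^sub>0 'k) set" where
  "relations \<equiv> relations_one \<Gamma> \<union> relations_two \<Gamma> \<union> relations_three \<Gamma>"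

sublocale A: ring A
  using Q.path_algebra_ring finite_polygons by simp

lemma A_minus [simp]: "Poly_Mapping.keys f \<subseteq> paths \<Longrightarrow> \<ominus>\<^bsub>A\<^esub> f = - f"
proof -
  assume f: "Poly_Mapping.keys f \<subseteq> paths"
  have "Poly_Mapping.keys (- f) \<subseteq> paths" using f by (auto simp: in_keys_iff)
  then show ?thesis using f A.minus_equality[of "- f" f] by simp
qed

lemma A_diff: "Poly_Mapping.keys f \<subseteq> paths \<Longrightarrow> Poly_Mapping.keys g \<subseteq> paths \<Longrightarrow> f \<ominus>\<^bsub>A\<^esub> g = f - g"
  by (simp add: a_minus_def)

lemma brauer_ideal_eq_Idl: "\<I> = Idl\<^bsub>A\<^esub> relations"
  by (simp add: brauer_ideal_def)

lemma relations_closed: "relations \<subseteq> carrier A"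
  using relations_normal_form(1) by auto

sublocale \<I>: ideal \<I> A
  unfolding brauer_ideal_eq_Idl using relations_closed by (rule A.genideal_ideal)

lemma relations_in_ideal: "f \<in> relations \<Longrightarrow> f \<in> \<I>"
  unfolding brauer_ideal_eq_Idl using A.genideal_self[OF relations_closed] by blast

lemma ideal_mult:
  assumes "f \<in> \<I>" "Poly_Mapping.keys g \<subseteq> paths"
  shows "path_mult f g \<in> \<I>" "path_mult g f \<in> \<I>"
  using \<I>.I_r_closed[of f g] \<I>.I_l_closed[of f g] assms by simp_all

lemma ideal_normal_form:
  assumes "f \<in> \<I>"
  shows "normal_form \<Gamma> f = 0"
proof -
  let ?N = "{f :: ('p, 'a \<times> nat) qpath \<Rightarrow>\<^sub>0 'k. Poly_Mapping.keys f \<subseteq> paths \<and> normal_form \<Gamma> f = 0}"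
  have "ideal ?N A"
  proof (rule idealI[OF A.ring_axioms])
    show "subgroup ?N (add_monoid A)"
    proof (rule A.add.subgroupI)
      fix f assume "f \<in> ?N"
      moreover have "normal_form \<Gamma> (- f) = - normal_form \<Gamma> f"
        using normal_form_diff[of \<Gamma> 0 f] by simp
      moreover have "Poly_Mapping.keys (- f) = Poly_Mapping.keys f" by (auto simp: in_keys_iff)
      ultimately show "\<ominus>\<^bsub>A\<^esub> f \<in> ?N" by simp
    next
      fix f g assume "f \<in> ?N" "g \<in> ?N"
      then show "f \<oplus>\<^bsub>A\<^esub> g \<in> ?N" using Poly_Mapping.keys_add[of f g] by auto
    qed (auto intro: exI[of _ 0])
  next
    fix f g assume *: "f \<in> ?N" "g \<in> carrier A"
    show "g \<otimes>\<^bsub>A\<^esub> f \<in> ?N"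
      using * Q.path_mult_closed[of g f] normal_form_mult_right[of g f] by simp
    show "f \<otimes>\<^bsub>A\<^esub> g \<in> ?N"
      using * Q.path_mult_closed[of f g] normal_form_mult_left[of f g] by simp
  qed
  then have "\<I> \<subseteq> ?N"
    unfolding brauer_ideal_eq_Idl using relations_normal_form by (intro A.genideal_minimal) auto
  then show ?thesis using assms by blast
qed

text \<open>Two consecutive arrows that violate the chain condition form a type three relation, and
  the path is a two-sided multiple of it.\<close>

lemma chain_violation_in_ideal:
  assumes "(u, p, v) \<in> paths" "\<not> chain \<Gamma> p"
  shows "Poly_Mapping.single (u, p, v) c \<in> \<I>"
proof -
  obtain ps a b qs where p: "p = ps @ [a, b] @ qs" and ab: "b \<noteq> next_arrow \<Gamma> a"
    using assms(2) by (rule not_successivelyE)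
  obtain x where x: "(u, ps, x) \<in> paths" "(x, [a, b] @ qs, v) \<in> paths"
    using assms(1) unfolding p by (rule path_split)
  obtain y where y: "(x, [a, b], y) \<in> paths" "(y, qs, v) \<in> paths"
    using x(2) by (rule path_split)
  have "a \<in> arcs (brauer_quiver \<Gamma>)" "b \<in> arcs (brauer_quiver \<Gamma>)"
      "head (brauer_quiver \<Gamma>) a = tail (brauer_quiver \<Gamma>) b"
      "x = tail (brauer_quiver \<Gamma>) a" "y = head (brauer_quiver \<Gamma>) b"
    using y(1) by (auto simp: quiver_paths_def Q.awalk_Cons_iff Q.awalk_Nil_iff)
  then have "Poly_Mapping.single (x, [a, b], y) 1 \<in> relations"
    unfolding relations_three_eq using ab by blast
  then have "path_mult (path_mult (Poly_Mapping.single (u, ps, x) c) (Poly_Mapping.single (x, [a, b], y) 1))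
      (Poly_Mapping.single (y, qs, v) 1) \<in> \<I>"
    using x y by (intro ideal_mult relations_in_ideal) auto
  then show ?thesis by (simp add: p)
qed

lemma long_chain_in_ideal:
  assumes path: "(u, p, v) \<in> paths" and "p \<noteq> []" "chain \<Gamma> p" "length p > full_length \<Gamma> p"
  shows "Poly_Mapping.single (u, p, v) c \<in> \<I>"
proof -
  obtain \<alpha> l where al: "hd p = (\<alpha>, l)" by (cases "hd p")
  note hd = path_hd[OF path assms(2) al] and ch = chain_path(1)[OF path assms(2) al assms(3)]
  let ?m = "mu \<Gamma> \<alpha> * valency \<Gamma> \<alpha>"
  \<comment> \<open>Cut p into mu full turns, one further arrow and a rest of length r; the first
    two parts together form a type two relation.\<close>
  obtain r where r: "length p = ?m + (1 + r)"
    using assms(4) al less_imp_Suc_add by (fastforce simp: full_length_def)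
  have cyc: "hd (special_cycle \<Gamma> \<alpha> l) = (\<alpha>, l)"
    using hd(1,2) valency_pos by (simp add: special_cycle_eq_segment hd_special_segment)
  define q where "q = special_segment \<Gamma> \<alpha> (l + ?m + 1) r"
  have p: "p = (special_power \<Gamma> \<alpha> l @ [(\<alpha>, l)]) @ q"
  proof -
    have "special_segment \<Gamma> \<alpha> l (?m + (1 + r)) =
        special_segment \<Gamma> \<alpha> l ?m @ special_segment \<Gamma> \<alpha> (l + ?m) (Suc 0) @ q"
      by (simp only: special_segment_add q_def One_nat_def)
    then show ?thesis
      using ch hd(2) unfolding r by (simp add: special_power_eq_segment special_segment_Suc)
  qed
  then obtain y where y: "(u, special_power \<Gamma> \<alpha> l @ [(\<alpha>, l)], y) \<in> paths" "(y, q, v) \<in> paths"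
    using path path_split by metis
  then obtain x where "(x, [(\<alpha>, l)], y) \<in> paths" using path_split by metis
  then have "y = head (brauer_quiver \<Gamma>) (hd (special_cycle \<Gamma> \<alpha> l))"
    unfolding cyc by (simp add: quiver_paths_def Q.awalk_Cons_iff Q.awalk_Nil_iff)
  then have "Poly_Mapping.single (u, special_power \<Gamma> \<alpha> l @ [(\<alpha>, l)], y) 1 \<in> relations"
    unfolding relations_two_def using hd(4,5) cyc by force
  then have "path_mult (Poly_Mapping.single (u, special_power \<Gamma> \<alpha> l @ [(\<alpha>, l)], y) 1)
      (Poly_Mapping.single (y, q, v) c) \<in> \<I>"
    using y by (intro ideal_mult relations_in_ideal) auto
  then show ?thesis by (simp add: p)
qed

lemma reduce_single_in_ideal:
  assumes x: "x \<in> paths"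
  shows "Poly_Mapping.single x c - reduce_single \<Gamma> x c \<in> \<I>"
proof -
  obtain u p v where x': "x = (u, p, v)" by (cases x)
  have zero: "0 \<in> \<I>" using \<I>.zero_closed by simp
  consider "p = []" | "p \<noteq> []" "\<not> chain \<Gamma> p" | "p \<noteq> []" "chain \<Gamma> p" "length p > full_length \<Gamma> p"
    | "p \<noteq> []" "chain \<Gamma> p" "length p < full_length \<Gamma> p" | "p \<noteq> []" "chain \<Gamma> p" "length p = full_length \<Gamma> p"
    by linarith
  then show ?thesis
  proof cases
    case 2
    then show ?thesis
      using chain_violation_in_ideal x by (simp add: x' reduce_single_def)
  next
    case 3
    then show ?thesis
      using long_chain_in_ideal x by (simp add: x' reduce_single_def)
  next
    case 5
    then obtain \<alpha> l where al: "u \<in> polygons \<Gamma>" "(\<alpha>, l) \<in> special_at \<Gamma> u" "p = special_power \<Gamma> \<alpha> l" "v = u"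
      using full_path x unfolding x' by metis
    obtain \<beta> m where bm: "(\<beta>, m) \<in> special_at \<Gamma> u" "socle \<Gamma> u = special_power \<Gamma> \<beta> m"
      using socle_eq[OF al(1)] .
    have "Poly_Mapping.single (u, p, u) 1 - Poly_Mapping.single (u, socle \<Gamma> u, u) 1 \<in> relations"
      unfolding relations_one_def al(3) bm(2) using al(1,2) bm(1) by blast
    \<comment> \<open>The relation has coefficients 1 and -1; multiplication by c times the trivial
      path at u produces the coefficient c.\<close>
    then have "path_mult (Poly_Mapping.single (u, [], u) c)
        (Poly_Mapping.single (u, p, u) 1 - Poly_Mapping.single (u, socle \<Gamma> u, u) 1) \<in> \<I>"
      using al(1) by (intro ideal_mult relations_in_ideal) (auto simp: quiver_paths_def Q.awalk_Nil_iff)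
    then show ?thesis using 5 al(4) by (simp add: x' reduce_single_def path_mult_diff)
  qed (use zero in \<open>simp_all add: x' reduce_single_def\<close>)
qed

lemma diff_normal_form_in_ideal:
  assumes "Poly_Mapping.keys f \<subseteq> paths"
  shows "f - normal_form \<Gamma> f \<in> \<I>"
  using assms
proof (induction rule: poly_mapping_additive_induct)
  case zero
  then show ?case using \<I>.zero_closed by simp
next
  case (single x c)
  then show ?case using reduce_single_in_ideal by (simp add: normal_form_single)
next
  case (add f g)
  then show ?case using \<I>.a_closed[OF add(3,4)] by (simp add: algebra_simps)
qed

lemma ideal_iff: "Poly_Mapping.keys f \<subseteq> paths \<Longrightarrow> f \<in> \<I> \<longleftrightarrow> normal_form \<Gamma> f = 0"
  using ideal_normal_form[of f] diff_normal_form_in_ideal[of f] by auto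

section \<open>The quotient map and equality in the algebra\<close>

definition proj :: "(('p, 'a \<times> nat) qpath \<Rightarrow>\<^sub>0 'k) \<Rightarrow> (('p, 'a \<times> nat) qpath \<Rightarrow>\<^sub>0 'k) set" where
  "proj f = \<I> +>\<^bsub>A\<^esub> f"

sublocale \<Lambda>: ring \<Lambda>
  unfolding brauer_algebra_def by (rule \<I>.quotient_is_ring)

lemma proj_hom: "proj \<in> ring_hom A \<Lambda>"
  using \<I>.rcos_ring_hom unfolding brauer_algebra_def proj_def[abs_def] .

lemma carrier_\<Lambda>: "carrier \<Lambda> = proj ` {f. Poly_Mapping.keys f \<subseteq> paths}"
  by (auto simp: brauer_algebra_def FactRing_def A_RCOSETS_def' proj_def)

lemma proj_closed [simp]: "Poly_Mapping.keys f \<subseteq> paths \<Longrightarrow> proj f \<in> carrier \<Lambda>"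
  by (auto simp: carrier_\<Lambda>)

lemma proj_add [simp]: "Poly_Mapping.keys f \<subseteq> paths \<Longrightarrow> Poly_Mapping.keys g \<subseteq> paths \<Longrightarrow> proj f \<oplus>\<^bsub>\<Lambda>\<^esub> proj g = proj (f + g)"
  using ring_hom_add[OF proj_hom, of f g] by simp

lemma proj_mult [simp]: "Poly_Mapping.keys f \<subseteq> paths \<Longrightarrow> Poly_Mapping.keys g \<subseteq> paths \<Longrightarrow> proj f \<otimes>\<^bsub>\<Lambda>\<^esub> proj g = proj (path_mult f g)"
  using ring_hom_mult[OF proj_hom, of f g] by simp

lemma proj_zero: "\<zero>\<^bsub>\<Lambda>\<^esub> = proj 0"
  using ring_hom_zero[OF proj_hom A.ring_axioms \<Lambda>.ring_axioms] by simp

lemma proj_one: "\<one>\<^bsub>\<Lambda>\<^esub> = proj (\<Sum>v\<in>polygons \<Gamma>. Poly_Mapping.single (v, [], v) 1)"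
  using ring_hom_one[OF proj_hom] by simp

text \<open>The ideal consists of the elements with normal form zero, so equality of classes is
  decided by formal sums of reduced paths. Linear independence of the reduced paths in
  \<open>\<Lambda>\<close> rests on this.\<close>

lemma proj_eq_iff:
  assumes "Poly_Mapping.keys f \<subseteq> paths" "Poly_Mapping.keys g \<subseteq> paths"
  shows "proj f = proj g \<longleftrightarrow> normal_form \<Gamma> f = normal_form \<Gamma> g"
proof -
  have "abelian_subgroup \<I> A"
    using \<I>.additive_subgroup_axioms A.abelian_group_axioms by (rule abelian_subgroupI3)
  then have "proj f = proj g \<longleftrightarrow> f \<ominus>\<^bsub>A\<^esub> g \<in> \<I>"
    unfolding proj_def using assms by (intro abelian_subgroup.coset_eq_iff) auto
  moreover have "Poly_Mapping.keys (f - g) \<subseteq> paths"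
    using assms Poly_Mapping.keys_add[of f "- g"] by (auto simp: in_keys_iff lookup_minus)
  ultimately show ?thesis
    using ideal_iff[of "f - g"] A_diff[OF assms] by simp
qed

lemma proj_normal_form: "Poly_Mapping.keys f \<subseteq> paths \<Longrightarrow> proj (normal_form \<Gamma> f) = proj f"
  using normal_form_reduced[of f] normal_form_id[of "normal_form \<Gamma> f"]
  by (subst proj_eq_iff) (auto simp: reduced_def)

lemma proj_uminus: "Poly_Mapping.keys f \<subseteq> paths \<Longrightarrow> \<ominus>\<^bsub>\<Lambda>\<^esub> proj f = proj (- f)"
  using \<Lambda>.minus_equality[of "proj (- f)" "proj f"] proj_zero by (simp add: in_keys_iff subset_iff)

section \<open>Ground field, arrow ideal and idempotents of the algebra\<close>

definition scalar :: "'k \<Rightarrow> ('p, 'a \<times> nat) qpath \<Rightarrow>\<^sub>0 'k" where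
  "scalar c = (\<Sum>v\<in>polygons \<Gamma>. Poly_Mapping.single (v, [], v) c)"

definition scalars :: "(('p, 'a \<times> nat) qpath \<Rightarrow>\<^sub>0 'k) set set" where
  "scalars = range (\<lambda>c. proj (scalar c))"

definition arrow_ideal :: "(('p, 'a \<times> nat) qpath \<Rightarrow>\<^sub>0 'k) set set" where
  "arrow_ideal = proj ` {f. Poly_Mapping.keys f \<subseteq> {x \<in> paths. fst (snd x) \<noteq> []}}"

lemma trivial_path: "v \<in> polygons \<Gamma> \<Longrightarrow> (v, [], v) \<in> paths"
  by (simp add: quiver_paths_def Q.awalk_Nil_iff)

lemma keys_scalar [simp]: "Poly_Mapping.keys (scalar c) \<subseteq> paths"
  unfolding scalar_def by (intro keys_sum_subset) (simp add: trivial_path)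

lemma scalar_0 [simp]: "scalar 0 = 0"
  by (simp add: scalar_def)

lemma scalar_add: "scalar (c + d) = scalar c + scalar d"
  by (simp add: scalar_def single_add sum.distrib)

lemma scalar_mult_single:
  assumes "x \<in> paths"
  shows "path_mult (scalar c) (Poly_Mapping.single x d) = Poly_Mapping.single x (c * d)"
    and "path_mult (Poly_Mapping.single x d) (scalar c) = Poly_Mapping.single x (d * c)"
  using Q.sum_trivial_mult[where u = "fst x" and p = "fst (snd x)" and w = "snd (snd x)" and c = c and d = d] finite_polygons assms
  by (simp_all add: scalar_def)

lemma scalar_mult_scalar: "path_mult (scalar c) (scalar d) = scalar (c * d)"
  unfolding scalar_def[of d] scalar_def[of "c * d"]
  by (simp add: path_mult_sum_right scalar_mult_single trivial_path)

lemma scalar_commute: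
  assumes "Poly_Mapping.keys f \<subseteq> paths"
  shows "path_mult (scalar c) f = path_mult f (scalar c)"
  using assms
  by (induction rule: poly_mapping_additive_induct)
    (simp_all add: path_mult_add scalar_mult_single mult.commute)

lemma normal_form_trivial:
  "normal_form \<Gamma> (Poly_Mapping.single (v, [], v) c) = Poly_Mapping.single (v, [], v) c"
  by (simp add: normal_form_single reduce_single_def)

lemma normal_form_scalar: "normal_form \<Gamma> (scalar c) = scalar c"
proof -
  have "Poly_Mapping.keys (scalar c) \<subseteq> reduced"
    unfolding scalar_def by (intro keys_sum_subset) (simp add: reduced_def trivial_path)
  then show ?thesis by (rule normal_form_id)
qed

lemma scalar_eq_0_iff: "scalar c = 0 \<longleftrightarrow> c = 0"
proof
  assume "scalar c = 0"
  moreover obtain v where v: "v \<in> polygons \<Gamma>" using polygons_nonempty by blast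
  have "Poly_Mapping.lookup (scalar c) (v, [], v) = c"
    using v finite_polygons
    by (simp add: scalar_def lookup_sum lookup_single when_def sum.delta)
  ultimately show "c = 0" by simp
qed simp

lemma proj_scalar_eq_zero_iff: "proj (scalar c) = \<zero>\<^bsub>\<Lambda>\<^esub> \<longleftrightarrow> c = 0"
  unfolding proj_zero by (subst proj_eq_iff) (simp_all add: normal_form_scalar scalar_eq_0_iff)

lemma one_eq_scalar: "\<one>\<^bsub>\<Lambda>\<^esub> = proj (scalar 1)"
  by (simp add: proj_one scalar_def)

lemma scalars_closed: "scalars \<subseteq> carrier \<Lambda>"
  by (auto simp: scalars_def)

lemma scalars_central:
  assumes "k \<in> scalars" "x \<in> carrier \<Lambda>"
  shows "k \<otimes>\<^bsub>\<Lambda>\<^esub> x = x \<otimes>\<^bsub>\<Lambda>\<^esub> k"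
  using assms by (auto simp: scalars_def carrier_\<Lambda> scalar_commute)

lemma scalars_subfield: "subfield scalars \<Lambda>"
proof (rule \<Lambda>.subfieldI)
  have "subring scalars \<Lambda>"
  proof (rule \<Lambda>.subringI)
    fix h assume "h \<in> scalars"
    then obtain c where c: "h = proj (scalar c)" by (auto simp: scalars_def)
    have "- scalar c = scalar (- c)" using scalar_add[of c "- c"] by (simp add: eq_neg_iff_add_eq_0 add.commute minus_unique)
    then show "\<ominus>\<^bsub>\<Lambda>\<^esub> h \<in> scalars" by (simp add: c proj_uminus scalars_def)
  next
    fix h h' assume "h \<in> scalars" "h' \<in> scalars"
    then show "h \<otimes>\<^bsub>\<Lambda>\<^esub> h' \<in> scalars" "h \<oplus>\<^bsub>\<Lambda>\<^esub> h' \<in> scalars"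
      by (auto simp: scalars_def scalar_mult_scalar scalar_add[symmetric])
  qed (auto simp: scalars_closed one_eq_scalar scalars_def)
  then show "subcring scalars \<Lambda>"
    using scalars_central scalars_closed by (intro \<Lambda>.subcringI) auto
  show "Units (\<Lambda>\<lparr>carrier := scalars\<rparr>) = scalars - {\<zero>\<^bsub>\<Lambda>\<^esub>}"
  proof (intro equalityI subsetI)
    fix k assume "k \<in> Units (\<Lambda>\<lparr>carrier := scalars\<rparr>)"
    then obtain k' where k: "k \<in> scalars" "k' \<in> scalars" "k' \<otimes>\<^bsub>\<Lambda>\<^esub> k = \<one>\<^bsub>\<Lambda>\<^esub>"
      by (auto simp: Units_def)
    moreover have "\<one>\<^bsub>\<Lambda>\<^esub> \<noteq> \<zero>\<^bsub>\<Lambda>\<^esub>" by (simp add: one_eq_scalar proj_scalar_eq_zero_iff)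
    ultimately have "k \<noteq> \<zero>\<^bsub>\<Lambda>\<^esub>" using scalars_closed by auto
    then show "k \<in> scalars - {\<zero>\<^bsub>\<Lambda>\<^esub>}" using k by blast
  next
    fix k assume k: "k \<in> scalars - {\<zero>\<^bsub>\<Lambda>\<^esub>}"
    then obtain c where c: "k = proj (scalar c)" "c \<noteq> 0"
      using proj_scalar_eq_zero_iff by (auto simp: scalars_def)
    have "proj (scalar (inverse c)) \<in> scalars" by (simp add: scalars_def)
    moreover have "proj (scalar (inverse c)) \<otimes>\<^bsub>\<Lambda>\<^esub> k = \<one>\<^bsub>\<Lambda>\<^esub>" "k \<otimes>\<^bsub>\<Lambda>\<^esub> proj (scalar (inverse c)) = \<one>\<^bsub>\<Lambda>\<^esub>"
      using c by (simp_all add: scalar_mult_scalar one_eq_scalar)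
    ultimately show "k \<in> Units (\<Lambda>\<lparr>carrier := scalars\<rparr>)"
      using k by (auto simp: Units_def)
  qed
qed

lemma idempotent_eq: "brauer_idempotent \<Gamma> v = proj (Poly_Mapping.single (v, [], v) 1)"
  by (simp add: brauer_idempotent_def proj_def)

lemma arrow_ideal_ideal: "ideal arrow_ideal \<Lambda>"
proof -
  let ?N = "{x \<in> paths. fst (snd x) \<noteq> []}"
  have closed: "Poly_Mapping.keys (path_mult f g) \<subseteq> ?N"
    if fg: "Poly_Mapping.keys f \<subseteq> paths" "Poly_Mapping.keys g \<subseteq> paths"
      and "Poly_Mapping.keys f \<subseteq> ?N \<or> Poly_Mapping.keys g \<subseteq> ?N" for f g :: "('p, 'a \<times> nat) qpath \<Rightarrow>\<^sub>0 'k"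
  proof
    fix z assume z: "z \<in> Poly_Mapping.keys (path_mult f g)"
    then obtain u p v q w where "z = (u, p @ q, w)" "(u, p, v) \<in> Poly_Mapping.keys f" "(v, q, w) \<in> Poly_Mapping.keys g"
      by (rule keys_path_mult)
    moreover from z have "z \<in> paths" using Q.path_mult_closed[OF fg] by blast
    ultimately show "z \<in> ?N" using that(3) by auto
  qed
  show ?thesis
  proof (rule idealI[OF \<Lambda>.ring_axioms])
    show "subgroup arrow_ideal (add_monoid \<Lambda>)"
    proof (rule \<Lambda>.add.subgroupI)
      fix a assume "a \<in> arrow_ideal"
      then obtain f where f: "a = proj f" "Poly_Mapping.keys f \<subseteq> ?N" by (auto simp: arrow_ideal_def)
      moreover have "Poly_Mapping.keys (- f) = Poly_Mapping.keys f" by (auto simp: in_keys_iff)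
      moreover have "\<ominus>\<^bsub>\<Lambda>\<^esub> a = proj (- f)" unfolding f(1) using f(2) by (intro proj_uminus) auto
      ultimately show "\<ominus>\<^bsub>\<Lambda>\<^esub> a \<in> arrow_ideal" by (auto simp: arrow_ideal_def)
    next
      fix a b assume "a \<in> arrow_ideal" "b \<in> arrow_ideal"
      then obtain f g where f: "a = proj f" "Poly_Mapping.keys f \<subseteq> ?N" "b = proj g" "Poly_Mapping.keys g \<subseteq> ?N"
        by (auto simp: arrow_ideal_def)
      then have "a \<oplus>\<^bsub>\<Lambda>\<^esub> b = proj (f + g)" by (auto intro!: proj_add)
      moreover have "Poly_Mapping.keys (f + g) \<subseteq> ?N"
        using f(2,4) Poly_Mapping.keys_add[of f g] by (meson Un_least subset_trans)
      ultimately show "a \<oplus>\<^bsub>\<Lambda>\<^esub> b \<in> arrow_ideal" unfolding arrow_ideal_def by blast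
    qed (auto simp: arrow_ideal_def subset_iff intro!: proj_closed intro: exI[of _ 0])
  next
    fix a x assume "a \<in> arrow_ideal" "x \<in> carrier \<Lambda>"
    then obtain f g where f: "a = proj f" "Poly_Mapping.keys f \<subseteq> ?N" "x = proj g" "Poly_Mapping.keys g \<subseteq> paths"
      by (auto simp: arrow_ideal_def carrier_\<Lambda>)
    then have f': "Poly_Mapping.keys f \<subseteq> paths" by auto
    show "x \<otimes>\<^bsub>\<Lambda>\<^esub> a \<in> arrow_ideal"
      using closed[OF f(4) f'] f(2) f' f(4) unfolding f(1,3) arrow_ideal_def by auto
    show "a \<otimes>\<^bsub>\<Lambda>\<^esub> x \<in> arrow_ideal"
      using closed[OF f' f(4)] f(2) f' f(4) unfolding f(1,3) arrow_ideal_def by auto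
  qed
qed

text \<open>The sum over all vertices merely serves as one bound above every individual full
  length.\<close>

lemma reduce_long:
  assumes "(u, p, v) \<in> paths" "length p > (\<Sum>\<alpha>\<in>vertices \<Gamma>. mu \<Gamma> \<alpha> * valency \<Gamma> \<alpha>)"
  shows "reduce \<Gamma> (u, p, v) = None"
proof -
  have "p \<noteq> []" using assms(2) by auto
  obtain \<alpha> l where al: "hd p = (\<alpha>, l)" by (cases "hd p")
  have "\<alpha> \<in> vertices \<Gamma>" using path_hd(1)[OF assms(1) \<open>p \<noteq> []\<close> al] by (simp add: nontruncated_def)
  then have "mu \<Gamma> \<alpha> * valency \<Gamma> \<alpha> \<le> (\<Sum>\<alpha>\<in>vertices \<Gamma>. mu \<Gamma> \<alpha> * valency \<Gamma> \<alpha>)"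
    using finite_vertices by (intro member_le_sum) auto
  then show ?thesis using assms(2) \<open>p \<noteq> []\<close> al by (simp add: full_length_def)
qed

text \<open>A product of n elements of the ideal has a representative supported on paths of length
  at least n. Beyond the bound of \<open>reduce_long\<close> all such paths reduce to zero.\<close>

lemma arrow_ideal_nilpotent:
  "\<exists>n. \<forall>xs. set xs \<subseteq> arrow_ideal \<longrightarrow> length xs = n \<longrightarrow> foldr (\<otimes>\<^bsub>\<Lambda>\<^esub>) xs \<one>\<^bsub>\<Lambda>\<^esub> = \<zero>\<^bsub>\<Lambda>\<^esub>"
proof -
  let ?L = "Suc (\<Sum>\<alpha>\<in>vertices \<Gamma>. mu \<Gamma> \<alpha> * valency \<Gamma> \<alpha>)"
  have prod: "\<exists>f. Poly_Mapping.keys f \<subseteq> {x \<in> paths. length (fst (snd x)) \<ge> length xs} \<and>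
      foldr (\<otimes>\<^bsub>\<Lambda>\<^esub>) xs \<one>\<^bsub>\<Lambda>\<^esub> = proj f" if "set xs \<subseteq> arrow_ideal" for xs
    using that
  proof (induction xs)
    case Nil
    show ?case using keys_scalar[of 1] by (intro exI[of _ "scalar 1"]) (simp add: one_eq_scalar)
  next
    case (Cons a xs)
    then obtain g where g: "Poly_Mapping.keys g \<subseteq> {x \<in> paths. length (fst (snd x)) \<ge> length xs}"
        "foldr (\<otimes>\<^bsub>\<Lambda>\<^esub>) xs \<one>\<^bsub>\<Lambda>\<^esub> = proj g" by auto
    obtain f where f: "a = proj f" "Poly_Mapping.keys f \<subseteq> {x \<in> paths. fst (snd x) \<noteq> []}"
      using Cons.prems by (auto simp: arrow_ideal_def)
    have fg: "Poly_Mapping.keys f \<subseteq> paths" "Poly_Mapping.keys g \<subseteq> paths" using f g by auto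
    have "Poly_Mapping.keys (path_mult f g) \<subseteq> {x \<in> paths. length (fst (snd x)) \<ge> length (a # xs)}"
    proof
      fix z assume z: "z \<in> Poly_Mapping.keys (path_mult f g)"
      then obtain u p v q w where *: "z = (u, p @ q, w)" "(u, p, v) \<in> Poly_Mapping.keys f" "(v, q, w) \<in> Poly_Mapping.keys g"
        by (rule keys_path_mult)
      have "p \<noteq> []" "length q \<ge> length xs" using * f(2) g(1) by auto
      then have "length (p @ q) \<ge> length (a # xs)" by (cases p) auto
      moreover from z have "z \<in> paths" using Q.path_mult_closed[OF fg] by blast
      ultimately show "z \<in> {x \<in> paths. length (fst (snd x)) \<ge> length (a # xs)}" using *(1) by simp
    qed
    then show ?case using f(1) g(2) fg by auto
  qed
  have zero: "proj f = \<zero>\<^bsub>\<Lambda>\<^esub>" if f: "Poly_Mapping.keys f \<subseteq> {x \<in> paths. length (fst (snd x)) \<ge> ?L}" for f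
  proof -
    have "normal_form \<Gamma> f = 0"
    proof (rule normal_form_eq_0)
      fix x assume "x \<in> Poly_Mapping.keys f"
      then show "reduce \<Gamma> x = None"
        using f reduce_long[of "fst x" "fst (snd x)" "snd (snd x)"] by auto
    qed
    then show ?thesis unfolding proj_zero using f by (subst proj_eq_iff) auto
  qed
  show ?thesis
  proof (intro exI[of _ ?L] allI impI)
    fix xs assume xs: "set xs \<subseteq> arrow_ideal" "length xs = ?L"
    show "foldr (\<otimes>\<^bsub>\<Lambda>\<^esub>) xs \<one>\<^bsub>\<Lambda>\<^esub> = \<zero>\<^bsub>\<Lambda>\<^esub>"
      using prod[OF xs(1)] zero unfolding xs(2) by auto
  qed
qed

text \<open>The trivial path at v keeps only the paths starting at v: the trivial one contributes to
  c, all others to z. This supplies \<open>e_decomp\<close>.\<close>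

lemma trivial_mult_decomp:
  assumes v: "v \<in> polygons \<Gamma>" and f: "Poly_Mapping.keys f \<subseteq> paths"
  shows "\<exists>c z. Poly_Mapping.keys z \<subseteq> {x \<in> paths. fst (snd x) \<noteq> []} \<and>
    path_mult (Poly_Mapping.single (v, [], v) (1::'k)) f = Poly_Mapping.single (v, [], v) c + z"
  using f
proof (induction rule: poly_mapping_additive_induct)
  case zero
  then show ?case by (intro exI[of _ 0]) auto
next
  case (single x d)
  obtain u p w where x: "x = (u, p, w)" by (cases x)
  consider "u \<noteq> v" | "u = v" "p = []" "w = v" | "u = v" "p \<noteq> []"
    using single unfolding x by (cases "p = []") (auto simp: quiver_paths_def Q.awalk_Nil_iff)
  then show ?case
  proof cases
    case 1
    then show ?thesis by (intro exI[of _ 0]) (auto simp: x)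
  next
    case 2
    then show ?thesis by (intro exI[of _ d] exI[of _ 0]) (auto simp: x)
  next
    case 3
    then show ?thesis
      using single by (intro exI[of _ 0] exI[of _ "Poly_Mapping.single x d"]) (auto simp: x)
  qed
next
  case (add f g)
  then obtain c z c' z' where *: "Poly_Mapping.keys z \<subseteq> {x \<in> paths. fst (snd x) \<noteq> []}"
      "path_mult (Poly_Mapping.single (v, [], v) (1::'k)) f = Poly_Mapping.single (v, [], v) c + z"
      "Poly_Mapping.keys z' \<subseteq> {x \<in> paths. fst (snd x) \<noteq> []}"
      "path_mult (Poly_Mapping.single (v, [], v) (1::'k)) g = Poly_Mapping.single (v, [], v) c' + z'"
    by blast
  have "Poly_Mapping.keys (z + z') \<subseteq> {x \<in> paths. fst (snd x) \<noteq> []}"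
    using *(1,3) Poly_Mapping.keys_add[of z z'] by (meson Un_least subset_trans)
  moreover have "path_mult (Poly_Mapping.single (v, [], v) (1::'k)) (f + g) =
      Poly_Mapping.single (v, [], v) (c + c') + (z + z')"
    by (simp add: path_mult_add * single_add ac_simps)
  ultimately show ?case by blast
qed

lemma split_algebra: "split_algebra \<Lambda> scalars arrow_ideal (polygons \<Gamma>) (brauer_idempotent \<Gamma>)"
proof (intro split_algebra.intro split_algebra_axioms.intro)
  let ?t = "\<lambda>v. Poly_Mapping.single (v, [], v) (1::'k)"
  show "ring \<Lambda>" by (rule \<Lambda>.ring_axioms)
  show "k \<otimes>\<^bsub>\<Lambda>\<^esub> x = x \<otimes>\<^bsub>\<Lambda>\<^esub> k" if "k \<in> scalars" "x \<in> carrier \<Lambda>" for k x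
    using that by (rule scalars_central)
  show "brauer_idempotent \<Gamma> v \<noteq> \<zero>\<^bsub>\<Lambda>\<^esub>" if "v \<in> polygons \<Gamma>" for v
  proof -
    have "?t v \<noteq> 0" by (metis insert_not_empty keys_single keys_zero zero_neq_one)
    then show ?thesis
      using that unfolding idempotent_eq proj_zero
      by (subst proj_eq_iff) (auto simp: normal_form_trivial trivial_path)
  qed
  have "(\<Oplus>\<^bsub>\<Lambda>\<^esub>v\<in>F. brauer_idempotent \<Gamma> v) = proj (\<Sum>v\<in>F. ?t v) \<and> Poly_Mapping.keys (\<Sum>v\<in>F. ?t v) \<subseteq> paths"
    if "finite F" "F \<subseteq> polygons \<Gamma>" for F
    using that
  proof (induction F rule: finite_induct)
    case empty
    then show ?case by (simp add: proj_zero)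
  next
    case (insert v F)
    then have IH: "(\<Oplus>\<^bsub>\<Lambda>\<^esub>v\<in>F. brauer_idempotent \<Gamma> v) = proj (\<Sum>v\<in>F. ?t v)"
        "Poly_Mapping.keys (\<Sum>v\<in>F. ?t v) \<subseteq> paths" "v \<in> polygons \<Gamma>" by auto
    have "Poly_Mapping.keys (\<Sum>v\<in>insert v F. ?t v) \<subseteq> paths"
      using insert.prems by (intro keys_sum_subset) (auto simp: trivial_path)
    moreover have "(\<Oplus>\<^bsub>\<Lambda>\<^esub>v\<in>insert v F. brauer_idempotent \<Gamma> v) =
        brauer_idempotent \<Gamma> v \<oplus>\<^bsub>\<Lambda>\<^esub> (\<Oplus>\<^bsub>\<Lambda>\<^esub>v\<in>F. brauer_idempotent \<Gamma> v)"
      using insert by (intro \<Lambda>.finsum_insert) (auto simp: idempotent_eq trivial_path subset_iff)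
    ultimately show ?case
      using insert.hyps IH by (simp add: idempotent_eq trivial_path)
  qed
  then show "(\<Oplus>\<^bsub>\<Lambda>\<^esub>v\<in>polygons \<Gamma>. brauer_idempotent \<Gamma> v) = \<one>\<^bsub>\<Lambda>\<^esub>"
    using finite_polygons by (simp add: proj_one)
  show "\<exists>k\<in>scalars. \<exists>z\<in>arrow_ideal. brauer_idempotent \<Gamma> v \<otimes>\<^bsub>\<Lambda>\<^esub> x =
      k \<otimes>\<^bsub>\<Lambda>\<^esub> brauer_idempotent \<Gamma> v \<oplus>\<^bsub>\<Lambda>\<^esub> z" if v: "v \<in> polygons \<Gamma>" and x: "x \<in> carrier \<Lambda>" for v x
  proof -
    obtain f where f: "x = proj f" "Poly_Mapping.keys f \<subseteq> paths" using x by (auto simp: carrier_\<Lambda>)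
    obtain c z where cz: "Poly_Mapping.keys z \<subseteq> {x \<in> paths. fst (snd x) \<noteq> []}"
        "path_mult (?t v) f = Poly_Mapping.single (v, [], v) c + z"
      using trivial_mult_decomp[OF v f(2)] by blast
    have "Poly_Mapping.keys z \<subseteq> paths" using cz(1) by auto
    then have "brauer_idempotent \<Gamma> v \<otimes>\<^bsub>\<Lambda>\<^esub> x =
        proj (scalar c) \<otimes>\<^bsub>\<Lambda>\<^esub> brauer_idempotent \<Gamma> v \<oplus>\<^bsub>\<Lambda>\<^esub> proj z"
      using v f(2) by (simp add: idempotent_eq f(1) cz(2) scalar_mult_single trivial_path)
    then show ?thesis using cz(1) unfolding scalars_def arrow_ideal_def by blast
  qed
qed (simp_all add: scalars_subfield finite_polygons arrow_ideal_ideal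
    arrow_ideal_nilpotent idempotent_eq trivial_path proj_zero[symmetric])

sublocale split: split_algebra \<Lambda> scalars arrow_ideal "polygons \<Gamma>" "brauer_idempotent \<Gamma>"
  by (rule split_algebra)

end

section \<open>Counting reduced paths\<close>

text \<open>Translation by l permutes the residues modulo t, so each of the m turns contributes the
  same number of hits.\<close>

lemma card_periodic:
  fixes P :: "nat \<Rightarrow> bool"
  assumes "t > 0"
  shows "card {n. n < m * t \<and> P ((l + n) mod t)} = m * card {j. j < t \<and> P j}"
proof -
  have inj: "inj_on (\<lambda>n. (l + n) mod t) {..<t}"
  proof (rule linorder_inj_onI)
    fix x y assume xy: "x < y" "x \<in> {..<t}" "y \<in> {..<t}"
    then have "\<not> t dvd (l + y) - (l + x)" by (auto dest: dvd_imp_le)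
    then show "(l + x) mod t \<noteq> (l + y) mod t"
      using xy(1) mod_eq_dvd_iff_nat[of "l + x" "l + y" t] by auto
  qed auto
  have "(\<lambda>n. (l + n) mod t) ` {..<t} \<subseteq> {..<t}" using assms by auto
  then have im: "(\<lambda>n. (l + n) mod t) ` {..<t} = {..<t}"
    using endo_inj_surj[OF finite_lessThan _ inj] by blast
  have "{j. j < t \<and> P j} = (\<lambda>n. (l + n) mod t) ` {n. n < t \<and> P ((l + n) mod t)}"
    using im by auto
  moreover have "inj_on (\<lambda>n. (l + n) mod t) {n. n < t \<and> P ((l + n) mod t)}"
    using inj by (rule inj_on_subset) auto
  ultimately have one: "card {n. n < t \<and> P ((l + n) mod t)} = card {j. j < t \<and> P j}"
    by (simp add: card_image)
  show ?thesis
  proof (induction m)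
    case (Suc m)
    let ?B = "{n. n < t \<and> P ((l + n) mod t)}"
    have shift: "(l + (n + m * t)) mod t = (l + n) mod t" for n
      by (metis add.assoc mod_mult_self1)
    have "{n. n < Suc m * t \<and> P ((l + n) mod t)} =
        {n. n < m * t \<and> P ((l + n) mod t)} \<union> (\<lambda>n. n + m * t) ` ?B"
    proof (intro equalityI subsetI)
      fix n assume n: "n \<in> {n. n < Suc m * t \<and> P ((l + n) mod t)}"
      show "n \<in> {n. n < m * t \<and> P ((l + n) mod t)} \<union> (\<lambda>n. n + m * t) ` ?B"
      proof (cases "n < m * t")
        case False
        then have "n = (n - m * t) + m * t" "n - m * t < t" using n by auto
        then show ?thesis using n shift[of "n - m * t"] by auto
      qed (use n in auto)
    qed (auto simp: shift)
    moreover have "{n. n < m * t \<and> P ((l + n) mod t)} \<inter> (\<lambda>n. n + m * t) ` ?B = {}" by auto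
    moreover have "card ((\<lambda>n. n + m * t) ` ?B) = card ?B" by (intro card_image) (simp add: inj_on_def)
    ultimately show ?case using Suc one by (simp add: card_Un_disjoint)
  qed simp
qed

context brauer_configuration
begin

definition reduced_between :: "'p \<Rightarrow> 'p \<Rightarrow> ('p, 'a \<times> nat) qpath set" where
  "reduced_between W V = {x \<in> reduced. fst x = W \<and> snd (snd x) = V}"

text \<open>Start position and length encode the reduced paths from W to V; the strict bounds on n
  leave out the trivial path and the full powers.\<close>

definition proper_segments :: "'p \<Rightarrow> 'p \<Rightarrow> (('a \<times> nat) \<times> nat) set" where
  "proper_segments W V = (SIGMA al : special_at \<Gamma> W.
     {n. n > 0 \<and> n < mu \<Gamma> (fst al) * valency \<Gamma> (fst al) \<and>
       orient \<Gamma> (fst al) ! ((snd al + n) mod valency \<Gamma> (fst al)) = V})"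

lemma special_at_Sigma:
  "V \<in> polygons \<Gamma> \<Longrightarrow>
   special_at \<Gamma> V = (SIGMA \<alpha> : nontruncated \<Gamma>. {l. l < valency \<Gamma> \<alpha> \<and> orient \<Gamma> \<alpha> ! l = V})"
  using special_at_iff by auto

lemma finite_nontruncated: "finite (nontruncated \<Gamma>)"
  using finite_vertices by (simp add: nontruncated_def)

lemma card_positions:
  assumes "\<alpha> \<in> nontruncated \<Gamma>" "V \<in> polygons \<Gamma>"
  shows "card {l. l < valency \<Gamma> \<alpha> \<and> orient \<Gamma> \<alpha> ! l = V} = occ \<Gamma> \<alpha> V"
proof -
  have "(=) V = (\<lambda>x. x = V)" by auto
  then have "occ \<Gamma> \<alpha> V = length (filter (\<lambda>x. x = V) (orient \<Gamma> \<alpha>))"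
    using count_orient[OF assms] unfolding count_mset count_list_eq_length_filter by simp
  then show ?thesis
    by (simp add: length_filter_conv_card length_orient[OF assms(1)])
qed

lemma finite_special_at: "V \<in> polygons \<Gamma> \<Longrightarrow> finite (special_at \<Gamma> V)"
  using finite_nontruncated by (simp add: special_at_Sigma)

lemma finite_proper_segments: "W \<in> polygons \<Gamma> \<Longrightarrow> finite (proper_segments W V)"
  using finite_special_at by (simp add: proper_segments_def)

text \<open>There are occ(\<alpha>, W) starting positions around \<alpha>. From each, the mu turns
  pass V exactly mu occ(\<alpha>, V) times when n runs from 0 up to the full length, exclusively.
  For V = W the value n = 0 is one of these hits and has to be dropped, whence the -1.\<close>

lemma card_proper_segments:
  assumes W: "W \<in> polygons \<Gamma>" and V: "V \<in> polygons \<Gamma>"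
  shows "int (card (proper_segments W V)) =
    (\<Sum>\<alpha>\<in>nontruncated \<Gamma>. int (occ \<Gamma> \<alpha> W) * (int (mu \<Gamma> \<alpha>) * int (occ \<Gamma> \<alpha> V) - (if V = W then 1 else 0)))"
proof -
  have block: "int (card {n. n > 0 \<and> n < mu \<Gamma> \<alpha> * valency \<Gamma> \<alpha> \<and>
        orient \<Gamma> \<alpha> ! ((l + n) mod valency \<Gamma> \<alpha>) = V}) =
      int (mu \<Gamma> \<alpha>) * int (occ \<Gamma> \<alpha> V) - (if V = W then 1 else 0)" (is "int (card ?N) = _")
    if al: "\<alpha> \<in> nontruncated \<Gamma>" "l < valency \<Gamma> \<alpha>" "orient \<Gamma> \<alpha> ! l = W" for \<alpha> l
  proof -
    let ?M = "{n. n < mu \<Gamma> \<alpha> * valency \<Gamma> \<alpha> \<and> orient \<Gamma> \<alpha> ! ((l + n) mod valency \<Gamma> \<alpha>) = V}"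
    have M: "card ?M = mu \<Gamma> \<alpha> * occ \<Gamma> \<alpha> V"
      using card_periodic[OF valency_pos[OF al(1)], of "mu \<Gamma> \<alpha>" "\<lambda>j. orient \<Gamma> \<alpha> ! j = V" l]
        card_positions[OF al(1) V] by simp
    have "mu \<Gamma> \<alpha> * valency \<Gamma> \<alpha> > 0" using mu_valency_gt_1[OF al(1)] by linarith
    then have ins: "?M = (if V = W then insert 0 ?N else ?N)"
      using al by (auto intro: gr0I)
    have "finite ?N" by simp
    then have "int (card ?N) + (if V = W then 1 else 0) = int (card ?M)"
      unfolding ins by simp
    then show ?thesis unfolding M by simp
  qed
  have "int (card (proper_segments W V)) = (\<Sum>al\<in>special_at \<Gamma> W.
      int (mu \<Gamma> (fst al)) * int (occ \<Gamma> (fst al) V) - (if V = W then 1 else 0))"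
    unfolding proper_segments_def using finite_special_at[OF W] block special_at_iff[OF W]
    by (subst card_SigmaI) (auto intro!: sum.cong)
  also have "\<dots> = (\<Sum>\<alpha>\<in>nontruncated \<Gamma>. \<Sum>l\<in>{l. l < valency \<Gamma> \<alpha> \<and> orient \<Gamma> \<alpha> ! l = W}.
      int (mu \<Gamma> \<alpha>) * int (occ \<Gamma> \<alpha> V) - (if V = W then 1 else 0))"
    unfolding special_at_Sigma[OF W] using finite_nontruncated
    by (subst sum.Sigma) (auto intro!: sum.cong)
  also have "\<dots> = (\<Sum>\<alpha>\<in>nontruncated \<Gamma>. int (occ \<Gamma> \<alpha> W) *
      (int (mu \<Gamma> \<alpha>) * int (occ \<Gamma> \<alpha> V) - (if V = W then 1 else 0)))"
    using W by (intro sum.cong) (simp_all add: card_positions)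
  finally show ?thesis .
qed

lemma reduced_between_eq:
  assumes W: "W \<in> polygons \<Gamma>"
  shows "reduced_between W V =
    (\<lambda>((\<alpha>, l), n). (W, special_segment \<Gamma> \<alpha> l n, V)) ` proper_segments W V \<union>
    (if V = W then {(W, [], W), (W, socle \<Gamma> W, W)} else {})" (is "_ = ?f ` _ \<union> ?E")
proof (intro equalityI subsetI)
  fix x assume "x \<in> reduced_between W V"
  then obtain p where x: "x = (W, p, V)" and path: "(W, p, V) \<in> paths"
    and red: "reduce \<Gamma> (W, p, V) = Some (W, p, V)"
    by (cases x) (auto simp: reduced_between_def reduced_def simp del: reduce.simps)
  show "x \<in> ?f ` proper_segments W V \<union> ?E"
  proof (cases "p = []")
    case True
    then show ?thesis using path by (simp add: x quiver_paths_def Q.awalk_Nil_iff)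
  next
    case False
    obtain \<alpha> l where al: "hd p = (\<alpha>, l)" by (cases "hd p")
    have ch: "chain \<Gamma> p" "length p \<le> full_length \<Gamma> p" using red False by (auto split: if_splits)
    show ?thesis
    proof (cases "length p = full_length \<Gamma> p")
      case True
      \<comment> \<open>A reduced path of full length equals its own reduction, which is the chosen
        socle.\<close>
      then have "socle \<Gamma> W = p" "W = V" using red False ch by auto
      then show ?thesis by (simp add: x)
    next
      case neq: False
      note hd = path_hd[OF path False al] and seg = chain_path[OF path False al ch(1)]
      have "((\<alpha>, l), length p) \<in> proper_segments W V"
        using hd(5) seg(2) False neq ch(2) al by (simp add: proper_segments_def full_length_def)
      moreover have "x = ?f ((\<alpha>, l), length p)" using seg(1) by (simp add: x)
      ultimately show ?thesis by blast
    qed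
  qed
next
  fix x assume "x \<in> ?f ` proper_segments W V \<union> ?E"
  then show "x \<in> reduced_between W V"
  proof
    assume "x \<in> ?f ` proper_segments W V"
    then obtain \<alpha> l n where x: "x = (W, special_segment \<Gamma> \<alpha> l n, V)"
      and n: "(\<alpha>, l) \<in> special_at \<Gamma> W" "n > 0" "n < mu \<Gamma> \<alpha> * valency \<Gamma> \<alpha>"
        "orient \<Gamma> \<alpha> ! ((l + n) mod valency \<Gamma> \<alpha>) = V"
      by (auto simp: proper_segments_def)
    have al: "\<alpha> \<in> nontruncated \<Gamma>" "l < valency \<Gamma> \<alpha>" "orient \<Gamma> \<alpha> ! l = W"
      using n(1) special_at_iff[OF W] by auto
    have "length (special_segment \<Gamma> \<alpha> l n) > 0" using n(2) by simp
    then have "special_segment \<Gamma> \<alpha> l n \<noteq> []" by blast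
    then have "reduce \<Gamma> x = Some x"
      using n(2,3) al(2) by (simp add: x chain_special_segment full_length_def hd_special_segment)
    then show ?thesis
      using special_segment_path[OF al(1), of l n] al n(4)
      by (simp add: reduced_between_def reduced_def x del: reduce.simps)
  next
    assume "x \<in> ?E"
    then have VW: "V = W" and x: "x = (W, [], W) \<or> x = (W, socle \<Gamma> W, W)" by (auto split: if_splits)
    obtain \<alpha> l where "(\<alpha>, l) \<in> special_at \<Gamma> W" "socle \<Gamma> W = special_power \<Gamma> \<alpha> l"
      using socle_eq[OF W] .
    then have "(W, socle \<Gamma> W, W) \<in> paths" using special_power_path[OF W] by simp
    moreover have "(W, [], W) \<in> paths" using W by (simp add: quiver_paths_def Q.awalk_Nil_iff)
    ultimately show ?thesis
      using x VW reduce_socle[OF W] by (auto simp: reduced_between_def reduced_def)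
  qed
qed

lemma finite_reduced_between: "W \<in> polygons \<Gamma> \<Longrightarrow> finite (reduced_between W V)"
  using finite_proper_segments by (simp add: reduced_between_eq)

text \<open>The constant 2 of the diagonal formula counts the trivial path and the socle. A proper
  segment differs from both by its length, and its first arrow and length recover its code.\<close>

lemma card_reduced_between:
  assumes W: "W \<in> polygons \<Gamma>"
  shows "card (reduced_between W V) = card (proper_segments W V) + (if V = W then 2 else 0)"
proof -
  let ?f = "\<lambda>((\<alpha>, l), n). (W, special_segment \<Gamma> \<alpha> l n, V)"
  let ?E = "if V = W then {(W, [], W), (W, socle \<Gamma> W, W)} else {}"
  have props: "special_segment \<Gamma> \<alpha> l n \<noteq> []" "hd (special_segment \<Gamma> \<alpha> l n) = (\<alpha>, l)"
      "n < mu \<Gamma> \<alpha> * valency \<Gamma> \<alpha>"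
    if "((\<alpha>, l), n) \<in> proper_segments W V" for \<alpha> l n
  proof -
    have n: "n > 0" "n < mu \<Gamma> \<alpha> * valency \<Gamma> \<alpha>" "(\<alpha>, l) \<in> special_at \<Gamma> W"
      using that by (auto simp: proper_segments_def)
    then have l: "length (special_segment \<Gamma> \<alpha> l n) > 0" "l < valency \<Gamma> \<alpha>" using special_at_iff[OF W] by auto
    from l(1) have "special_segment \<Gamma> \<alpha> l n \<noteq> []" by blast
    with l show "special_segment \<Gamma> \<alpha> l n \<noteq> []" "hd (special_segment \<Gamma> \<alpha> l n) = (\<alpha>, l)"
      "n < mu \<Gamma> \<alpha> * valency \<Gamma> \<alpha>"
      using n by (auto simp: hd_special_segment)
  qed
  have "inj_on ?f (proper_segments W V)"
  proof (rule inj_onI)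
    fix x y assume xy: "x \<in> proper_segments W V" "y \<in> proper_segments W V" "?f x = ?f y"
    obtain \<alpha> l n \<beta> m k where *: "x = ((\<alpha>, l), n)" "y = ((\<beta>, m), k)"
      by (metis prod.exhaust)
    then have seg: "special_segment \<Gamma> \<alpha> l n = special_segment \<Gamma> \<beta> m k" using xy(3) by simp
    then have "(\<alpha>, l) = (\<beta>, m)" using props(2) xy(1,2) unfolding * by metis
    moreover have "n = k" using seg length_special_segment by metis
    ultimately show "x = y" by (simp add: *)
  qed
  moreover have "?f ` proper_segments W V \<inter> ?E = {}"
  proof -
    have "special_segment \<Gamma> \<alpha> l n \<noteq> socle \<Gamma> W" if "((\<alpha>, l), n) \<in> proper_segments W V" for \<alpha> l n
    proof
      assume eq: "special_segment \<Gamma> \<alpha> l n = socle \<Gamma> W"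
      have "n = full_length \<Gamma> (special_segment \<Gamma> \<alpha> l n)"
        using socle_props(3)[OF W] unfolding eq[symmetric] by simp
      then show False using props[OF that] by (simp add: full_length_def)
    qed
    then show ?thesis using props(1) by (fastforce split: if_splits)
  qed
  moreover have "card ?E = (if V = W then 2 else 0)"
    using socle_props(1)[OF W] by auto
  ultimately show ?thesis
    unfolding reduced_between_eq[OF W] using finite_proper_segments[OF W]
    by (subst card_Un_disjoint) (auto simp: card_image)
qed

end

section \<open>The Cartan matrix\<close>

context brauer_algebra_over
begin

text \<open>Each further reduced path spans a new line: were its class a combination of the earlier
  ones, equality of normal forms would put it into their support.\<close>

lemma dimension_proj:
  assumes "finite B" "B \<subseteq> reduced"
  shows "\<Lambda>.dimension (card B) scalars (proj ` {f. Poly_Mapping.keys f \<subseteq> B})"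
  using assms
proof (induction B rule: finite_induct)
  case empty
  then show ?case by (simp add: proj_zero[symmetric])
next
  case (insert b B)
  let ?E = "proj ` {f :: ('p, 'a \<times> nat) qpath \<Rightarrow>\<^sub>0 'k. Poly_Mapping.keys f \<subseteq> B}"
  let ?b = "Poly_Mapping.single b (1 :: 'k)"
  have red: "B \<subseteq> reduced" "b \<in> reduced" using insert.prems by auto
  then have paths: "B \<subseteq> paths" "b \<in> paths" by (auto simp: reduced_def)
  have "proj ?b \<notin> ?E"
  proof
    assume "proj ?b \<in> ?E"
    then obtain f where f: "proj ?b = proj f" "Poly_Mapping.keys f \<subseteq> B" by blast
    have "normal_form \<Gamma> ?b = normal_form \<Gamma> f"
      using f paths by (subst proj_eq_iff[symmetric]) auto
    then have "?b = f" using normal_form_id[of f] normal_form_id[of ?b] f(2) red by auto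
    then show False using f(2) insert.hyps(2) by auto
  qed
  moreover have "proj ` {f. Poly_Mapping.keys f \<subseteq> insert b B} = \<Lambda>.line_extension scalars (proj ?b) ?E"
  proof (intro equalityI subsetI)
    fix x assume "x \<in> proj ` {f. Poly_Mapping.keys f \<subseteq> insert b B}"
    then obtain f where f: "x = proj f" "Poly_Mapping.keys f \<subseteq> insert b B" by blast
    \<comment> \<open>Split off the term of f at b; the remainder g is supported on B.\<close>
    define c g where "c = Poly_Mapping.lookup f b" and "g = f - Poly_Mapping.single b c"
    have g: "Poly_Mapping.keys g \<subseteq> B"
    proof
      fix y assume y: "y \<in> Poly_Mapping.keys g"
      then have "y \<noteq> b" by (auto simp: g_def c_def in_keys_iff lookup_minus lookup_single)
      then have "y \<in> Poly_Mapping.keys f"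
        using y by (simp add: g_def in_keys_iff lookup_minus lookup_single when_def)
      then show "y \<in> B" using f(2) \<open>y \<noteq> b\<close> by blast
    qed
    have "f = Poly_Mapping.single b c + g" by (simp add: g_def)
    then have "x = proj (scalar c) \<otimes>\<^bsub>\<Lambda>\<^esub> proj ?b \<oplus>\<^bsub>\<Lambda>\<^esub> proj g"
      using g paths by (simp add: f(1) scalar_mult_single subset_trans)
    then show "x \<in> \<Lambda>.line_extension scalars (proj ?b) ?E"
      unfolding \<Lambda>.line_extension_mem_iff scalars_def using g by blast
  next
    fix x assume "x \<in> \<Lambda>.line_extension scalars (proj ?b) ?E"
    then obtain c g where cg: "x = proj (scalar c) \<otimes>\<^bsub>\<Lambda>\<^esub> proj ?b \<oplus>\<^bsub>\<Lambda>\<^esub> proj g" "Poly_Mapping.keys g \<subseteq> B"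
      unfolding \<Lambda>.line_extension_mem_iff scalars_def by blast
    then have "x = proj (Poly_Mapping.single b c + g)"
      using paths by (simp add: scalar_mult_single subset_trans)
    moreover have "Poly_Mapping.keys (Poly_Mapping.single b c + g) \<subseteq> insert b B"
      using cg(2) Poly_Mapping.keys_add[of "Poly_Mapping.single b c" g] by (auto split: if_splits)
    ultimately show "x \<in> proj ` {f. Poly_Mapping.keys f \<subseteq> insert b B}" by blast
  qed
  ultimately show ?case
    using \<Lambda>.Suc_dim[of "proj ?b" ?E "card B" scalars] insert paths by simp
qed

text \<open>T is an arbitrary condition on source and target, so that one argument serves both for
  fixing the source alone and for fixing both ends.\<close>

lemma normal_form_ends:
  fixes f :: "('p, 'a \<times> nat) qpath \<Rightarrow>\<^sub>0 'k"
  assumes "Poly_Mapping.keys f \<subseteq> {x \<in> paths. T (fst x) (snd (snd x))}"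
  shows "Poly_Mapping.keys (normal_form \<Gamma> f) \<subseteq> {x \<in> reduced. T (fst x) (snd (snd x))}"
  unfolding normal_form_def
proof (rule keys_sum_subset)
  fix x assume "x \<in> Poly_Mapping.keys f"
  then have x: "x \<in> paths" "T (fst x) (snd (snd x))" using assms by auto
  show "Poly_Mapping.keys (reduce_single \<Gamma> x (Poly_Mapping.lookup f x)) \<subseteq>
      {x \<in> reduced. T (fst x) (snd (snd x))}"
  proof (cases "reduce \<Gamma> x")
    case (Some y)
    obtain u p v u' p' v' where xy: "x = (u, p, v)" "y = (u', p', v')" by (metis prod.exhaust)
    have "y \<in> reduced" using reduce_path[OF x(1) Some] by (simp add: reduced_def)
    moreover have "fst y = fst x" "snd (snd y) = snd (snd x)"
      using reduce_ends[of u p v u' p' v'] x(1) Some unfolding xy by auto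
    ultimately show ?thesis using x(2) Some by (simp add: reduce_single_def)
  qed (simp add: reduce_single_def)
qed

lemma proj_image_reduced:
  "proj ` {f. Poly_Mapping.keys f \<subseteq> {x \<in> paths. T (fst x) (snd (snd x))}} =
   proj ` {f. Poly_Mapping.keys f \<subseteq> {x \<in> reduced. T (fst x) (snd (snd x))}}"
proof (intro equalityI subsetI)
  fix a assume "a \<in> proj ` {f. Poly_Mapping.keys f \<subseteq> {x \<in> paths. T (fst x) (snd (snd x))}}"
  then obtain f where f: "a = proj f" "Poly_Mapping.keys f \<subseteq> {x \<in> paths. T (fst x) (snd (snd x))}"
    by blast
  then have "a = proj (normal_form \<Gamma> f)" by (subst proj_normal_form) auto
  then show "a \<in> proj ` {f. Poly_Mapping.keys f \<subseteq> {x \<in> reduced. T (fst x) (snd (snd x))}}"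
    using normal_form_ends[OF f(2)] by blast
qed (auto simp: reduced_def)

lemma trivial_mult:
  fixes f :: "('p, 'a \<times> nat) qpath \<Rightarrow>\<^sub>0 'k"
  assumes w: "w \<in> polygons \<Gamma>" and f: "Poly_Mapping.keys f \<subseteq> {x \<in> paths. T (fst x) (snd (snd x))}"
  shows "Poly_Mapping.keys (path_mult (Poly_Mapping.single (w, [], w) 1) f) \<subseteq>
      {x \<in> paths. fst x = w \<and> T (fst x) (snd (snd x))}"
    and "Poly_Mapping.keys (path_mult f (Poly_Mapping.single (w, [], w) 1)) \<subseteq>
      {x \<in> paths. snd (snd x) = w \<and> T (fst x) (snd (snd x))}"
proof -
  have fc: "Poly_Mapping.keys f \<subseteq> paths" using f by auto
  have tc: "Poly_Mapping.keys (Poly_Mapping.single (w, [], w) (1::'k)) \<subseteq> paths"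
    using w by (simp add: trivial_path)
  show "Poly_Mapping.keys (path_mult (Poly_Mapping.single (w, [], w) 1) f) \<subseteq>
      {x \<in> paths. fst x = w \<and> T (fst x) (snd (snd x))}"
  proof
    fix z assume z: "z \<in> Poly_Mapping.keys (path_mult (Poly_Mapping.single (w, [], w) 1) f)"
    then obtain u p v q x where "z = (u, p @ q, x)" "(u, p, v) \<in> Poly_Mapping.keys (Poly_Mapping.single (w, [], w) (1::'k))"
        "(v, q, x) \<in> Poly_Mapping.keys f" by (rule keys_path_mult)
    moreover have "z \<in> paths" using z Q.path_mult_closed[OF tc fc] by blast
    ultimately show "z \<in> {x \<in> paths. fst x = w \<and> T (fst x) (snd (snd x))}" using f by auto
  qed
  show "Poly_Mapping.keys (path_mult f (Poly_Mapping.single (w, [], w) 1)) \<subseteq>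
      {x \<in> paths. snd (snd x) = w \<and> T (fst x) (snd (snd x))}"
  proof
    fix z assume z: "z \<in> Poly_Mapping.keys (path_mult f (Poly_Mapping.single (w, [], w) 1))"
    then obtain u p v q x where "z = (u, p @ q, x)" "(u, p, v) \<in> Poly_Mapping.keys f"
        "(v, q, x) \<in> Poly_Mapping.keys (Poly_Mapping.single (w, [], w) (1::'k))" by (rule keys_path_mult)
    moreover have "z \<in> paths" using z Q.path_mult_closed[OF fc tc] by blast
    ultimately show "z \<in> {x \<in> paths. snd (snd x) = w \<and> T (fst x) (snd (snd x))}" using f by auto
  qed
qed

lemma trivial_mult_id:
  fixes f :: "('p, 'a \<times> nat) qpath \<Rightarrow>\<^sub>0 'k"
  shows "Poly_Mapping.keys f \<subseteq> {x. fst x = w} \<Longrightarrow> path_mult (Poly_Mapping.single (w, [], w) 1) f = f"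
    and "Poly_Mapping.keys f \<subseteq> {x. snd (snd x) = w} \<Longrightarrow> path_mult f (Poly_Mapping.single (w, [], w) 1) = f"
  by (induction rule: poly_mapping_additive_induct; auto simp: path_mult_add)+

lemma carrier_P:
  assumes w: "w \<in> polygons \<Gamma>"
  shows "carrier (split.P w) = proj ` {f. Poly_Mapping.keys f \<subseteq> {x \<in> reduced. fst x = w}}"
proof -
  have "carrier (split.P w) = proj ` {f. Poly_Mapping.keys f \<subseteq> {x \<in> paths. fst x = w}}"
  proof (intro equalityI subsetI)
    fix x assume "x \<in> carrier (split.P w)"
    then obtain f where f: "Poly_Mapping.keys f \<subseteq> paths" "x = brauer_idempotent \<Gamma> w \<otimes>\<^bsub>\<Lambda>\<^esub> proj f"
      by (auto simp: principal_right_module_def carrier_\<Lambda>)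
    then have "x = proj (path_mult (Poly_Mapping.single (w, [], w) 1) f)"
      using w by (simp add: idempotent_eq trivial_path)
    then show "x \<in> proj ` {f. Poly_Mapping.keys f \<subseteq> {x \<in> paths. fst x = w}}"
      using trivial_mult(1)[OF w, of f "\<lambda>_ _. True"] f(1) by auto
  next
    fix x assume "x \<in> proj ` {f. Poly_Mapping.keys f \<subseteq> {x \<in> paths. fst x = w}}"
    then obtain f where f: "Poly_Mapping.keys f \<subseteq> {x \<in> paths. fst x = w}" "x = proj f" by blast
    then have "Poly_Mapping.keys f \<subseteq> paths" "Poly_Mapping.keys f \<subseteq> {x. fst x = w}" by auto
    then show "x \<in> carrier (split.P w)"
      using w f(2) trivial_mult_id(1)[of f w]
      unfolding split.P_mem_iff[OF w] by (simp add: idempotent_eq trivial_path)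
  qed
  then show ?thesis using proj_image_reduced[of "\<lambda>u v. u = w"] by simp
qed

lemma carrier_P_mult:
  assumes w: "w \<in> polygons \<Gamma>" and v: "v \<in> polygons \<Gamma>"
  shows "(\<lambda>x. x \<otimes>\<^bsub>\<Lambda>\<^esub> brauer_idempotent \<Gamma> v) ` carrier (split.P w) =
    proj ` {f. Poly_Mapping.keys f \<subseteq> reduced_between w v}"
proof -
  have "(\<lambda>x. x \<otimes>\<^bsub>\<Lambda>\<^esub> brauer_idempotent \<Gamma> v) ` carrier (split.P w) =
    proj ` {f. Poly_Mapping.keys f \<subseteq> {x \<in> paths. fst x = w \<and> snd (snd x) = v}}"
  proof (intro equalityI subsetI)
    fix x assume "x \<in> (\<lambda>x. x \<otimes>\<^bsub>\<Lambda>\<^esub> brauer_idempotent \<Gamma> v) ` carrier (split.P w)"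
    then obtain f where f: "Poly_Mapping.keys f \<subseteq> {x \<in> reduced. fst x = w}"
        "x = proj f \<otimes>\<^bsub>\<Lambda>\<^esub> brauer_idempotent \<Gamma> v" unfolding carrier_P[OF w] by blast
    then have "Poly_Mapping.keys f \<subseteq> {x \<in> paths. fst x = w}" by (auto simp: reduced_def)
    moreover from this have "x = proj (path_mult f (Poly_Mapping.single (v, [], v) 1))"
      using v f(2) by (subst (asm) idempotent_eq, subst (asm) proj_mult) (auto simp: trivial_path)
    ultimately show "x \<in> proj ` {f. Poly_Mapping.keys f \<subseteq> {x \<in> paths. fst x = w \<and> snd (snd x) = v}}"
      using trivial_mult(2)[OF v, of f "\<lambda>u _. u = w"] by (auto simp: conj_commute)
  next
    fix x assume "x \<in> proj ` {f. Poly_Mapping.keys f \<subseteq> {x \<in> paths. fst x = w \<and> snd (snd x) = v}}"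
    then obtain f where f: "Poly_Mapping.keys f \<subseteq> {x \<in> paths. fst x = w \<and> snd (snd x) = v}" "x = proj f"
      by blast
    then have keys: "Poly_Mapping.keys f \<subseteq> paths" "Poly_Mapping.keys f \<subseteq> {x. fst x = w}"
        "Poly_Mapping.keys f \<subseteq> {x. snd (snd x) = v}" by auto
    then have "x \<in> carrier (split.P w)"
      using w f(2) trivial_mult_id(1)[of f w]
      unfolding split.P_mem_iff[OF w] by (simp add: idempotent_eq trivial_path)
    moreover have "x = x \<otimes>\<^bsub>\<Lambda>\<^esub> brauer_idempotent \<Gamma> v"
      using v f(2) keys trivial_mult_id(2)[of f v] by (simp add: idempotent_eq trivial_path)
    ultimately show "x \<in> (\<lambda>x. x \<otimes>\<^bsub>\<Lambda>\<^esub> brauer_idempotent \<Gamma> v) ` carrier (split.P w)" by blast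
  qed
  then show ?thesis
    using proj_image_reduced[of "\<lambda>a b. a = w \<and> b = v"] by (simp add: reduced_between_def)
qed

text \<open>The row index v names the simple module and the column index w the projective
  \<open>e w \<Lambda>\<close>, so the paths counted run from w to v.\<close>

lemma cartan_entry:
  assumes v: "v \<in> polygons \<Gamma>" and w: "w \<in> polygons \<Gamma>"
  shows "cartan_matrix \<Lambda> split.P v w = card (reduced_between w v)"
proof (rule split.cartan_matrix_eq_dimension[OF v w])
  have "{x \<in> reduced. fst x = w} \<subseteq> (\<Union>v\<in>polygons \<Gamma>. reduced_between w v)"
    using Q.awalk_last_in_verts by (auto simp: reduced_between_def reduced_def quiver_paths_def)
  then have "finite {x \<in> reduced. fst x = w}"
    by (rule finite_subset) (intro finite_UN_I finite_polygons finite_reduced_between w)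
  then show "\<Lambda>.dimension (card {x \<in> reduced. fst x = w}) scalars (carrier (split.P w))"
    unfolding carrier_P[OF w] by (intro dimension_proj) auto
  show "\<Lambda>.dimension (card (reduced_between w v)) scalars
      ((\<lambda>x. x \<otimes>\<^bsub>\<Lambda>\<^esub> brauer_idempotent \<Gamma> v) ` carrier (split.P w))"
    unfolding carrier_P_mult[OF w v] using finite_reduced_between[OF w]
    by (intro dimension_proj) (auto simp: reduced_between_def)
qed

end

section \<open>Truncated vertices in the two sums\<close>

context brauer_configuration
begin

lemma valency_ge_occ_sum:
  assumes "F \<subseteq> polygons \<Gamma>"
  shows "(\<Sum>V\<in>F. occ \<Gamma> \<alpha> V) \<le> valency \<Gamma> \<alpha>"
  unfolding valency_def using assms finite_polygons by (intro sum_mono2) auto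

lemma truncated_occ:
  assumes "\<alpha> \<in> vertices \<Gamma>" "\<alpha> \<notin> nontruncated \<Gamma>"
  shows "mu \<Gamma> \<alpha> = 1" "valency \<Gamma> \<alpha> = 1"
  using assms by (auto simp: nontruncated_def truncated_def)

text \<open>A truncated corner has occ = mu = 1, so its factor occ mu - 1 vanishes; a nontruncated
  vertex outside V contributes zero through occ.\<close>

lemma diagonal_sum:
  assumes V: "V \<in> polygons \<Gamma>"
  shows "(\<Sum>\<alpha>\<in>nontruncated \<Gamma>. int (occ \<Gamma> \<alpha> V) * (int (mu \<Gamma> \<alpha>) * int (occ \<Gamma> \<alpha> V) - 1)) =
    (\<Sum>\<alpha>\<in>set_mset (corners \<Gamma> V). int (occ \<Gamma> \<alpha> V) * (int (occ \<Gamma> \<alpha> V) * int (mu \<Gamma> \<alpha>) - 1))"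
proof -
  have "int (occ \<Gamma> \<alpha> V) * (int (occ \<Gamma> \<alpha> V) * int (mu \<Gamma> \<alpha>) - 1) = 0"
    if \<alpha>: "\<alpha> \<in># corners \<Gamma> V" "\<alpha> \<notin> nontruncated \<Gamma>" for \<alpha>
  proof -
    have "\<alpha> \<in> vertices \<Gamma>" using \<alpha>(1) corners_vertices[OF V] by blast
    moreover have "occ \<Gamma> \<alpha> V > 0" using \<alpha>(1) by (simp add: occ_def)
    ultimately have "occ \<Gamma> \<alpha> V = 1" "mu \<Gamma> \<alpha> = 1"
      using truncated_occ[of \<alpha>] \<alpha>(2) valency_ge_occ_sum[of "{V}" \<alpha>] V by auto
    then show ?thesis by simp
  qed
  moreover have "occ \<Gamma> \<alpha> V = 0" if "\<alpha> \<notin># corners \<Gamma> V" for \<alpha>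
    using that by (simp add: occ_def not_in_iff)
  ultimately show ?thesis
    using finite_nontruncated by (intro sum.mono_neutral_cong) (auto simp: mult.commute)
qed

text \<open>A vertex shared by two distinct polygons has valency at least 2 and is therefore
  nontruncated.\<close>

lemma offdiagonal_sum:
  assumes V: "V \<in> polygons \<Gamma>" and W: "W \<in> polygons \<Gamma>" and "V \<noteq> W"
  shows "(\<Sum>\<alpha>\<in>nontruncated \<Gamma>. int (occ \<Gamma> \<alpha> W) * (int (mu \<Gamma> \<alpha>) * int (occ \<Gamma> \<alpha> V))) =
    (\<Sum>\<alpha>\<in>set_mset (corners \<Gamma> V) \<inter> set_mset (corners \<Gamma> W).
       int (mu \<Gamma> \<alpha>) * int (occ \<Gamma> \<alpha> V) * int (occ \<Gamma> \<alpha> W))"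
proof -
  have "\<alpha> \<in> nontruncated \<Gamma>" if \<alpha>: "\<alpha> \<in># corners \<Gamma> V" "\<alpha> \<in># corners \<Gamma> W" for \<alpha>
  proof (rule ccontr)
    assume "\<alpha> \<notin> nontruncated \<Gamma>"
    moreover have "\<alpha> \<in> vertices \<Gamma>" using \<alpha>(1) corners_vertices[OF V] by blast
    ultimately have "valency \<Gamma> \<alpha> = 1" using truncated_occ by blast
    moreover have "occ \<Gamma> \<alpha> V > 0" "occ \<Gamma> \<alpha> W > 0" using \<alpha> by (simp_all add: occ_def)
    ultimately show False
      using valency_ge_occ_sum[of "{V, W}" \<alpha>] V W \<open>V \<noteq> W\<close> by simp
  qed
  moreover have "occ \<Gamma> \<alpha> U = 0" if "\<alpha> \<notin># corners \<Gamma> U" for \<alpha> U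
    using that by (simp add: occ_def not_in_iff)
  ultimately show ?thesis
    using finite_nontruncated by (intro sum.mono_neutral_cong) (auto simp: ac_simps)
qed

end

theorem mainTheorem2:
  fixes \<Gamma> :: "('a, 'p) brauer_config"
    and V W :: 'p
  assumes "brauer_configuration \<Gamma>"
    and "V \<in> polygons \<Gamma>"
    and "W \<in> polygons \<Gamma>"
  shows "int (brauer_cartan_matrix TYPE('k::alg_closed_field) \<Gamma> V W) =
    (if V = W
     then 2 + (\<Sum>\<alpha>\<in>set_mset (corners \<Gamma> V). int (occ \<Gamma> \<alpha> V) * (int (occ \<Gamma> \<alpha> V) * int (mu \<Gamma> \<alpha>) - 1))
     else (\<Sum>\<alpha>\<in>set_mset (corners \<Gamma> V) \<inter> set_mset (corners \<Gamma> W).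
             int (mu \<Gamma> \<alpha>) * int (occ \<Gamma> \<alpha> V) * int (occ \<Gamma> \<alpha> W)))"
proof -
  \<comment> \<open>V itself witnesses that there is a polygon.\<close>
  interpret brauer_algebra_over \<Gamma> "TYPE('k)"
    using assms by (intro brauer_algebra_over.intro brauer_algebra_over_axioms.intro) auto
  have "brauer_cartan_matrix TYPE('k) \<Gamma> V W = card (reduced_between W V)"
    using cartan_entry[OF assms(2,3)] by (simp add: brauer_cartan_matrix_def Let_def)
  then show ?thesis
    using card_reduced_between[OF assms(3), of V] card_proper_segments[OF assms(3,2)]
      diagonal_sum[OF assms(2)] offdiagonal_sum[OF assms(2,3)]
    by auto
qed

end
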